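(* Let $\alpha:\mathbb{R}\to[c,d]\subset(0,2)$ and $H:\mathbb{R}\to(0,1)$ be continuously differentiable. Let $(\Gamma_i)_{i\ge1}$ be the arrival times of a Poisson process with unit rate, $(V_i)_{i\ge1}$ i.i.d. random variables with distribution $\hat m(dx)=\frac{3}{\pi^2}\sum_{j=1}^{\infty}j^{-2}\mathbf{1}_{[-j,-j+1)\cup[j-1,j)}(x)\,dx$ on $\mathbb{R}$, and $(\gamma_i)_{i\ge1}$ i.i.d. with $P(\gamma_i=1)=P(\gamma_i=-1)=1/2$, the three sequences being independent. Define $$X(t,u)=C_{\alpha(u)}^{1/\alpha(u)}\sum_{i,j=1}^{\infty}\Big(\frac{\pi^2j^2}{3}\Big)^{1/\alpha(u)}\gamma_i\Gamma_i^{-1/\alpha(u)}\Big(|t-V_i|^{H(u)-1/\alpha(u)}-|V_i|^{H(u)-1/\alpha(u)}\Big)\mathbf{1}_{[-j,-j+1)\cup[j-1,j)}(V_i)$$ and the linear multistable multifractional motion $Y(t)=X(t,t)$. Then for all $t\in\mathbb{R}$ and $0<\eta<c$, as $\varepsilon\to0^+$, $$\mathsf{E}\big[|Y(t+\varepsilon)-Y(t)|^\eta\big]\sim\frac{2^{\eta-1}\,\Gamma\big(1-\frac{\eta}{\alpha(t)}\big)}{\eta\int_0^\infty u^{-\eta-1}\sin^2(u)\,du}\left(\int_{\mathbb{R}}\Big||1-x|^{H(t)-\frac1{\alpha(t)}}-|x|^{H(t)-\frac1{\alpha(t)}}\Big|^{\alpha(t)}dx\right)^{\frac{\eta}{\alpha(t)}}\varepsilon^{\eta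 H(t)}.$$
   Context: $C_\eta=\big(\int_0^\infty x^{-\eta}\sin x\,dx\big)^{-1}$ for $\eta\in(0,2)$. $\Gamma(\cdot)$ without index is Euler's Gamma function. $A\sim B$ means that the ratio tends to $1$.
   Formalization: The formal theorem additionally assumes H(t) ≠ 1/α(t) at the given t; when H(t) = 1/α(t) the integral over ℝ is 0, the right-hand side vanishes identically and the ratio in "∼" is undefined. *)

theory Defs
  imports "HOL-Probability.Probability" "HOL-Library.Landau_Symbols"
begin

text \<open>
  The sequences, which are traditionally numbered from 1, are numbered from 0 here: the value at
  \<open>i\<close> is the one with traditional index \<open>Suc i\<close>. The same shift is applied to the cells.
\<close>

text \<open>
  The \<open>n\<close>-th arrival time of a Poisson process is the sum of its first \<open>n\<close> interarrival times, which
  are independent and exponentially distributed.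
\<close>

definition (in prob_space) poisson_arrival_times :: "real \<Rightarrow> (nat \<Rightarrow> 'a \<Rightarrow> real) \<Rightarrow> bool" where
  "poisson_arrival_times rate \<Gamma> \<longleftrightarrow>
    (\<exists>T. indep_vars (\<lambda>_. borel) T UNIV \<and>
         (\<forall>i. distributed M lborel (T i) (exponential_density rate)) \<and>
         (\<forall>i. \<forall>\<omega>\<in>space M. \<Gamma> i \<omega> = (\<Sum>k\<le>i. T k \<omega>)))"

definition (in prob_space) iid_density :: "(real \<Rightarrow> real) \<Rightarrow> (nat \<Rightarrow> 'a \<Rightarrow> real) \<Rightarrow> bool" where
  "iid_density f V \<longleftrightarrow>
    indep_vars (\<lambda>_. borel) V UNIV \<and> (\<forall>i. distributed M lborel (V i) (\<lambda>x. ennreal (f x)))"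

definition (in prob_space) iid_signs :: "(nat \<Rightarrow> 'a \<Rightarrow> real) \<Rightarrow> bool" where
  "iid_signs \<gamma> \<longleftrightarrow>
    indep_vars (\<lambda>_. borel) \<gamma> UNIV \<and>
    (\<forall>i. prob {\<omega>\<in>space M. \<gamma> i \<omega> = 1} = 1/2 \<and> prob {\<omega>\<in>space M. \<gamma> i \<omega> = -1} = 1/2)"

text \<open>
  Independence of whole sequences, each regarded as one random element of the sequence space; nothing
  is said about independence within a sequence.
\<close>

definition (in prob_space) indep_sequences :: "(nat \<Rightarrow> 'a \<Rightarrow> real) list \<Rightarrow> bool" where
  "indep_sequences Xs \<longleftrightarrow>
    indep_vars (\<lambda>_. Pi\<^sub>M UNIV (\<lambda>_. borel)) (\<lambda>k \<omega> i. (Xs ! k) i \<omega>) {..<length Xs}"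

definition cell :: "nat \<Rightarrow> real set" where
  "cell j = {- real (Suc j)..<- real (Suc j) + 1} \<union> {real (Suc j) - 1..<real (Suc j)}"

definition m_hat_density :: "real \<Rightarrow> real" where
  "m_hat_density x = 3 / pi\<^sup>2 * (\<Sum>j. 1 / (real (Suc j))\<^sup>2 * indicator (cell j) x)"

text \<open>
  For \<open>\<eta> \<le> 1\<close> the integral converges only conditionally. The Henstock-Kurzweil integral used here
  covers this improper case, whereas the Lebesgue integral would be 0 by convention.
\<close>

definition C_stable :: "real \<Rightarrow> real" where
  "C_stable \<eta> = inverse (integral {0<..} (\<lambda>x. x powr (- \<eta>) * sin x))"

text \<open>
  The cells partition the real line, so the inner series has at most one nonzero term; the
  outer series converges almost surely, but in general only conditionally. The convention
  \<open>0 powr a = 0\<close> affects only the null events \<open>V i = t\<close> and \<open>V i = 0\<close>.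
\<close>

definition lmmm_field ::
  "(real \<Rightarrow> real) \<Rightarrow> (real \<Rightarrow> real) \<Rightarrow> (nat \<Rightarrow> 'a \<Rightarrow> real) \<Rightarrow> (nat \<Rightarrow> 'a \<Rightarrow> real) \<Rightarrow>
   (nat \<Rightarrow> 'a \<Rightarrow> real) \<Rightarrow> real \<Rightarrow> real \<Rightarrow> 'a \<Rightarrow> real" where
  "lmmm_field \<alpha> H \<Gamma> V \<gamma> t u \<omega> =
    C_stable (\<alpha> u) powr (1 / \<alpha> u) *
    (\<Sum>i. \<Sum>j. (pi\<^sup>2 * (real (Suc j))\<^sup>2 / 3) powr (1 / \<alpha> u) * \<gamma> i \<omega> * \<Gamma> i \<omega> powr (- 1 / \<alpha> u) *
       (\<bar>t - V i \<omega>\<bar> powr (H u - 1 / \<alpha> u) - \<bar>V i \<omega>\<bar> powr (H u - 1 / \<alpha> u)) *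
       indicator (cell j) (V i \<omega>))"

definition lmmm ::
  "(real \<Rightarrow> real) \<Rightarrow> (real \<Rightarrow> real) \<Rightarrow> (nat \<Rightarrow> 'a \<Rightarrow> real) \<Rightarrow> (nat \<Rightarrow> 'a \<Rightarrow> real) \<Rightarrow>
   (nat \<Rightarrow> 'a \<Rightarrow> real) \<Rightarrow> real \<Rightarrow> 'a \<Rightarrow> real" where
  "lmmm \<alpha> H \<Gamma> V \<gamma> t = lmmm_field \<alpha> H \<Gamma> V \<gamma> t t"

end

theory Submission
  imports Defs
begin

text \<open>
  For fixed parameters the field is a LePage series \<open>\<Sum>i. \<gamma> i * a (\<Gamma> i, V i)\<close>. Since the signs are
  independent of everything else, such a series behaves in \<open>L\<^sup>p\<close>, \<open>p \<le> 2\<close>, as if its terms were orthogonal, and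
  Campbell's formula bounds its moments by integrals of \<open>\<bar>a\<bar> powr p\<close>. Conditioning on the next
  interarrival time gives its characteristic function without using order statistics. For
  \<open>a (x, v) = x powr (- 1 / r) * k v\<close> it is \<open>r\<close>-stable, and integrating \<open>1 - cos\<close> against a power yields the
  exact absolute moment.

  The increment \<open>Y (t + \<epsilon>) - Y t\<close> equals the increment in the first argument of the field with parameters
  frozen at \<open>t\<close>, whose \<open>\<eta>\<close>-th moment is exactly the right-hand side by scaling, plus the effect of
  changing the parameters. As \<open>\<alpha>\<close> and \<open>H\<close> are Lipschitz at \<open>t\<close>, the latter has \<open>\<eta>\<close>-th moment of order
  \<open>\<epsilon> powr \<eta>\<close>, which is negligible because \<open>H t < 1\<close>.
\<close>

section \<open>Rademacher series\<close>

text \<open>No single moment order controls a stable series. Its coefficients behave like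
  \<open>x powr (- 1 / r)\<close> in the arrival time, and the \<open>p\<close>-th power of this is
  integrable at 0 only for \<open>p < r\<close> and at infinity only for \<open>p > r\<close>; hence
  two orders \<open>\<eta> < r < p\<close>. A change of the exponents brings in logarithms of
  arrival time, mark and cell weight. They are absorbed by widening every exponent by
  \<open>\<delta>\<close>, which leaves the cell weight with a power slightly above
  \<open>1 / r\<close>; the decay of the kernel increment, available because \<open>H t < 1\<close>,
  pays for it. The constants fit together: the density of the marks is the reciprocal of the cell
  weight, and \<open>C_stable\<close> is the reciprocal of the scale constant of the stable law, so
  only the norm of the kernel increment survives. The leading coefficient must come out as exactly 1
  also for \<open>\<eta> < 1\<close>, where no triangle inequality for norms is at hand; therefore
  sums are compared with weights \<open>(1 + d) powr \<eta>\<close> and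
  \<open>(1 + 1 / d) powr \<eta>\<close> for a free \<open>d\<close>.\<close>

lemma powr_add_le_add_powr:
  fixes x y q :: real
  assumes "0 \<le> x" "0 \<le> y" "0 < q" "q \<le> 1"
  shows "(x + y) powr q \<le> x powr q + y powr q"
proof (cases "x + y = 0")
  case False
  then have s: "x + y > 0" using assms by auto
  \<comment> \<open>A share of the total lies in the unit interval, where a power at most 1 can only
    increase it; the two shares add up to 1.\<close>
  have *: "u / (x + y) \<le> (u / (x + y)) powr q" if "0 \<le> u" "u \<le> x + y" for u
  proof (cases "u = 0")
    case False
    have "(u / (x + y)) powr 1 \<le> (u / (x + y)) powr q"
      using that s False assms by (intro powr_mono') auto
    then show ?thesis using that s False by auto
  qed auto
  have "1 = x / (x + y) + y / (x + y)" using s by (simp add: add_divide_distrib[symmetric])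
  also have "\<dots> \<le> (x / (x + y)) powr q + (y / (x + y)) powr q"
    using *[of x] *[of y] assms by auto
  also have "\<dots> = (x powr q + y powr q) / (x + y) powr q"
    using assms s by (simp add: powr_divide add_divide_distrib)
  finally show ?thesis using s by (simp add: field_simps)
qed (use assms in auto)

text \<open>Concavity: both values lie below the tangent at the mean \<open>m\<close>, and the
  linear terms cancel in the sum. The tangent bound is Young's inequality with weights
  \<open>q\<close> and \<open>1 - q\<close>.\<close>

lemma powr_mean_le:
  fixes u v q :: real
  assumes "0 \<le> u" "0 \<le> v" "0 < q" "q \<le> 1"
  shows "u powr q + v powr q \<le> 2 * ((u + v) / 2) powr q"
proof (cases "u + v = 0")
  case False
  define m where "m = (u + v) / 2"
  have m: "m > 0" using False assms by (auto simp: m_def)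
  have *: "w powr q \<le> m powr q * (1 + q * (w / m - 1))" if "0 \<le> w" for w
  proof (cases "w = 0")
    case True
    then show ?thesis using assms m by (simp add: mult_nonneg_nonneg)
  next
    case False
    then have "(w / m) powr q \<le> q * (w / m) + (1 - q) * 1"
      using Youngs_inequality_0[of q "1 - q" "w / m" 1] that m assms by auto
    then have "m powr q * (w / m) powr q \<le> m powr q * (1 + q * (w / m - 1))"
      by (intro mult_left_mono) (auto simp: algebra_simps)
    then show ?thesis using m that by (simp add: powr_divide)
  qed
  have "u powr q + v powr q \<le> m powr q * (1 + q * (u / m - 1)) + m powr q * (1 + q * (v / m - 1))"
    using *[of u] *[of v] assms by auto
  also have "\<dots> = m powr q * (2 + q * ((u + v) / m - 2))"
    by (simp add: algebra_simps add_divide_distrib)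
  also have "(u + v) / m = 2" using m by (simp add: m_def field_simps)
  finally show ?thesis by (simp add: m_def)
qed (use assms in \<open>auto simp: add_nonneg_eq_0_iff\<close>)

text \<open>For \<open>p = 2\<close> this is the parallelogram identity. Smaller orders follow on
  writing each term as a square to the power \<open>p / 2\<close>, at most 1: concavity, then the
  identity, then subadditivity. It replaces orthogonality when \<open>p < 2\<close>.\<close>

lemma powr_abs_parallelogram:
  fixes x a p :: real
  assumes "0 < p" "p \<le> 2"
  shows "\<bar>x + a\<bar> powr p + \<bar>x - a\<bar> powr p \<le> 2 * (\<bar>x\<bar> powr p + \<bar>a\<bar> powr p)"
proof -
  have sq: "\<bar>y\<bar> powr p = (y\<^sup>2) powr (p / 2)" for y :: real
  proof (cases "y = 0")
    case False
    have "\<bar>y\<bar> powr p = (\<bar>y\<bar> powr 2) powr (p / 2)" by (subst powr_powr) simp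
    also have "\<bar>y\<bar> powr 2 = y\<^sup>2" using False by (simp add: powr_numeral)
    finally show ?thesis .
  qed (use assms in auto)
  have "((x + a)\<^sup>2) powr (p / 2) + ((x - a)\<^sup>2) powr (p / 2) \<le> 2 * (((x + a)\<^sup>2 + (x - a)\<^sup>2) / 2) powr (p / 2)"
    using assms by (intro powr_mean_le) auto
  also have "((x + a)\<^sup>2 + (x - a)\<^sup>2) / 2 = x\<^sup>2 + a\<^sup>2" by (simp add: power2_eq_square algebra_simps)
  also have "2 * (x\<^sup>2 + a\<^sup>2) powr (p / 2) \<le> 2 * ((x\<^sup>2) powr (p / 2) + (a\<^sup>2) powr (p / 2))"
    using assms by (intro mult_left_mono powr_add_le_add_powr) auto
  finally show ?thesis by (simp add: sq)
qed

text \<open>\<open>F n\<close> holds what is known just before the sign \<open>n\<close> is drawn.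
  \<open>fair\<close> expresses in one condition that this sign is symmetric and independent of
  \<open>F n\<close>; other values than 1 and -1 may occur on a null set.\<close>

locale rademacher_filtration = prob_space M for M :: "'a measure" +
  fixes F :: "nat \<Rightarrow> 'a measure" and \<gamma> :: "nat \<Rightarrow> 'a \<Rightarrow> real"
  assumes subalg: "subalgebra M (F n)"
    and sets_mono: "n \<le> m \<Longrightarrow> sets (F n) \<subseteq> sets (F m)"
    and adapted: "\<gamma> n \<in> borel_measurable (F (Suc n))"
    and fair: "A \<in> sets (F n) \<Longrightarrow> \<sigma> \<in> {1, -1} \<Longrightarrow> prob {\<omega>\<in>A. \<gamma> n \<omega> = \<sigma>} = prob A / 2"
begin

lemma space_F [simp]: "space (F n) = space M"
  using subalg by (auto simp: subalgebra_def)

lemma measurable_F_M: "f \<in> measurable (F n) N \<Longrightarrow> f \<in> measurable M N"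
  using measurable_from_subalg subalg by blast

lemma measurable_F_mono: "n \<le> m \<Longrightarrow> f \<in> measurable (F n) N \<Longrightarrow> f \<in> measurable (F m) N"
  using measurable_mono[of N N "F n" "F m"] sets_mono by auto

lemma sign_measurable [measurable]: "\<gamma> n \<in> borel_measurable M"
  using measurable_F_M adapted by blast

lemma AE_sign: "AE \<omega> in M. \<gamma> n \<omega> = 1 \<or> \<gamma> n \<omega> = -1"
proof -
  have "prob {\<omega>\<in>space M. \<gamma> n \<omega> = \<sigma>} = 1 / 2" if "\<sigma> \<in> {1, -1}" for \<sigma>
  proof -
    have "space M \<in> sets (F n)" using sets.top[of "F n"] by simp
    from fair[OF this that] show ?thesis by (simp only: prob_space)
  qed
  from this[of 1] this[of "-1"]
  have "prob ({\<omega>\<in>space M. \<gamma> n \<omega> = 1} \<union> {\<omega>\<in>space M. \<gamma> n \<omega> = -1}) = 1"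
    by (subst finite_measure_Union) (simp_all add: disjoint_iff)
  then have "AE \<omega> in M. \<omega> \<in> {\<omega>\<in>space M. \<gamma> n \<omega> = 1} \<union> {\<omega>\<in>space M. \<gamma> n \<omega> = -1}"
    using AE_prob_1 by blast
  then show ?thesis by eventually_elim auto
qed

text \<open>Under the density \<open>2 * indicator {\<sigma>} (\<gamma> n \<omega>)\<close> every
  event of \<open>F n\<close> keeps its probability. The new measure and \<open>M\<close> therefore
  integrate functions measurable in \<open>F n\<close> alike, and no conditional expectation has to
  be formed.\<close>

lemma nn_integral_sign:
  assumes g: "g \<in> borel_measurable (F n)" and \<sigma>: "\<sigma> \<in> {1, -1}"
  shows "2 * (\<integral>\<^sup>+\<omega>. g \<omega> * indicator {\<sigma>} (\<gamma> n \<omega>) \<partial>M) = (\<integral>\<^sup>+\<omega>. g \<omega> \<partial>M)"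
proof -
  let ?d = "\<lambda>\<omega>. 2 * indicator {\<sigma>} (\<gamma> n \<omega>) :: ennreal"
  have d[measurable]: "?d \<in> borel_measurable M"
    by measurable
  define N where "N = density M ?d"
  have subN: "subalgebra N (F n)" using subalg by (auto simp: N_def subalgebra_def)
  have "emeasure N A = emeasure M A" if A: "A \<in> sets (F n)" for A
  proof -
    have AM[measurable]: "A \<in> sets M" using A subalg by (auto simp: subalgebra_def)
    have "emeasure N A = (\<integral>\<^sup>+\<omega>. ?d \<omega> * indicator A \<omega> \<partial>M)"
      by (simp add: N_def emeasure_density)
    also have "\<dots> = (\<integral>\<^sup>+\<omega>. 2 * indicator {\<omega>\<in>A. \<gamma> n \<omega> = \<sigma>} \<omega> \<partial>M)"
      by (intro nn_integral_cong) (auto simp: indicator_def)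
    also have "\<dots> = 2 * emeasure M {\<omega>\<in>A. \<gamma> n \<omega> = \<sigma>}"
    proof (rule nn_integral_cmult_indicator)
      have "{\<omega>\<in>A. \<gamma> n \<omega> = \<sigma>} = A \<inter> {\<omega>\<in>space M. \<gamma> n \<omega> = \<sigma>}"
        using sets.sets_into_space[OF AM] by auto
      then show "{\<omega>\<in>A. \<gamma> n \<omega> = \<sigma>} \<in> sets M" by simp
    qed
    also have "\<dots> = ennreal (2 * (prob A / 2))"
      unfolding emeasure_eq_measure fair[OF A \<sigma>] by (subst ennreal_mult) auto
    also have "\<dots> = emeasure M A" by (simp add: emeasure_eq_measure)
    finally show ?thesis .
  qed
  then have "restr_to_subalg N (F n) = restr_to_subalg M (F n)"
    using subN subalg
    by (intro measure_eqI) (auto simp: sets_restr_to_subalg emeasure_restr_to_subalg)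
  then have "(\<integral>\<^sup>+\<omega>. g \<omega> \<partial>N) = (\<integral>\<^sup>+\<omega>. g \<omega> \<partial>M)"
    using nn_integral_subalgebra2[OF subN g] nn_integral_subalgebra2[OF subalg g] by simp
  moreover have "(\<integral>\<^sup>+\<omega>. g \<omega> \<partial>N) = (\<integral>\<^sup>+\<omega>. ?d \<omega> * g \<omega> \<partial>M)"
    unfolding N_def using measurable_F_M[OF g] d by (intro nn_integral_density) auto
  moreover have "(\<integral>\<^sup>+\<omega>. ?d \<omega> * g \<omega> \<partial>M) = (\<integral>\<^sup>+\<omega>. 2 * (g \<omega> * indicator {\<sigma>} (\<gamma> n \<omega>)) \<partial>M)"
    by (intro nn_integral_cong) (simp add: mult_ac)
  moreover have "\<dots> = 2 * (\<integral>\<^sup>+\<omega>. g \<omega> * indicator {\<sigma>} (\<gamma> n \<omega>) \<partial>M)"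
    using measurable_F_M[OF g] measurable_compose[OF sign_measurable borel_measurable_indicator, of "{\<sigma>}" n]
    by (intro nn_integral_cmult borel_measurable_times) auto
  ultimately show ?thesis by simp
qed

lemma nn_integral_sign_average:
  assumes g: "\<And>\<sigma>. \<sigma> \<in> {1, -1} \<Longrightarrow> (\<lambda>\<omega>. g \<omega> \<sigma>) \<in> borel_measurable (F n)"
  shows "2 * (\<integral>\<^sup>+\<omega>. g \<omega> (\<gamma> n \<omega>) \<partial>M) = (\<integral>\<^sup>+\<omega>. g \<omega> 1 + g \<omega> (-1) \<partial>M)"
proof -
  have [measurable]: "(\<lambda>\<omega>. g \<omega> 1) \<in> borel_measurable M" "(\<lambda>\<omega>. g \<omega> (-1)) \<in> borel_measurable M"
    using measurable_F_M[OF g] by auto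
  have "(\<integral>\<^sup>+\<omega>. g \<omega> (\<gamma> n \<omega>) \<partial>M) = (\<integral>\<^sup>+\<omega>. g \<omega> 1 * indicator {1} (\<gamma> n \<omega>)
      + g \<omega> (-1) * indicator {-1} (\<gamma> n \<omega>) \<partial>M)"
    by (intro nn_integral_cong_AE, rule AE_mp[OF AE_sign[of n]]) (auto simp: indicator_def)
  also have "\<dots> = (\<integral>\<^sup>+\<omega>. g \<omega> 1 * indicator {1} (\<gamma> n \<omega>) \<partial>M)
      + (\<integral>\<^sup>+\<omega>. g \<omega> (-1) * indicator {-1} (\<gamma> n \<omega>) \<partial>M)"
    by (intro nn_integral_add) measurable
  finally have "2 * (\<integral>\<^sup>+\<omega>. g \<omega> (\<gamma> n \<omega>) \<partial>M) = (\<integral>\<^sup>+\<omega>. g \<omega> 1 \<partial>M) + (\<integral>\<^sup>+\<omega>. g \<omega> (-1) \<partial>M)"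
    using nn_integral_sign[of "\<lambda>\<omega>. g \<omega> 1" n 1] nn_integral_sign[of "\<lambda>\<omega>. g \<omega> (-1)" n "-1"] g
    by (simp add: distrib_left)
  then show ?thesis by (simp add: nn_integral_add)
qed

lemma measurable_partial_sum:
  assumes "\<And>i. i < n \<Longrightarrow> a i \<in> borel_measurable (F i)"
  shows "(\<lambda>\<omega>. \<Sum>i<n. \<gamma> i \<omega> * a i \<omega>) \<in> borel_measurable (F n)"
proof (intro borel_measurable_sum borel_measurable_times)
  fix i assume i: "i \<in> {..<n}"
  show "\<gamma> i \<in> borel_measurable (F n)" using i by (intro measurable_F_mono[OF _ adapted]) auto
  show "a i \<in> borel_measurable (F n)" using i by (intro measurable_F_mono[OF _ assms]) auto
qed

text \<open>Given \<open>F n\<close>, the next sum is \<open>S + a n\<close> or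
  \<open>S - a n\<close> with equal weight, and \<open>powr_abs_parallelogram\<close> bounds the
  average of the two powers without cross terms.\<close>

lemma Lp_partial_sum:
  assumes a: "\<And>i. a i \<in> borel_measurable (F i)" and p: "0 < p" "p \<le> 2"
  shows "(\<integral>\<^sup>+\<omega>. ennreal (\<bar>\<Sum>i<n. \<gamma> i \<omega> * a i \<omega>\<bar> powr p) \<partial>M)
    \<le> (\<Sum>i<n. \<integral>\<^sup>+\<omega>. ennreal (\<bar>a i \<omega>\<bar> powr p) \<partial>M)"
proof (induction n)
  case (Suc n)
  define S where "S = (\<lambda>\<omega>. \<Sum>i<n. \<gamma> i \<omega> * a i \<omega>)"
  have [measurable]: "S \<in> borel_measurable (F n)" "a n \<in> borel_measurable (F n)"
    using measurable_partial_sum[of n a] a by (auto simp: S_def)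
  have [measurable]: "S \<in> borel_measurable M" "a n \<in> borel_measurable M"
    by (rule measurable_F_M[of _ n]; measurable)+
  have "2 * (\<integral>\<^sup>+\<omega>. ennreal (\<bar>S \<omega> + \<gamma> n \<omega> * a n \<omega>\<bar> powr p) \<partial>M)
      = (\<integral>\<^sup>+\<omega>. ennreal (\<bar>S \<omega> + 1 * a n \<omega>\<bar> powr p) + ennreal (\<bar>S \<omega> + (-1) * a n \<omega>\<bar> powr p) \<partial>M)"
    by (rule nn_integral_sign_average) measurable
  also have "\<dots> \<le> (\<integral>\<^sup>+\<omega>. 2 * (ennreal (\<bar>S \<omega>\<bar> powr p) + ennreal (\<bar>a n \<omega>\<bar> powr p)) \<partial>M)"
  proof (rule nn_integral_mono)
    fix \<omega>
    have "ennreal (\<bar>S \<omega> + 1 * a n \<omega>\<bar> powr p) + ennreal (\<bar>S \<omega> + (-1) * a n \<omega>\<bar> powr p)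
        = ennreal (\<bar>S \<omega> + a n \<omega>\<bar> powr p + \<bar>S \<omega> - a n \<omega>\<bar> powr p)" by simp
    also have "\<dots> \<le> ennreal (2 * (\<bar>S \<omega>\<bar> powr p + \<bar>a n \<omega>\<bar> powr p))"
      using p by (intro ennreal_leI powr_abs_parallelogram)
    also have "\<dots> = 2 * (ennreal (\<bar>S \<omega>\<bar> powr p) + ennreal (\<bar>a n \<omega>\<bar> powr p))"
      by (subst ennreal_mult) auto
    finally show "ennreal (\<bar>S \<omega> + 1 * a n \<omega>\<bar> powr p) + ennreal (\<bar>S \<omega> + (-1) * a n \<omega>\<bar> powr p) \<le> \<dots>" .
  qed
  also have "\<dots> = 2 * ((\<integral>\<^sup>+\<omega>. ennreal (\<bar>S \<omega>\<bar> powr p) \<partial>M) + (\<integral>\<^sup>+\<omega>. ennreal (\<bar>a n \<omega>\<bar> powr p) \<partial>M))"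
    by (subst nn_integral_cmult, measurable, subst nn_integral_add) auto
  finally have "(\<integral>\<^sup>+\<omega>. ennreal (\<bar>S \<omega> + \<gamma> n \<omega> * a n \<omega>\<bar> powr p) \<partial>M)
     \<le> (\<integral>\<^sup>+\<omega>. ennreal (\<bar>S \<omega>\<bar> powr p) \<partial>M) + (\<integral>\<^sup>+\<omega>. ennreal (\<bar>a n \<omega>\<bar> powr p) \<partial>M)"
    by (subst (asm) ennreal_mult_le_mult_iff) auto
  then show ?case using Suc by (auto simp: S_def intro: order_trans add_right_mono)
qed simp

text \<open>The partial sums are stopped at the first time they exceed \<open>\<lambda>\<close>: the stopped sums are again of the
  form covered by the moment bound, since the stopping event is predictable.\<close>

lemma maximal_inequality:
  assumes a: "\<And>i. a i \<in> borel_measurable (F i)" and l: "0 < l"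
  shows "emeasure M {\<omega>\<in>space M. \<exists>k\<le>n. l \<le> \<bar>\<Sum>i<k. \<gamma> i \<omega> * a i \<omega>\<bar>}
    \<le> (\<Sum>i<n. \<integral>\<^sup>+\<omega>. ennreal ((a i \<omega>)\<^sup>2) \<partial>M) / ennreal (l\<^sup>2)"
proof -
  define S where "S k \<omega> = (\<Sum>i<k. \<gamma> i \<omega> * a i \<omega>)" for k \<omega>
  define b where "b i \<omega> = (if \<forall>k\<le>i. \<bar>S k \<omega>\<bar> < l then a i \<omega> else 0)" for i \<omega>
  have Sm: "S k \<in> borel_measurable (F i)" if "k \<le> i" for k i
    using measurable_F_mono[OF that measurable_partial_sum[of k a]] a by (simp add: S_def[abs_def])
  have [measurable]: "S k \<in> borel_measurable M" "a k \<in> borel_measurable M" for k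
    using Sm[of k k] a[of k] measurable_F_M[of _ k] by auto
  have b: "b i \<in> borel_measurable (F i)" for i
  proof -
    have [measurable]: "{\<omega>\<in>space (F i). \<forall>k\<in>{..i}. \<bar>S k \<omega>\<bar> < l} \<in> sets (F i)"
    proof (intro sets.sets_Collect_finite_All)
      fix k assume "k \<in> {..i}"
      then have [measurable]: "S k \<in> borel_measurable (F i)" by (intro Sm) auto
      show "{\<omega>\<in>space (F i). \<bar>S k \<omega>\<bar> < l} \<in> sets (F i)" by measurable
    qed auto
    have "(\<lambda>\<omega>. if \<omega> \<in> {\<omega>\<in>space (F i). \<forall>k\<in>{..i}. \<bar>S k \<omega>\<bar> < l} then a i \<omega> else 0) \<in> borel_measurable (F i)"
      using a by measurable
    then show ?thesis by (rule measurable_cong[THEN iffD1, rotated]) (auto simp: b_def)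
  qed
  define R where "R k \<omega> = (\<Sum>i<k. \<gamma> i \<omega> * b i \<omega>)" for k \<omega>
  have R_eq: "R k \<omega> = S k \<omega>" if "\<forall>j<k. \<bar>S j \<omega>\<bar> < l" for k \<omega>
    unfolding R_def S_def using that by (intro sum.cong) (auto simp: b_def)
  have R_stop: "l \<le> \<bar>R n \<omega>\<bar>" if "k \<le> n" "l \<le> \<bar>S k \<omega>\<bar>" for k \<omega>
  proof -
    define m where "m = (LEAST k. l \<le> \<bar>S k \<omega>\<bar>)"
    have m: "l \<le> \<bar>S m \<omega>\<bar>" "m \<le> k" unfolding m_def using that(2) by (auto intro: LeastI Least_le)
    have lt: "\<bar>S j \<omega>\<bar> < l" if "j < m" for j
      using not_less_Least[of j "\<lambda>k. l \<le> \<bar>S k \<omega>\<bar>"] that by (auto simp: m_def)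
    have "R n \<omega> = R m \<omega>" unfolding R_def
    proof (rule sum.mono_neutral_right)
      show "\<forall>i\<in>{..<n} - {..<m}. \<gamma> i \<omega> * b i \<omega> = 0"
      proof
        fix i assume "i \<in> {..<n} - {..<m}"
        then have "m \<le> i" by auto
        with m(1) have "\<not> (\<forall>k\<le>i. \<bar>S k \<omega>\<bar> < l)" by (auto simp: not_less)
        then show "\<gamma> i \<omega> * b i \<omega> = 0" unfolding b_def by (simp only: if_False mult_zero_right)
      qed
      show "{..<m} \<subseteq> {..<n}" using m(2) that(1) by simp
    qed simp
    also have "R m \<omega> = S m \<omega>" using lt by (intro R_eq) simp
    finally show ?thesis using m(1) by simp
  qed
  have [measurable]: "b k \<in> borel_measurable M" for k using b[of k] measurable_F_M[of _ k] by auto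
  have [measurable]: "R n \<in> borel_measurable M" unfolding R_def[abs_def] by measurable
  have "emeasure M {\<omega>\<in>space M. \<exists>k\<le>n. l \<le> \<bar>S k \<omega>\<bar>} \<le> emeasure M {\<omega>\<in>space M. l \<le> \<bar>R n \<omega>\<bar>}"
    using R_stop by (intro emeasure_mono) auto
  also have "\<dots> \<le> emeasure M {\<omega>\<in>space M. 1 \<le> ennreal (1 / l\<^sup>2) * ennreal (\<bar>R n \<omega>\<bar> powr 2)}"
  proof (intro emeasure_mono, safe)
    fix \<omega> assume *: "l \<le> \<bar>R n \<omega>\<bar>"
    then have "l\<^sup>2 \<le> \<bar>R n \<omega>\<bar>\<^sup>2" using l by (intro power_mono) auto
    then have "1 \<le> 1 / l\<^sup>2 * \<bar>R n \<omega>\<bar> powr 2" using l * by (simp add: powr_numeral)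
    then show "1 \<le> ennreal (1 / l\<^sup>2) * ennreal (\<bar>R n \<omega>\<bar> powr 2)"
      by (simp add: ennreal_mult[symmetric])
  qed measurable
  also have "\<dots> \<le> ennreal (1 / l\<^sup>2) * (\<integral>\<^sup>+\<omega>. ennreal (\<bar>R n \<omega>\<bar> powr 2) * indicator (space M) \<omega> \<partial>M)"
  proof -
    have "emeasure M ({\<omega>\<in>space M. 1 \<le> ennreal (1 / l\<^sup>2) * ennreal (\<bar>R n \<omega>\<bar> powr 2)} \<inter> space M)
      \<le> ennreal (1 / l\<^sup>2) * (\<integral>\<^sup>+\<omega>. ennreal (\<bar>R n \<omega>\<bar> powr 2) * indicator (space M) \<omega> \<partial>M)"
      using nn_integral_Markov_inequality[of "\<lambda>\<omega>. ennreal (\<bar>R n \<omega>\<bar> powr 2)" "space M" M "ennreal (1/l\<^sup>2)"]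
      by (simp add: Int_def conj_commute)
    moreover have "{\<omega>\<in>space M. 1 \<le> ennreal (1 / l\<^sup>2) * ennreal (\<bar>R n \<omega>\<bar> powr 2)} \<inter> space M
        = {\<omega>\<in>space M. 1 \<le> ennreal (1 / l\<^sup>2) * ennreal (\<bar>R n \<omega>\<bar> powr 2)}" by blast
    ultimately show ?thesis by argo
  qed
  also have "(\<integral>\<^sup>+\<omega>. ennreal (\<bar>R n \<omega>\<bar> powr 2) * indicator (space M) \<omega> \<partial>M)
      \<le> (\<Sum>i<n. \<integral>\<^sup>+\<omega>. ennreal (\<bar>b i \<omega>\<bar> powr 2) \<partial>M)"
    using Lp_partial_sum[of b 2 n] b by (simp add: R_def cong: nn_integral_cong)
  also have "\<dots> \<le> (\<Sum>i<n. \<integral>\<^sup>+\<omega>. ennreal ((a i \<omega>)\<^sup>2) \<partial>M)"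
    by (intro sum_mono nn_integral_mono ennreal_leI) (auto simp: b_def)
  finally have "emeasure M {\<omega>\<in>space M. \<exists>k\<le>n. l \<le> \<bar>S k \<omega>\<bar>}
    \<le> ennreal (1 / l\<^sup>2) * (\<Sum>i<n. \<integral>\<^sup>+\<omega>. ennreal ((a i \<omega>)\<^sup>2) \<partial>M)"
    by (simp add: mult_left_mono)
  moreover have "ennreal (1 / l\<^sup>2) * X = X / ennreal (l\<^sup>2)" for X
    using l by (simp add: divide_ennreal_def inverse_ennreal inverse_eq_divide mult.commute)
  ultimately show ?thesis by (simp only: S_def)
qed


text \<open>Cauchy's criterion: by the maximal inequality the probability that block sums started at
  \<open>N\<close> ever reach size \<open>l\<close> is at most the tail of the series of second
  moments divided by \<open>l\<^sup>2\<close>, which vanishes as \<open>N\<close> grows.\<close>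

lemma AE_summable_L2:
  assumes a: "\<And>i. a i \<in> borel_measurable (F i)"
    and fin: "(\<Sum>i. \<integral>\<^sup>+\<omega>. ennreal ((a i \<omega>)\<^sup>2) \<partial>M) < \<infinity>"
  shows "AE \<omega> in M. summable (\<lambda>i. \<gamma> i \<omega> * a i \<omega>)"
proof -
  define e where "e i = (\<integral>\<^sup>+\<omega>. ennreal ((a i \<omega>)\<^sup>2) \<partial>M)" for i
  define osc where "osc l N \<omega> \<longleftrightarrow> (\<exists>n. l \<le> \<bar>\<Sum>i\<in>{N..<N+n}. \<gamma> i \<omega> * a i \<omega>\<bar>)" for l :: real and N \<omega>
  have [measurable]: "a i \<in> borel_measurable M" for i using measurable_F_M[OF a] .
  have [measurable]: "Measurable.pred M (osc l N)" for l N
    unfolding osc_def[abs_def] by measurable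
  have osc_le: "emeasure M {\<omega>\<in>space M. osc l N \<omega>} \<le> (\<Sum>i. e (i + N)) / ennreal (l\<^sup>2)" if l: "0 < l" for l N
  proof -
    \<comment> \<open>Deleting the first \<open>N\<close> coefficients turns block sums from
      \<open>N\<close> on into initial sums, as the maximal inequality requires, and keeps
      predictability.\<close>
    define b where "b i \<omega> = (if N \<le> i then a i \<omega> else 0)" for i \<omega>
    have b: "b i \<in> borel_measurable (F i)" for i
      using a[of i] unfolding b_def[abs_def] by (cases "N \<le> i") simp_all
    define A where "A n = {\<omega>\<in>space M. \<exists>k\<le>n. l \<le> \<bar>\<Sum>i<k. \<gamma> i \<omega> * b i \<omega>\<bar>}" for n
    have [measurable]: "b i \<in> borel_measurable M" for i using measurable_F_M[OF b] .
    have Am: "A n \<in> sets M" for n unfolding A_def by measurable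
    have sum_b: "(\<Sum>i<N+n. \<gamma> i \<omega> * b i \<omega>) = (\<Sum>i\<in>{N..<N+n}. \<gamma> i \<omega> * a i \<omega>)" for n \<omega>
      by (rule sum.mono_neutral_cong_right) (auto simp: b_def)
    have "emeasure M {\<omega>\<in>space M. osc l N \<omega>} \<le> emeasure M (\<Union>n. A n)"
    proof (rule emeasure_mono)
      show "{\<omega>\<in>space M. osc l N \<omega>} \<subseteq> (\<Union>n. A n)"
        unfolding osc_def A_def sum_b[symmetric] by auto
    qed (use Am in auto)
    also have "\<dots> = (SUP n. emeasure M (A n))"
    proof (rule SUP_emeasure_incseq[symmetric])
      show "range A \<subseteq> sets M" using Am by auto
      show "incseq A" unfolding incseq_def A_def by (auto intro: order_trans)
    qed
    also have "\<dots> \<le> (\<Sum>i. e (i + N)) / ennreal (l\<^sup>2)"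
    proof (rule SUP_least)
      fix n
      have "emeasure M (A n) \<le> (\<Sum>i<n. \<integral>\<^sup>+\<omega>. ennreal ((b i \<omega>)\<^sup>2) \<partial>M) / ennreal (l\<^sup>2)"
        unfolding A_def by (rule maximal_inequality[OF b l])
      also have "(\<Sum>i<n. \<integral>\<^sup>+\<omega>. ennreal ((b i \<omega>)\<^sup>2) \<partial>M) \<le> (\<Sum>i\<in>{N..<N+n}. e i)"
      proof -
        have "(\<Sum>i<n. \<integral>\<^sup>+\<omega>. ennreal ((b i \<omega>)\<^sup>2) \<partial>M) = (\<Sum>i\<in>{N..<n}. e i)"
          by (rule sum.mono_neutral_cong_right) (auto simp: b_def e_def)
        also have "\<dots> \<le> (\<Sum>i\<in>{N..<N+n}. e i)" by (intro sum_mono2) auto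
        finally show ?thesis .
      qed
      also have "(\<Sum>i\<in>{N..<N+n}. e i) = (\<Sum>i<n. e (i + N))"
        using sum.shift_bounds_nat_ivl[of e 0 N n] by (simp add: atLeast0LessThan add.commute)
      also have "\<dots> \<le> (\<Sum>i. e (i + N))"
        by (intro sum_le_suminf) auto
      finally show "emeasure M (A n) \<le> (\<Sum>i. e (i + N)) / ennreal (l\<^sup>2)"
        by (simp add: divide_right_mono_ennreal)
    qed
    finally show ?thesis .
  qed
  have tail: "(\<lambda>N. \<Sum>i. e (i + N)) \<longlonglongrightarrow> 0"
  proof -
    have fin': "e i < \<infinity>" for i
      using fin sum_le_suminf[of e "{i}"] by (auto simp: e_def[symmetric] intro: le_less_trans)
    define r where "r i = enn2real (e i)" for i
    have er: "e i = ennreal (r i)" "0 \<le> r i" for i using fin' by (auto simp: r_def)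
    have sr: "summable r"
      using fin er by (intro summable_suminf_not_top) (auto simp: e_def[symmetric])
    have "(\<lambda>N. ennreal (\<Sum>i. r (i + N))) \<longlonglongrightarrow> ennreal 0"
      by (intro tendsto_ennrealI suminf_exist_split2 sr)
    moreover have "(\<Sum>i. e (i + N)) = ennreal (\<Sum>i. r (i + N))" for N
      using er sr by (simp add: suminf_ennreal2 summable_ignore_initial_segment)
    ultimately show ?thesis by simp
  qed
  have "AE \<omega> in M. \<exists>N. \<not> osc (1 / Suc k) N \<omega>" for k
  proof -
    let ?l = "1 / Suc k :: real"
    let ?B = "{\<omega>\<in>space M. \<forall>N. osc ?l N \<omega>}"
    have "emeasure M ?B \<le> (\<Sum>i. e (i + N)) / ennreal (?l\<^sup>2)" for N
      by (rule order_trans[OF emeasure_mono osc_le]) auto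
    moreover have "(\<lambda>N. (\<Sum>i. e (i + N)) / ennreal (?l\<^sup>2)) \<longlonglongrightarrow> 0"
    proof -
      have "inverse (ennreal (?l\<^sup>2)) < top" by (simp add: inverse_ennreal less_top)
      from ennreal_tendsto_cmult[OF this tail] show ?thesis
        by (simp add: divide_ennreal_def mult.commute)
    qed
    ultimately have "emeasure M ?B \<le> 0"
      by (intro LIMSEQ_le_const[of _ 0]) auto
    then have "?B \<in> null_sets M" by (auto simp: null_sets_def)
    then show ?thesis by (rule AE_I') auto
  qed
  then have "AE \<omega> in M. \<forall>k. \<exists>N. \<not> osc (1 / Suc k) N \<omega>" by (simp add: AE_all_countable)
  then show ?thesis
  proof eventually_elim
    case (elim \<omega>)
    let ?f = "\<lambda>i. \<gamma> i \<omega> * a i \<omega>"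
    show "summable ?f"
      unfolding summable_Cauchy
    proof (intro allI impI)
      fix \<epsilon> :: real assume "0 < \<epsilon>"
      then obtain k where k: "1 / Suc k < \<epsilon> / 2" using nat_approx_posE[of "\<epsilon> / 2"] by auto
      obtain N where "\<not> osc (1 / Suc k) N \<omega>" using elim by blast
      then have N: "\<bar>sum ?f {N..<N+n}\<bar> < \<epsilon> / 2" for n
        using k unfolding osc_def by (meson less_trans not_less)
      \<comment> \<open>Any later block is the difference of two blocks that start at
        \<open>N\<close>, each below half of \<open>\<epsilon>\<close>.\<close>
      have "norm (sum ?f {m..<n}) < \<epsilon>" if "N \<le> m" for m n
      proof (cases "m \<le> n")
        case True
        have "sum ?f {N..<m} + sum ?f {m..<n} = sum ?f {N..<n}"
          using that True by (rule sum.atLeastLessThan_concat)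
        moreover have "\<bar>sum ?f {N..<m}\<bar> < \<epsilon> / 2" "\<bar>sum ?f {N..<n}\<bar> < \<epsilon> / 2"
          using N[of "m - N"] N[of "n - N"] that True by auto
        ultimately show ?thesis by auto
      qed (use \<open>0 < \<epsilon>\<close> in simp)
      then show "\<exists>N. \<forall>m\<ge>N. \<forall>n. norm (sum ?f {m..<n}) < \<epsilon>" by blast
    qed
  qed
qed

lemma AE_suminf_finite:
  assumes "\<And>i. f i \<in> borel_measurable M" "(\<Sum>i. \<integral>\<^sup>+\<omega>. f i \<omega> \<partial>M) < \<infinity>"
  shows "AE \<omega> in M. (\<Sum>i. f i \<omega>) < (\<infinity>::ennreal)"
proof -
  have "(\<integral>\<^sup>+\<omega>. (\<Sum>i. f i \<omega>) \<partial>M) = (\<Sum>i. \<integral>\<^sup>+\<omega>. f i \<omega> \<partial>M)"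
    using assms by (intro nn_integral_suminf) auto
  then have "AE \<omega> in M. (\<Sum>i. f i \<omega>) \<noteq> \<infinity>"
    using assms by (intro nn_integral_PInf_AE) auto
  then show ?thesis by eventually_elim (auto simp: less_top)
qed

lemma summable_ennreal_suminf:
  assumes "(\<Sum>i. ennreal (f i)) < \<infinity>" "\<And>i. 0 \<le> f i"
  shows "summable f"
  using assms by (intro summable_suminf_not_top) (auto simp: less_top)

text \<open>The sum of the squares of the truncated terms is dominated by the sum of the \<open>p\<close>-th powers, and almost
  surely only finitely many terms are truncated.\<close>

lemma AE_summable_Lp:
  assumes a: "\<And>i. a i \<in> borel_measurable (F i)" and p: "0 < p" "p \<le> 2"
    and fin: "(\<Sum>i. \<integral>\<^sup>+\<omega>. ennreal (\<bar>a i \<omega>\<bar> powr p) \<partial>M) < \<infinity>"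
  shows "AE \<omega> in M. summable (\<lambda>i. \<gamma> i \<omega> * a i \<omega>)"
proof -
  define b where "b i \<omega> = (if \<bar>a i \<omega>\<bar> \<le> 1 then a i \<omega> else 0)" for i \<omega>
  have b: "b i \<in> borel_measurable (F i)" for i
    using a[of i] unfolding b_def[abs_def] by measurable
  have [measurable]: "a i \<in> borel_measurable M" for i using measurable_F_M[OF a] .
  have "(b i \<omega>)\<^sup>2 \<le> \<bar>a i \<omega>\<bar> powr p" for i \<omega>
  proof (cases "a i \<omega> = 0 \<or> \<bar>a i \<omega>\<bar> > 1")
    case False
    then have "\<bar>a i \<omega>\<bar> powr 2 \<le> \<bar>a i \<omega>\<bar> powr p" using p by (intro powr_mono') auto
    then show ?thesis using False by (auto simp: b_def)
  qed (auto simp: b_def)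
  then have "(\<Sum>i. \<integral>\<^sup>+\<omega>. ennreal ((b i \<omega>)\<^sup>2) \<partial>M) \<le> (\<Sum>i. \<integral>\<^sup>+\<omega>. ennreal (\<bar>a i \<omega>\<bar> powr p) \<partial>M)"
    by (intro suminf_le nn_integral_mono ennreal_leI) auto
  then have "AE \<omega> in M. summable (\<lambda>i. \<gamma> i \<omega> * b i \<omega>)"
    using fin by (intro AE_summable_L2[OF b]) auto
  moreover have "AE \<omega> in M. (\<Sum>i. ennreal (\<bar>a i \<omega>\<bar> powr p)) < \<infinity>"
    by (intro AE_suminf_finite fin) auto
  ultimately show ?thesis
  proof eventually_elim
    case (elim \<omega>)
    have "summable (\<lambda>i. \<bar>a i \<omega>\<bar> powr p)" by (rule summable_ennreal_suminf[OF elim(2)]) simp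
    then have "eventually (\<lambda>i. \<bar>a i \<omega>\<bar> powr p < 1) sequentially"
      using order_tendstoD(2)[OF summable_LIMSEQ_zero, of "\<lambda>i. \<bar>a i \<omega>\<bar> powr p" 1] by simp
    then have "eventually (\<lambda>i. \<gamma> i \<omega> * a i \<omega> = \<gamma> i \<omega> * b i \<omega>) sequentially"
    proof eventually_elim
      case (elim i)
      then have "\<bar>a i \<omega>\<bar> \<le> 1" using p ge_one_powr_ge_zero[of "\<bar>a i \<omega>\<bar>" p] by linarith
      then show ?case by (simp add: b_def)
    qed
    from summable_cong[OF this] show ?case using elim(1) by blast
  qed
qed

text \<open>Fatou's lemma carries the bound for partial sums over to their almost sure
  limit.\<close>

lemma Lp_suminf:
  assumes a: "\<And>i. a i \<in> borel_measurable (F i)" and p: "0 < p" "p \<le> 2"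
    and conv: "AE \<omega> in M. summable (\<lambda>i. \<gamma> i \<omega> * a i \<omega>)"
  shows "(\<integral>\<^sup>+\<omega>. ennreal (\<bar>\<Sum>i. \<gamma> i \<omega> * a i \<omega>\<bar> powr p) \<partial>M)
    \<le> (\<Sum>i. \<integral>\<^sup>+\<omega>. ennreal (\<bar>a i \<omega>\<bar> powr p) \<partial>M)"
proof -
  have [measurable]: "a i \<in> borel_measurable M" for i using measurable_F_M[OF a] .
  let ?S = "\<lambda>n \<omega>. \<Sum>i<n. \<gamma> i \<omega> * a i \<omega>"
  have "(\<integral>\<^sup>+\<omega>. ennreal (\<bar>\<Sum>i. \<gamma> i \<omega> * a i \<omega>\<bar> powr p) \<partial>M)
      = (\<integral>\<^sup>+\<omega>. liminf (\<lambda>n. ennreal (\<bar>?S n \<omega>\<bar> powr p)) \<partial>M)"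
  proof (rule nn_integral_cong_AE, use conv in eventually_elim)
    case (elim \<omega>)
    then have "?S n \<omega> = ?S n \<omega>" "(\<lambda>n. ?S n \<omega>) \<longlonglongrightarrow> (\<Sum>i. \<gamma> i \<omega> * a i \<omega>)" for n
      using summable_LIMSEQ by auto
    then have "(\<lambda>n. ennreal (\<bar>?S n \<omega>\<bar> powr p)) \<longlonglongrightarrow> ennreal (\<bar>\<Sum>i. \<gamma> i \<omega> * a i \<omega>\<bar> powr p)"
      using p by (intro tendsto_ennrealI tendsto_powr' tendsto_rabs tendsto_const) auto
    then show ?case by (intro lim_imp_Liminf[symmetric]) auto
  qed
  also have "\<dots> \<le> liminf (\<lambda>n. \<integral>\<^sup>+\<omega>. ennreal (\<bar>?S n \<omega>\<bar> powr p) \<partial>M)"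
    by (intro nn_integral_liminf) measurable
  also have "\<dots> \<le> liminf (\<lambda>n::nat. \<Sum>i. \<integral>\<^sup>+\<omega>. ennreal (\<bar>a i \<omega>\<bar> powr p) \<partial>M)"
    by (intro Liminf_mono always_eventually allI order_trans[OF Lp_partial_sum[OF a p] sum_le_suminf]) auto
  also have "\<dots> = (\<Sum>i. \<integral>\<^sup>+\<omega>. ennreal (\<bar>a i \<omega>\<bar> powr p) \<partial>M)" by (intro Liminf_const) auto
  finally show ?thesis .
qed

end

section \<open>Marked Poisson arrival times\<close>

context prob_space
begin

text \<open>Arrival times are sums of waiting times only on \<open>space M\<close>, so independence
  has to be transported along an equality that holds there.\<close>

lemma indep_vars_cong_space:
  assumes "indep_vars N X I" "\<And>i \<omega>. i \<in> I \<Longrightarrow> \<omega> \<in> space M \<Longrightarrow> X i \<omega> = Y i \<omega>"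
  shows "indep_vars N Y I"
proof -
  have "X i -` A \<inter> space M = Y i -` A \<inter> space M" if "i \<in> I" for i A
    using assms(2)[OF that] by auto
  then have "{X i -` A \<inter> space M |A. A \<in> sets (N i)} = {Y i -` A \<inter> space M |A. A \<in> sets (N i)}"
    if "i \<in> I" for i using that by simp
  then have "indep_sets (\<lambda>i. {Y i -` A \<inter> space M |A. A \<in> sets (N i)}) I"
    using assms(1) unfolding indep_vars_def2 by (simp cong: indep_sets_cong)
  moreover have "random_variable (N i) (Y i)" if "i \<in> I" for i
  proof -
    have "random_variable (N i) (X i)" using assms(1) that unfolding indep_vars_def2 by blast
    moreover have "random_variable (N i) (X i) \<longleftrightarrow> random_variable (N i) (Y i)"
      by (rule measurable_cong) (rule assms(2)[OF that])
    ultimately show ?thesis by blast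
  qed
  ultimately show ?thesis unfolding indep_vars_def2 by blast
qed

text \<open>A finite index set splits into its sections over the blocks. The events of one section
  form a cylinder event of a whole sequence, so the product formula holds between the sections, and
  inside each section by independence within the sequence.\<close>

lemma indep_vars_blocks:
  fixes X :: "'k \<Rightarrow> nat \<Rightarrow> 'a \<Rightarrow> 'b"
  assumes blocks: "indep_vars (\<lambda>_. Pi\<^sub>M UNIV (\<lambda>_. N)) (\<lambda>k \<omega> i. X k i \<omega>) K"
    and within: "\<And>k. k \<in> K \<Longrightarrow> indep_vars (\<lambda>_. N) (X k) UNIV"
  shows "indep_vars (\<lambda>_. N) (\<lambda>(k, i). X k i) (K \<times> UNIV)"
  unfolding indep_vars_def2
proof safe
  fix k i assume "k \<in> K"
  then show rv: "random_variable N (X k i)"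
    using within[of k] by (auto simp: indep_vars_def)
next
  have rv: "random_variable N (X k i)" if "k \<in> K" for k i
    using within[OF that] by (auto simp: indep_vars_def)
  let ?F = "\<lambda>j. {(case j of (k, i) \<Rightarrow> X k i) -` A \<inter> space M |A. A \<in> sets N}"
  show "indep_sets ?F (K \<times> UNIV)"
  proof (rule indep_setsI)
    fix j assume "j \<in> K \<times> (UNIV :: nat set)"
    then show "?F j \<subseteq> events" using rv by (auto intro: measurable_sets)
  next
    fix A J assume J: "J \<noteq> {}" "J \<subseteq> K \<times> (UNIV :: nat set)" "finite J" and A: "\<forall>j\<in>J. A j \<in> ?F j"
    from A have "\<forall>j\<in>J. \<exists>B. B \<in> sets N \<and> A j = (case j of (k, i) \<Rightarrow> X k i) -` B \<inter> space M" by blast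
    from bchoice[OF this] obtain B where
      "\<forall>j\<in>J. B j \<in> sets N \<and> A j = (case j of (k, i) \<Rightarrow> X k i) -` B j \<inter> space M" by blast
    then have B: "\<And>j. j \<in> J \<Longrightarrow> B j \<in> sets N"
      "\<And>k i. (k, i) \<in> J \<Longrightarrow> A (k, i) = X k i -` B (k, i) \<inter> space M" by fastforce+
    define L where "L = fst ` J"
    define Jk where "Jk k = {i. (k, i) \<in> J}" for k
    have L: "L \<noteq> {}" "finite L" "L \<subseteq> K" using J by (auto simp: L_def)
    have Jk: "finite (Jk k)" for k
      using finite_subset[of "Jk k" "snd ` J"] J(3) by (force simp: Jk_def)
    have Jk_ne: "Jk k \<noteq> {}" if "k \<in> L" for k using that by (auto simp: L_def Jk_def)
    have JS: "J = Sigma L Jk" by (force simp: L_def Jk_def)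
    \<comment> \<open>The part of the event that concerns block \<open>k\<close>, as a cylinder in
      the sequence space.\<close>
    define C where "C k = {f \<in> space (Pi\<^sub>M UNIV (\<lambda>_::nat. N)). \<forall>i\<in>Jk k. f i \<in> B (k, i)}" for k
    have C: "C k \<in> sets (Pi\<^sub>M UNIV (\<lambda>_::nat. N))" for k
      unfolding C_def
    proof (rule sets.sets_Collect_finite_All)
      fix i assume "i \<in> Jk k"
      then have "B (k, i) \<in> sets N" using B(1) by (auto simp: Jk_def)
      then show "{f \<in> space (Pi\<^sub>M UNIV (\<lambda>_. N)). f i \<in> B (k, i)} \<in> sets (Pi\<^sub>M UNIV (\<lambda>_. N))"
        by measurable
    qed (rule Jk)
    have eqC: "(\<lambda>\<omega> i. X k i \<omega>) -` C k \<inter> space M = (\<Inter>i\<in>Jk k. X k i -` B (k, i) \<inter> space M)"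
      if "k \<in> L" for k
      using rv[of k] L(3) that Jk_ne[OF that] by (auto simp: C_def space_PiM dest: measurable_space)
    have "(\<Inter>j\<in>J. A j) = (\<Inter>k\<in>L. \<Inter>i\<in>Jk k. A (k, i))"
      unfolding JS by auto
    also have "\<dots> = (\<Inter>k\<in>L. (\<lambda>\<omega> i. X k i \<omega>) -` C k \<inter> space M)"
      using eqC B(2) by (intro INF_cong refl) (auto simp: Jk_def)
    also have "prob \<dots> = (\<Prod>k\<in>L. prob ((\<lambda>\<omega> i. X k i \<omega>) -` C k \<inter> space M))"
      by (rule indep_varsD[OF blocks L(1,2,3) C])
    also have "\<dots> = (\<Prod>k\<in>L. \<Prod>i\<in>Jk k. prob (A (k, i)))"
    proof (rule prod.cong[OF refl])
      fix k assume k: "k \<in> L"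
      have "prob (\<Inter>i\<in>Jk k. X k i -` B (k, i) \<inter> space M) = (\<Prod>i\<in>Jk k. prob (X k i -` B (k, i) \<inter> space M))"
        using k L(3) B(1) by (intro indep_varsD[OF within Jk_ne Jk]) (auto simp: Jk_def)
      also have "\<dots> = (\<Prod>i\<in>Jk k. prob (A (k, i)))"
        using B(2) by (intro prod.cong refl) (auto simp: Jk_def)
      finally show "prob ((\<lambda>\<omega> i. X k i \<omega>) -` C k \<inter> space M) = (\<Prod>i\<in>Jk k. prob (A (k, i)))"
        using eqC[OF k] by simp
    qed
    also have "\<dots> = (\<Prod>j\<in>J. prob (A j))"
      unfolding JS using L(2) Jk by (subst prod.Sigma) (auto simp: case_prod_unfold)
    finally show "prob (\<Inter>j\<in>J. A j) = (\<Prod>j\<in>J. prob (A j))" .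
  qed
qed

end

text \<open>One family indexed by pairs \<open>(k, i)\<close>, where \<open>k\<close> selects
  waiting times, marks or signs: any two disjoint sets of pairs then give independent
  blocks.\<close>

locale lepage = prob_space M for M :: "'a measure" +
  fixes T V \<gamma> :: "nat \<Rightarrow> 'a \<Rightarrow> real" and \<nu> :: "real measure"
  assumes indep: "indep_vars (\<lambda>_. borel) (\<lambda>(k, i). ([T, V, \<gamma>] ! k) i) ({..<3} \<times> UNIV)"
    and T_exponential: "\<And>i. distributed M lborel (T i) (exponential_density 1)"
    and V_distr: "\<And>i. distr M borel (V i) = \<nu>"
    and sign_prob: "\<And>i \<sigma>. \<sigma> \<in> {1, -1} \<Longrightarrow> prob {\<omega>\<in>space M. \<gamma> i \<omega> = \<sigma>} = 1 / 2"
begin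

abbreviation X :: "nat \<times> nat \<Rightarrow> 'a \<Rightarrow> real" where "X \<equiv> \<lambda>(k, i). ([T, V, \<gamma>] ! k) i"

definition arrival :: "nat \<Rightarrow> 'a \<Rightarrow> real" where "arrival i \<omega> = (\<Sum>k\<le>i. T k \<omega>)"

lemma measurable_X: "j \<in> {..<3} \<times> UNIV \<Longrightarrow> X j \<in> borel_measurable M"
  using indep by (auto simp: indep_vars_def)

lemma T_measurable [measurable]: "T i \<in> borel_measurable M"
  and V_measurable [measurable]: "V i \<in> borel_measurable M"
  and \<gamma>_measurable [measurable]: "\<gamma> i \<in> borel_measurable M"
  using measurable_X[of "(0, i)"] measurable_X[of "(1, i)"] measurable_X[of "(2, i)"] by simp_all

lemma arrival_measurable [measurable]: "arrival i \<in> borel_measurable M"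
  unfolding arrival_def[abs_def] by measurable

lemma sets_\<nu> [measurable_cong, simp]: "sets \<nu> = sets borel"
  using V_distr[of 0] by auto

lemma prob_space_\<nu>: "prob_space \<nu>"
  using V_distr[of 0] prob_space_distr[of "V 0" borel] by simp

text \<open>All waiting times and marks belong to the past from the start; only the signs are
  revealed one by one. Hence every coefficient \<open>a (arrival i, V i)\<close> is predictable,
  however it depends on arrival time and mark.\<close>

definition past_index :: "nat \<Rightarrow> (nat \<times> nat) set" where
  "past_index n = {0, 1} \<times> UNIV \<union> {2} \<times> {..<n}"

definition past :: "nat \<Rightarrow> 'a measure" where
  "past n = vimage_algebra (space M) (\<lambda>\<omega>. \<lambda>j\<in>past_index n. X j \<omega>) (Pi\<^sub>M (past_index n) (\<lambda>_. borel))"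

lemma past_index_subset: "past_index n \<subseteq> {..<3} \<times> UNIV"
  by (auto simp: past_index_def)

lemma restrict_measurable:
  "J \<subseteq> {..<3} \<times> UNIV \<Longrightarrow> (\<lambda>\<omega>. \<lambda>j\<in>J. X j \<omega>) \<in> measurable M (Pi\<^sub>M J (\<lambda>_. borel))"
  by (intro measurable_restrict measurable_X) auto

lemma sets_past:
  "sets (past n) = {(\<lambda>\<omega>. \<lambda>j\<in>past_index n. X j \<omega>) -` A \<inter> space M | A. A \<in> sets (Pi\<^sub>M (past_index n) (\<lambda>_. borel))}"
  unfolding past_def by (rule sets_vimage_algebra2) (auto simp: space_PiM)

lemma measurable_past:
  assumes "j \<in> past_index n"
  shows "X j \<in> borel_measurable (past n)"
proof -
  have "(\<lambda>\<omega>. \<lambda>j\<in>past_index n. X j \<omega>) \<in> measurable (past n) (Pi\<^sub>M (past_index n) (\<lambda>_. borel))"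
    unfolding past_def by (rule measurable_vimage_algebra1) (auto simp: space_PiM)
  then have "(\<lambda>\<omega>. (\<lambda>j\<in>past_index n. X j \<omega>) j) \<in> borel_measurable (past n)"
    by (rule measurable_compose) (rule measurable_component_singleton[OF assms])
  then show ?thesis using assms by simp
qed

lemma T_past [measurable]: "T i \<in> borel_measurable (past n)"
  and V_past [measurable]: "V i \<in> borel_measurable (past n)"
  using measurable_past[of "(0, i)" n] measurable_past[of "(1, i)" n] by (auto simp: past_index_def)

lemma arrival_past [measurable]: "arrival i \<in> borel_measurable (past n)"
  unfolding arrival_def[abs_def] by measurable

sublocale rademacher_filtration M past \<gamma>
proof
  fix n
  show "subalgebra M (past n)"
    using restrict_measurable[OF past_index_subset[of n]]
    by (auto simp: subalgebra_def sets_past) (auto simp: past_def)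
next
  fix n m :: nat assume "n \<le> m"
  then have sub: "past_index n \<subseteq> past_index m" by (auto simp: past_index_def)
  show "sets (past n) \<subseteq> sets (past m)"
  proof
    fix E assume "E \<in> sets (past n)"
    then obtain A where A: "A \<in> sets (Pi\<^sub>M (past_index n) (\<lambda>_. borel))"
      "E = (\<lambda>\<omega>. \<lambda>j\<in>past_index n. X j \<omega>) -` A \<inter> space M" by (auto simp: sets_past)
    \<comment> \<open>The smaller block is a coordinate restriction of the larger one, along which
      its cylinder \<open>A\<close> is pulled back.\<close>
    define B where "B = (\<lambda>f. restrict f (past_index n)) -` A \<inter> space (Pi\<^sub>M (past_index m) (\<lambda>_. borel :: real measure))"
    have "B \<in> sets (Pi\<^sub>M (past_index m) (\<lambda>_. borel))"
      unfolding B_def by (rule measurable_sets[OF measurable_restrict_subset[OF sub] A(1)])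
    moreover have "E = (\<lambda>\<omega>. \<lambda>j\<in>past_index m. X j \<omega>) -` B \<inter> space M"
      using sub by (auto simp: A(2) B_def space_PiM restrict_restrict Int_absorb1)
    ultimately show "E \<in> sets (past m)" by (auto simp: sets_past)
  qed
next
  fix n
  show "\<gamma> n \<in> borel_measurable (past (Suc n))"
    using measurable_past[of "(2, n)" "Suc n"] by (simp add: past_index_def)
next
  fix A n and \<sigma> :: real assume A: "A \<in> sets (past n)" and \<sigma>: "\<sigma> \<in> {1, -1}"
  let ?U = "\<lambda>\<omega>. \<lambda>j\<in>past_index n. X j \<omega>" and ?W = "\<lambda>\<omega>. \<lambda>j\<in>{(2, n)}. X j \<omega>"
  from A obtain B where B: "B \<in> sets (Pi\<^sub>M (past_index n) (\<lambda>_. borel))" "A = ?U -` B \<inter> space M"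
    by (auto simp: sets_past)
  define C where "C = {f \<in> space (Pi\<^sub>M {(2::nat, n)} (\<lambda>_. borel :: real measure)). f (2, n) = \<sigma>}"
  have C: "C \<in> sets (Pi\<^sub>M {(2::nat, n)} (\<lambda>_. borel))" unfolding C_def by measurable
  \<comment> \<open>The sign \<open>n\<close> has the index \<open>(2, n)\<close>, which lies
    outside \<open>past_index n\<close>; fairness is the independence of these two blocks.\<close>
  have "indep_var (Pi\<^sub>M (past_index n) (\<lambda>_. borel)) ?U (Pi\<^sub>M {(2, n)} (\<lambda>_. borel)) ?W"
    by (rule indep_var_restrict[OF indep]) (auto simp: past_index_def)
  from indep_varD[OF this B(1) C]
  have "prob ((\<lambda>\<omega>. (?U \<omega>, ?W \<omega>)) -` (B \<times> C) \<inter> space M) = prob A * prob (?W -` C \<inter> space M)"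
    by (simp add: B(2))
  moreover have "?W -` C \<inter> space M = {\<omega>\<in>space M. \<gamma> n \<omega> = \<sigma>}"
    by (auto simp: C_def space_PiM)
  moreover have "(\<lambda>\<omega>. (?U \<omega>, ?W \<omega>)) -` (B \<times> C) \<inter> space M = {\<omega>\<in>A. \<gamma> n \<omega> = \<sigma>}"
    by (auto simp: B(2) C_def space_PiM)
  ultimately show "prob {\<omega>\<in>A. \<gamma> n \<omega> = \<sigma>} = prob A / 2"
    using sign_prob[OF \<sigma>] by simp
qed

lemma indep_function_of_blocks:
  assumes "A \<inter> B = {}" "A \<subseteq> {..<3} \<times> UNIV" "B \<subseteq> {..<3} \<times> UNIV"
    and f: "f \<in> measurable (Pi\<^sub>M A (\<lambda>_. borel)) N1" and g: "g \<in> measurable (Pi\<^sub>M B (\<lambda>_. borel)) N2"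
    and "\<And>\<omega>. f (\<lambda>j\<in>A. X j \<omega>) = f' \<omega>" "\<And>\<omega>. g (\<lambda>j\<in>B. X j \<omega>) = g' \<omega>"
  shows "indep_var N1 f' N2 g'"
proof -
  have "indep_var N1 (f \<circ> (\<lambda>\<omega>. \<lambda>j\<in>A. X j \<omega>)) N2 (g \<circ> (\<lambda>\<omega>. \<lambda>j\<in>B. X j \<omega>))"
    by (intro indep_var_compose[OF indep_var_restrict[OF indep assms(1,2,3)] f g])
  then show ?thesis using assms(6,7) by (simp add: comp_def)
qed

lemma indep_T: "indep_vars (\<lambda>_. borel) T UNIV"
proof -
  have "indep_vars (\<lambda>i. Pi\<^sub>M {(0, i)} (\<lambda>_. borel)) (\<lambda>i \<omega>. \<lambda>j\<in>{(0, i)}. X j \<omega>) UNIV"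
    by (rule indep_vars_restrict[OF indep]) (auto simp: disjoint_family_on_def)
  then have "indep_vars (\<lambda>_. borel) (\<lambda>i \<omega>. (\<lambda>j\<in>{(0, i)}. X j \<omega>) (0, i)) UNIV"
    by (rule indep_vars_compose2) (auto intro: measurable_component_singleton)
  then show ?thesis by simp
qed

text \<open>The indices agree: \<open>arrival i\<close> is a sum of \<open>i + 1\<close> waiting
  times, and \<open>erlang_density i\<close> is the Gamma density of shape
  \<open>i + 1\<close>.\<close>

lemma arrival_distributed: "distributed M lborel (arrival i) (erlang_density i 1)"
proof -
  have "distributed M lborel (\<lambda>\<omega>. \<Sum>k\<in>{..i}. T k \<omega>) (erlang_density (card {..i} - 1) 1)"
    by (rule exponential_distributed_sum) (auto intro: T_exponential indep_vars_subset[OF indep_T])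
  then show ?thesis by (simp add: arrival_def[abs_def])
qed

lemma indep_arrival_V: "indep_var borel (arrival i) borel (V i)"
  by (rule indep_function_of_blocks[of "{0} \<times> {..i}" "{(1, i)}" "\<lambda>f. \<Sum>k\<le>i. f (0, k)" _ "\<lambda>f. f (1, i)"])
     (auto simp: arrival_def intro!: borel_measurable_sum measurable_component_singleton)

text \<open>The exponential series. In terms of the process: all arrival times together have
  constant intensity 1 on the half line.\<close>

lemma sum_erlang_density: "(\<Sum>i. ennreal (erlang_density i 1 x)) = indicator {0..} x"
proof (cases "x < 0")
  case False
  have "(\<lambda>i. exp (- x) * (x ^ i /\<^sub>R fact i)) sums (exp (- x) * exp x)"
    by (intro sums_mult exp_converges)
  then have "(\<lambda>i. erlang_density i 1 x) sums 1"
    using False by (simp add: erlang_density_def exp_minus field_simps scaleR_conv_of_real)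
  then have "(\<Sum>i. ennreal (erlang_density i 1 x)) = ennreal 1"
    by (intro suminf_ennreal_eq) auto
  then show ?thesis using False by simp
qed (simp add: erlang_density_def)

text \<open>An arrival time and its mark are independent, so each term is an integral against an
  Erlang density times \<open>\<nu>\<close>; the Erlang densities add up to Lebesgue measure on the
  half line.\<close>

theorem campbell:
  assumes g[measurable]: "g \<in> borel_measurable (borel \<Otimes>\<^sub>M borel)"
  shows "(\<Sum>i. \<integral>\<^sup>+\<omega>. g (arrival i \<omega>, V i \<omega>) \<partial>M) = (\<integral>\<^sup>+x\<in>{0..}. (\<integral>\<^sup>+v. g (x, v) \<partial>\<nu>) \<partial>lborel)"
proof -
  interpret \<nu>: prob_space \<nu> by (rule prob_space_\<nu>)
  have h[measurable]: "(\<lambda>x. \<integral>\<^sup>+v. g (x, v) \<partial>\<nu>) \<in> borel_measurable borel" by measurable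
  have "(\<integral>\<^sup>+\<omega>. g (arrival i \<omega>, V i \<omega>) \<partial>M) = (\<integral>\<^sup>+x. ennreal (erlang_density i 1 x) * (\<integral>\<^sup>+v. g (x, v) \<partial>\<nu>) \<partial>lborel)" for i
  proof -
    have "(\<integral>\<^sup>+\<omega>. g (arrival i \<omega>, V i \<omega>) \<partial>M) = (\<integral>\<^sup>+z. g z \<partial>distr M (borel \<Otimes>\<^sub>M borel) (\<lambda>\<omega>. (arrival i \<omega>, V i \<omega>)))"
      by (subst nn_integral_distr) auto
    also have "distr M (borel \<Otimes>\<^sub>M borel) (\<lambda>\<omega>. (arrival i \<omega>, V i \<omega>)) = distr M borel (arrival i) \<Otimes>\<^sub>M \<nu>"
      using indep_arrival_V[of i] V_distr[of i] by (simp add: indep_var_distribution_eq)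
    also have "(\<integral>\<^sup>+z. g z \<partial>(distr M borel (arrival i) \<Otimes>\<^sub>M \<nu>)) = (\<integral>\<^sup>+x. (\<integral>\<^sup>+v. g (x, v) \<partial>\<nu>) \<partial>distr M borel (arrival i))"
      by (subst \<nu>.nn_integral_fst[symmetric]) auto
    also have "\<dots> = (\<integral>\<^sup>+\<omega>. (\<integral>\<^sup>+v. g (arrival i \<omega>, v) \<partial>\<nu>) \<partial>M)"
      by (subst nn_integral_distr) auto
    also have "\<dots> = (\<integral>\<^sup>+x. ennreal (erlang_density i 1 x) * (\<integral>\<^sup>+v. g (x, v) \<partial>\<nu>) \<partial>lborel)"
      by (subst distributed_nn_integral[OF arrival_distributed[of i]]) auto
    finally show ?thesis .
  qed
  then have "(\<Sum>i. \<integral>\<^sup>+\<omega>. g (arrival i \<omega>, V i \<omega>) \<partial>M)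
      = (\<Sum>i. \<integral>\<^sup>+x. ennreal (erlang_density i 1 x) * (\<integral>\<^sup>+v. g (x, v) \<partial>\<nu>) \<partial>lborel)" by simp
  also have "\<dots> = (\<integral>\<^sup>+x. (\<Sum>i. ennreal (erlang_density i 1 x) * (\<integral>\<^sup>+v. g (x, v) \<partial>\<nu>)) \<partial>lborel)"
    by (rule nn_integral_suminf[symmetric]) measurable
  also have "\<dots> = (\<integral>\<^sup>+x\<in>{0..}. (\<integral>\<^sup>+v. g (x, v) \<partial>\<nu>) \<partial>lborel)"
    by (intro nn_integral_cong) (simp add: ennreal_suminf_multc sum_erlang_density mult.commute)
  finally show ?thesis .
qed

lemma AE_T_pos: "AE \<omega> in M. 0 < T i \<omega>"
proof -
  have "AE x in lborel. 0 < ennreal (exponential_density 1 x) \<longrightarrow> 0 < x"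
  proof -
    have "AE x in lborel. x \<noteq> (0::real)" by (rule AE_lborel_singleton)
    then show ?thesis by eventually_elim (auto simp: exponential_density_def)
  qed
  then show ?thesis
    using distributed_AE2[OF T_exponential[of i], of "\<lambda>x. 0 < x"] by simp
qed

lemma AE_arrival_at_top: "AE \<omega> in M. filterlim (\<lambda>i. arrival i \<omega>) at_top sequentially"
proof -
  have "AE \<omega> in M. eventually (\<lambda>i. real R < arrival i \<omega>) sequentially" for R
  proof -
    \<comment> \<open>With this \<open>g\<close> the sum counts the arrivals up to \<open>R\<close>.
      Campbell's formula makes the expected count finite, so almost surely only finitely many
      arrivals lie there.\<close>
    let ?g = "\<lambda>(x, v::real). indicator {..real R} x :: ennreal"
    have "(\<Sum>i. \<integral>\<^sup>+\<omega>. ?g (arrival i \<omega>, V i \<omega>) \<partial>M) = (\<integral>\<^sup>+x\<in>{0..}. (\<integral>\<^sup>+v. ?g (x, v) \<partial>\<nu>) \<partial>lborel)"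
      by (rule campbell) measurable
    also have "\<dots> = (\<integral>\<^sup>+x. indicator {0..real R} x \<partial>lborel)"
      using prob_space.emeasure_space_1[OF prob_space_\<nu>]
      by (intro nn_integral_cong) (auto simp: indicator_def)
    also have "\<dots> < \<infinity>" by simp
    finally have "AE \<omega> in M. (\<Sum>i. ?g (arrival i \<omega>, V i \<omega>)) < \<infinity>"
      by (intro AE_suminf_finite) auto
    then show ?thesis
    proof eventually_elim
      case (elim \<omega>)
      then have "summable (\<lambda>i. indicator {..real R} (arrival i \<omega>) :: real)"
        by (intro summable_ennreal_suminf) (auto simp: ennreal_indicator)
      then have "eventually (\<lambda>i. indicator {..real R} (arrival i \<omega>) < (1::real)) sequentially"
        using order_tendstoD(2)[OF summable_LIMSEQ_zero] by fastforce
      then show ?case by eventually_elim (auto simp: indicator_def split: if_splits)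
    qed
  qed
  then have "AE \<omega> in M. \<forall>R. eventually (\<lambda>i. real R < arrival i \<omega>) sequentially"
    by (simp add: AE_all_countable)
  then show ?thesis
  proof eventually_elim
    case (elim \<omega>)
    show ?case unfolding filterlim_at_top
    proof
      fix Z :: real
      obtain R where "Z \<le> real R" using real_arch_simple by blast
      then show "eventually (\<lambda>i. Z \<le> arrival i \<omega>) sequentially"
        using elim[rule_format, of R] by (auto elim!: eventually_mono)
    qed
  qed
qed

end

section \<open>LePage series\<close>

lemma nn_integral_powr_near_0:
  fixes r :: real
  assumes "r < 1"
  shows "(\<integral>\<^sup>+x\<in>{0..1}. ennreal (x powr - r) \<partial>lborel) = ennreal (1 / (1 - r))"
  using assms has_integral_powr_from_0[of "- r" 1]
  by (intro nn_integral_has_integral_lebesgue') (auto simp: add.commute)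

lemma nn_integral_powr_near_infinity:
  fixes r :: real
  assumes "1 < r"
  shows "(\<integral>\<^sup>+x\<in>{1..}. ennreal (x powr - r) \<partial>lborel) = ennreal (1 / (r - 1))"
proof (intro nn_integral_has_integral_lebesgue')
  have "- (1 powr (- r + 1)) / (- r + 1) = 1 / (r - 1)"
    using assms by (simp add: field_simps)
  then show "((\<lambda>x. x powr - r) has_integral 1 / (r - 1)) {1..}"
    using has_integral_powr_to_inf[of "- r" 1] assms by simp
qed auto

text \<open>The sum is at most twice the larger modulus, and \<open>2 powr e\<close> is at most
  4.\<close>

lemma powr_abs_add_le:
  fixes x y e :: real
  assumes "0 < e" "e \<le> 2"
  shows "\<bar>x + y\<bar> powr e \<le> 4 * (\<bar>x\<bar> powr e + \<bar>y\<bar> powr e)"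
proof -
  have "\<bar>x + y\<bar> powr e \<le> (2 * max \<bar>x\<bar> \<bar>y\<bar>) powr e"
    using assms by (intro powr_mono2) auto
  also have "\<dots> = 2 powr e * max \<bar>x\<bar> \<bar>y\<bar> powr e" by (simp add: powr_mult)
  also have "\<dots> \<le> 2 powr 2 * (\<bar>x\<bar> powr e + \<bar>y\<bar> powr e)"
    using assms by (intro mult_mono powr_mono) (auto simp: max_def)
  finally show ?thesis by simp
qed

lemma powr_le_one_plus:
  fixes x e p :: real
  assumes "0 \<le> x" "0 < e" "e \<le> p"
  shows "x powr e \<le> 1 + x powr p"
proof (cases "x \<le> 1")
  case True
  then have "x powr e \<le> 1" using assms powr_mono2[of e x 1] by auto
  then show ?thesis by (simp add: add_increasing2)
next
  case False
  then have "x powr e \<le> x powr p" using assms by (intro powr_mono) auto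
  then show ?thesis by simp
qed

context lepage
begin

definition series :: "(real \<times> real \<Rightarrow> real) \<Rightarrow> 'a \<Rightarrow> real" where
  "series a \<omega> = (\<Sum>i. \<gamma> i \<omega> * a (arrival i \<omega>, V i \<omega>))"

text \<open>\<open>suminf\<close> has an unspecified value on divergent series, so
  \<open>series\<close> may fail to be additive there; almost sure convergence is carried along as a
  predicate.\<close>

definition series_converges :: "(real \<times> real \<Rightarrow> real) \<Rightarrow> bool" where
  "series_converges a \<longleftrightarrow> (AE \<omega> in M. summable (\<lambda>i. \<gamma> i \<omega> * a (arrival i \<omega>, V i \<omega>)))"

lemma series_measurable [measurable]:
  assumes [measurable]: "a \<in> borel_measurable (borel \<Otimes>\<^sub>M borel)"
  shows "series a \<in> borel_measurable M"
  unfolding series_def[abs_def] by measurable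

lemma term_past:
  assumes [measurable]: "a \<in> borel_measurable (borel \<Otimes>\<^sub>M borel)"
  shows "(\<lambda>\<omega>. a (arrival i \<omega>, V i \<omega>)) \<in> borel_measurable (past i)"
  by measurable

text \<open>Campbell's formula turns the sum of the \<open>p\<close>-th moments of the coefficients
  into an integral over the half line, and the bounds for Rademacher series apply.\<close>

lemma series_Lp:
  assumes a[measurable]: "a \<in> borel_measurable (borel \<Otimes>\<^sub>M borel)" and p: "0 < p" "p \<le> 2"
    and fin: "(\<integral>\<^sup>+x\<in>{0..}. (\<integral>\<^sup>+v. ennreal (\<bar>a (x, v)\<bar> powr p) \<partial>\<nu>) \<partial>lborel) < \<infinity>"
  shows "series_converges a"
    and "(\<integral>\<^sup>+\<omega>. ennreal (\<bar>series a \<omega>\<bar> powr p) \<partial>M)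
      \<le> (\<integral>\<^sup>+x\<in>{0..}. (\<integral>\<^sup>+v. ennreal (\<bar>a (x, v)\<bar> powr p) \<partial>\<nu>) \<partial>lborel)"
proof -
  have c: "(\<Sum>i. \<integral>\<^sup>+\<omega>. ennreal (\<bar>a (arrival i \<omega>, V i \<omega>)\<bar> powr p) \<partial>M)
      = (\<integral>\<^sup>+x\<in>{0..}. (\<integral>\<^sup>+v. ennreal (\<bar>a (x, v)\<bar> powr p) \<partial>\<nu>) \<partial>lborel)"
    using campbell[of "\<lambda>z. ennreal (\<bar>a z\<bar> powr p)"] by simp
  show conv: "series_converges a"
    unfolding series_converges_def using fin c by (intro AE_summable_Lp[OF _ p] term_past a) simp
  show "(\<integral>\<^sup>+\<omega>. ennreal (\<bar>series a \<omega>\<bar> powr p) \<partial>M)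
      \<le> (\<integral>\<^sup>+x\<in>{0..}. (\<integral>\<^sup>+v. ennreal (\<bar>a (x, v)\<bar> powr p) \<partial>\<nu>) \<partial>lborel)"
    unfolding series_def c[symmetric] using conv
    by (intro Lp_suminf[OF _ p] term_past a) (simp add: series_converges_def)
qed

lemma series_converges_add:
  assumes "series_converges a" "series_converges b"
  shows "series_converges (\<lambda>z. a z + b z)"
    and "AE \<omega> in M. series (\<lambda>z. a z + b z) \<omega> = series a \<omega> + series b \<omega>"
proof -
  from assms show "series_converges (\<lambda>z. a z + b z)"
    unfolding series_converges_def
    by eventually_elim (auto simp: distrib_left intro: summable_add)
  from assms show "AE \<omega> in M. series (\<lambda>z. a z + b z) \<omega> = series a \<omega> + series b \<omega>"
    unfolding series_converges_def
    by eventually_elim (simp add: series_def distrib_left suminf_add)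
qed

lemma series_scale:
  assumes "series_converges a"
  shows "series_converges (\<lambda>z. c * a z)"
    and "AE \<omega> in M. series (\<lambda>z. c * a z) \<omega> = c * series a \<omega>"
proof -
  from assms show "series_converges (\<lambda>z. c * a z)"
    unfolding series_converges_def
    by eventually_elim (auto simp: mult.left_commute intro: summable_mult)
  from assms show "AE \<omega> in M. series (\<lambda>z. c * a z) \<omega> = c * series a \<omega>"
    unfolding series_converges_def
    by eventually_elim (simp add: series_def mult.left_commute suminf_mult)
qed

text \<open>The small arrival times carry the heavy tail and are controlled in \<open>L\<^sup>\<eta>\<close>; the large arrival times need
  the cancellation from the signs and are controlled in \<open>L\<^sup>p\<close>.\<close>

theorem series_moment_bound:
  assumes a[measurable]: "a \<in> borel_measurable (borel \<Otimes>\<^sub>M borel)"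
    and h[measurable]: "h \<in> borel_measurable borel" and h0: "\<And>v. 0 \<le> h v"
    and e: "0 < \<eta>" "\<eta> \<le> p" "p \<le> 2" and b: "\<eta> * b1 < 1" "1 < p * b2"
    and small: "\<And>x v. 0 < x \<Longrightarrow> x < 1 \<Longrightarrow> \<bar>a (x, v)\<bar> \<le> h v * x powr - b1"
    and large: "\<And>x v. 1 \<le> x \<Longrightarrow> \<bar>a (x, v)\<bar> \<le> h v * x powr - b2"
    and hp: "(\<integral>\<^sup>+v. ennreal (h v powr p) \<partial>\<nu>) \<le> ennreal m" and m: "0 \<le> m"
  shows "series_converges a"
    and "(\<integral>\<^sup>+\<omega>. ennreal (\<bar>series a \<omega>\<bar> powr \<eta>) \<partial>M)
      \<le> ennreal (4 * (1 + m) * (1 / (1 - \<eta> * b1) + 1 + 1 / (p * b2 - 1)))"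
proof -
  interpret \<nu>: prob_space \<nu> by (rule prob_space_\<nu>)
  \<comment> \<open>The splitting depends on the arrival time of each single term, so both pieces
    are again coefficient functions.\<close>
  define a1 where "a1 z = (if fst z < 1 then a z else 0)" for z
  define a2 where "a2 z = (if fst z < 1 then 0 else a z)" for z
  have [measurable]: "a1 \<in> borel_measurable (borel \<Otimes>\<^sub>M borel)" "a2 \<in> borel_measurable (borel \<Otimes>\<^sub>M borel)"
    unfolding a1_def[abs_def] a2_def[abs_def] by measurable
  \<comment> \<open>One estimate serves both pieces, as \<open>h v powr \<eta>\<close> and
    \<open>h v powr p\<close> are at most \<open>1 + h v powr p\<close>, and \<open>\<nu>\<close>
    has total mass 1.\<close>
  have hm: "(\<integral>\<^sup>+v. ennreal (1 + h v powr p) \<partial>\<nu>) \<le> ennreal (1 + m)"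
  proof -
    have "(\<integral>\<^sup>+v. ennreal (1 + h v powr p) \<partial>\<nu>) = (\<integral>\<^sup>+v. 1 + ennreal (h v powr p) \<partial>\<nu>)"
      by (intro nn_integral_cong) simp
    also have "\<dots> = 1 + (\<integral>\<^sup>+v. ennreal (h v powr p) \<partial>\<nu>)"
      using \<nu>.emeasure_space_1 by (subst nn_integral_add) auto
    finally show ?thesis using hp m by (simp add: add_left_mono)
  qed
  have I1: "(\<integral>\<^sup>+x\<in>{0..}. (\<integral>\<^sup>+v. ennreal (\<bar>a1 (x, v)\<bar> powr \<eta>) \<partial>\<nu>) \<partial>lborel) \<le> ennreal ((1 + m) / (1 - \<eta> * b1))"
  proof -
    have "AE x in lborel. (\<integral>\<^sup>+v. ennreal (\<bar>a1 (x, v)\<bar> powr \<eta>) \<partial>\<nu>) * indicator {0..} x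
        \<le> ennreal (1 + m) * (ennreal (x powr - (\<eta> * b1)) * indicator {0..1} x)"
    proof -
      have "AE x in lborel. x \<noteq> (0::real)" by (rule AE_lborel_singleton)
      then show ?thesis
      proof eventually_elim
        case (elim x)
        show ?case
        proof (cases "0 < x \<and> x < 1")
          case True
          have "\<bar>a1 (x, v)\<bar> powr \<eta> \<le> (1 + h v powr p) * x powr - (\<eta> * b1)" for v
          proof -
            have "\<bar>a1 (x, v)\<bar> powr \<eta> \<le> (h v * x powr - b1) powr \<eta>"
              using True small[of x v] e by (intro powr_mono2) (auto simp: a1_def)
            also have "\<dots> = h v powr \<eta> * x powr - (\<eta> * b1)"
              using h0 True by (simp add: powr_mult powr_powr mult.commute)
            also have "\<dots> \<le> (1 + h v powr p) * x powr - (\<eta> * b1)"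
              using h0 e by (intro mult_right_mono powr_le_one_plus) auto
            finally show ?thesis .
          qed
          then have "(\<integral>\<^sup>+v. ennreal (\<bar>a1 (x, v)\<bar> powr \<eta>) \<partial>\<nu>)
              \<le> (\<integral>\<^sup>+v. ennreal (1 + h v powr p) * ennreal (x powr - (\<eta> * b1)) \<partial>\<nu>)"
            by (intro nn_integral_mono) (simp add: ennreal_mult[symmetric] ennreal_leI del: ennreal_plus)
          also have "\<dots> = (\<integral>\<^sup>+v. ennreal (1 + h v powr p) \<partial>\<nu>) * ennreal (x powr - (\<eta> * b1))"
            by (rule nn_integral_multc) measurable
          also have "\<dots> \<le> ennreal (1 + m) * ennreal (x powr - (\<eta> * b1))"
            by (intro mult_right_mono hm) simp
          finally show ?thesis using True by simp
        next
          case False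
          with elim have "x < 0 \<or> 1 \<le> x" by auto
          then show ?thesis using e by (auto simp: a1_def)
        qed
      qed
    qed
    then have "(\<integral>\<^sup>+x\<in>{0..}. (\<integral>\<^sup>+v. ennreal (\<bar>a1 (x, v)\<bar> powr \<eta>) \<partial>\<nu>) \<partial>lborel)
        \<le> (\<integral>\<^sup>+x. ennreal (1 + m) * (ennreal (x powr - (\<eta> * b1)) * indicator {0..1} x) \<partial>lborel)"
      by (rule nn_integral_mono_AE)
    also have "\<dots> = ennreal (1 + m) * ennreal (1 / (1 - \<eta> * b1))"
      using nn_integral_powr_near_0[OF b(1)] by (subst nn_integral_cmult) auto
    finally show ?thesis using m b by (simp add: ennreal_mult[symmetric] del: ennreal_plus)
  qed
  have I2: "(\<integral>\<^sup>+x\<in>{0..}. (\<integral>\<^sup>+v. ennreal (\<bar>a2 (x, v)\<bar> powr p) \<partial>\<nu>) \<partial>lborel) \<le> ennreal ((1 + m) / (p * b2 - 1))"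
  proof -
    have "(\<integral>\<^sup>+v. ennreal (\<bar>a2 (x, v)\<bar> powr p) \<partial>\<nu>) * indicator {0..} x
        \<le> ennreal (1 + m) * (ennreal (x powr - (p * b2)) * indicator {1..} x)" for x
    proof (cases "1 \<le> x")
      case True
      have "\<bar>a2 (x, v)\<bar> powr p \<le> (1 + h v powr p) * x powr - (p * b2)" for v
      proof -
        have "\<bar>a2 (x, v)\<bar> powr p \<le> (h v * x powr - b2) powr p"
          using True large[of x v] e by (intro powr_mono2) (auto simp: a2_def)
        also have "\<dots> = h v powr p * x powr - (p * b2)"
          using h0 True by (simp add: powr_mult powr_powr mult.commute)
        also have "\<dots> \<le> (1 + h v powr p) * x powr - (p * b2)"
          by (intro mult_right_mono) auto
        finally show ?thesis .
      qed
      then have "(\<integral>\<^sup>+v. ennreal (\<bar>a2 (x, v)\<bar> powr p) \<partial>\<nu>)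
          \<le> (\<integral>\<^sup>+v. ennreal (1 + h v powr p) * ennreal (x powr - (p * b2)) \<partial>\<nu>)"
        by (intro nn_integral_mono) (simp add: ennreal_mult[symmetric] ennreal_leI del: ennreal_plus)
      also have "\<dots> = (\<integral>\<^sup>+v. ennreal (1 + h v powr p) \<partial>\<nu>) * ennreal (x powr - (p * b2))"
        by (rule nn_integral_multc) measurable
      also have "\<dots> \<le> ennreal (1 + m) * ennreal (x powr - (p * b2))"
        by (intro mult_right_mono hm) simp
      finally show ?thesis using True by simp
    qed (use e in \<open>auto simp: a2_def\<close>)
    then have "(\<integral>\<^sup>+x\<in>{0..}. (\<integral>\<^sup>+v. ennreal (\<bar>a2 (x, v)\<bar> powr p) \<partial>\<nu>) \<partial>lborel)
        \<le> (\<integral>\<^sup>+x. ennreal (1 + m) * (ennreal (x powr - (p * b2)) * indicator {1..} x) \<partial>lborel)"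
      by (intro nn_integral_mono) auto
    also have "\<dots> = ennreal (1 + m) * ennreal (1 / (p * b2 - 1))"
      using nn_integral_powr_near_infinity[OF b(2)] by (subst nn_integral_cmult) auto
    finally show ?thesis using m b by (simp add: ennreal_mult[symmetric] del: ennreal_plus)
  qed
  have L1: "series_converges a1" "(\<integral>\<^sup>+\<omega>. ennreal (\<bar>series a1 \<omega>\<bar> powr \<eta>) \<partial>M) \<le> ennreal ((1 + m) / (1 - \<eta> * b1))"
  proof -
    have fin: "(\<integral>\<^sup>+x\<in>{0..}. (\<integral>\<^sup>+v. ennreal (\<bar>a1 (x, v)\<bar> powr \<eta>) \<partial>\<nu>) \<partial>lborel) < \<infinity>"
      using I1 by (rule le_less_trans) simp
    show "series_converges a1" by (rule series_Lp(1)[OF _ _ _ fin]) (use e in auto)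
    show "(\<integral>\<^sup>+\<omega>. ennreal (\<bar>series a1 \<omega>\<bar> powr \<eta>) \<partial>M) \<le> ennreal ((1 + m) / (1 - \<eta> * b1))"
      by (rule order_trans[OF series_Lp(2)[OF _ _ _ fin] I1]) (use e in auto)
  qed
  have L2: "series_converges a2" "(\<integral>\<^sup>+\<omega>. ennreal (\<bar>series a2 \<omega>\<bar> powr p) \<partial>M) \<le> ennreal ((1 + m) / (p * b2 - 1))"
  proof -
    have fin: "(\<integral>\<^sup>+x\<in>{0..}. (\<integral>\<^sup>+v. ennreal (\<bar>a2 (x, v)\<bar> powr p) \<partial>\<nu>) \<partial>lborel) < \<infinity>"
      using I2 by (rule le_less_trans) simp
    show "series_converges a2" by (rule series_Lp(1)[OF _ _ _ fin]) (use e in auto)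
    show "(\<integral>\<^sup>+\<omega>. ennreal (\<bar>series a2 \<omega>\<bar> powr p) \<partial>M) \<le> ennreal ((1 + m) / (p * b2 - 1))"
      by (rule order_trans[OF series_Lp(2)[OF _ _ _ fin] I2]) (use e in auto)
  qed
  have a12: "(\<lambda>z. a1 z + a2 z) = a" by (auto simp: a1_def a2_def)
  show "series_converges a" using series_converges_add(1)[OF L1(1) L2(1)] by (simp add: a12)
  \<comment> \<open>On a probability space the \<open>\<eta>\<close>-th moment of the second piece
    is at most 1 plus its \<open>p\<close>-th moment; 4 is the constant of
    \<open>powr_abs_add_le\<close>.\<close>
  have "AE \<omega> in M. ennreal (\<bar>series a \<omega>\<bar> powr \<eta>)
      \<le> 4 * (ennreal (\<bar>series a1 \<omega>\<bar> powr \<eta>) + (1 + ennreal (\<bar>series a2 \<omega>\<bar> powr p)))"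
    using series_converges_add(2)[OF L1(1) L2(1)]
  proof eventually_elim
    case (elim \<omega>)
    have "\<bar>series a \<omega>\<bar> powr \<eta> \<le> 4 * (\<bar>series a1 \<omega>\<bar> powr \<eta> + \<bar>series a2 \<omega>\<bar> powr \<eta>)"
      using elim powr_abs_add_le[of \<eta> "series a1 \<omega>" "series a2 \<omega>"] e by (simp add: a12)
    also have "\<dots> \<le> 4 * (\<bar>series a1 \<omega>\<bar> powr \<eta> + (1 + \<bar>series a2 \<omega>\<bar> powr p))"
      using e by (intro mult_left_mono add_left_mono powr_le_one_plus) auto
    finally have "ennreal (\<bar>series a \<omega>\<bar> powr \<eta>)
        \<le> ennreal (4 * (\<bar>series a1 \<omega>\<bar> powr \<eta> + (1 + \<bar>series a2 \<omega>\<bar> powr p)))"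
      by (rule ennreal_leI)
    then show ?case by (simp add: ennreal_mult)
  qed
  then have "(\<integral>\<^sup>+\<omega>. ennreal (\<bar>series a \<omega>\<bar> powr \<eta>) \<partial>M)
      \<le> (\<integral>\<^sup>+\<omega>. 4 * (ennreal (\<bar>series a1 \<omega>\<bar> powr \<eta>) + (1 + ennreal (\<bar>series a2 \<omega>\<bar> powr p))) \<partial>M)"
    by (rule nn_integral_mono_AE)
  also have "\<dots> = 4 * ((\<integral>\<^sup>+\<omega>. ennreal (\<bar>series a1 \<omega>\<bar> powr \<eta>) \<partial>M) + (1 + (\<integral>\<^sup>+\<omega>. ennreal (\<bar>series a2 \<omega>\<bar> powr p) \<partial>M)))"
    by (simp add: nn_integral_cmult nn_integral_add emeasure_space_1)
  also have "\<dots> \<le> 4 * (ennreal ((1 + m) / (1 - \<eta> * b1)) + (1 + ennreal ((1 + m) / (p * b2 - 1))))"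
    using L1 L2 by (intro mult_left_mono add_mono) auto
  also have "\<dots> = ennreal (4 * ((1 + m) / (1 - \<eta> * b1) + (1 + (1 + m) / (p * b2 - 1))))"
  proof -
    have "4 * (ennreal A + (1 + ennreal B)) = ennreal (4 * (A + (1 + B)))" if "0 \<le> A" "0 \<le> B" for A B
      using that by (simp add: ennreal_mult)
    then show ?thesis using m b by simp
  qed
  \<comment> \<open>The lone summand 1 is enlarged to \<open>1 + m\<close> so that this factor can
    be taken out.\<close>
  also have "\<dots> \<le> ennreal (4 * (1 + m) * (1 / (1 - \<eta> * b1) + 1 + 1 / (p * b2 - 1)))"
    using m b by (intro ennreal_leI) (simp add: distrib_left add_divide_distrib)
  finally show "(\<integral>\<^sup>+\<omega>. ennreal (\<bar>series a \<omega>\<bar> powr \<eta>) \<partial>M)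
      \<le> ennreal (4 * (1 + m) * (1 / (1 - \<eta> * b1) + 1 + 1 / (p * b2 - 1)))" .
qed

end

section \<open>The characteristic function of a LePage series\<close>

lemma set_integral_subset_le:
  fixes f :: "'b \<Rightarrow> real"
  assumes "set_integrable N A f" "set_integrable N B f" "A \<subseteq> B" "\<And>x. 0 \<le> f x"
  shows "(LINT x:A|N. f x) \<le> (LINT x:B|N. f x)"
  using assms unfolding set_lebesgue_integral_def set_integrable_def
  by (intro integral_mono) (auto simp: indicator_def)

text \<open>For nonnegative \<open>s\<close> this is the integral of \<open>f\<close> beyond
  \<open>s\<close>. As a difference it inherits continuity and its limit from the indefinite
  integral.\<close>

definition tail_integral :: "(real \<Rightarrow> real) \<Rightarrow> real \<Rightarrow> real" where
  "tail_integral f s = (LBINT y:{0..}. f y) - (LBINT y:{0..s}. f y)"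

lemma tail_integral_zero: "tail_integral f 0 = (LBINT y:{0..}. f y)"
proof -
  have "(LBINT y:{0..0}. f y) = 0"
    unfolding set_lebesgue_integral_def
    by (rule integral_eq_zero_AE, rule AE_mp[OF AE_lborel_singleton[of 0]]) (auto simp: indicator_def)
  then show ?thesis by (simp only: tail_integral_def diff_zero)
qed

lemma tail_integral_at_top:
  assumes "set_integrable lborel {0..} f"
  shows "(tail_integral f \<longlongrightarrow> 0) at_top"
proof -
  have "((\<lambda>s. (LBINT y:{0..}. f y) - (LBINT y:{0..s}. f y)) \<longlongrightarrow> (LBINT y:{0..}. f y) - (LBINT y:{0..}. f y)) at_top"
    by (intro tendsto_intros tendsto_set_lebesgue_integral_at_top assms) auto
  then show ?thesis by (simp add: tail_integral_def[abs_def])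
qed

text \<open>\<open>exp (- q s)\<close> will be the characteristic function of the part of the series
  beyond time \<open>s\<close>. It must reproduce itself when one waits an exponential time
  \<open>x\<close>, multiplies by the mean cosine \<open>1 - f (s + x)\<close> of the term found
  there, and continues from \<open>s + x\<close>. Since \<open>q\<close> has derivative
  \<open>- f\<close>, this average is the integral of an exact derivative.\<close>

lemma renewal_fixed_point:
  fixes f :: "real \<Rightarrow> real"
  assumes f[measurable]: "f \<in> borel_measurable borel" and cont: "continuous_on {0<..} f"
    and f0: "\<And>x. 0 \<le> f x" and f2: "\<And>x. f x \<le> 2" and int: "set_integrable lborel {0..} f"
  defines "q \<equiv> tail_integral f"
  assumes s: "0 \<le> s"
  shows "(\<integral>x. (1 - f (s + x)) * exp (- q (s + x)) \<partial>density lborel (exponential_density 1)) = exp (- q s)"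
    and "0 \<le> q s" and "q \<in> borel_measurable borel"
proof -
  have ints: "set_integrable lborel {0..y} f" for y by (rule set_integrable_subset[OF int]) auto
  have q_nonneg: "0 \<le> q y" for y
    unfolding q_def tail_integral_def using set_integral_subset_le[OF ints int] f0 by simp
  then show "0 \<le> q s" .
  have q_HK: "q y = (LBINT y:{0..}. f y) - integral {0..y} f" for y
    unfolding q_def tail_integral_def using set_borel_integral_eq_integral(2)[OF ints] by simp
  have fi: "f integrable_on {0..y}" for y using set_borel_integral_eq_integral(1)[OF ints] .
  have dq: "(q has_real_derivative - f y) (at y)" if "0 < y" for y
  proof -
    have "continuous (at y within {0..y + 1}) f"
      by (rule continuous_at_imp_continuous_at_within) (use cont that in \<open>auto simp: continuous_on_eq_continuous_at\<close>)
    then have "((\<lambda>u. integral {0..u} f) has_vector_derivative f y) (at y within {0..y + 1})"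
      using integral_has_vector_derivative_continuous_at[OF fi, of y "y + 1" "{}"] that by simp
    then have "((\<lambda>u. integral {0..u} f) has_vector_derivative f y) (at y)"
      using that at_within_interior[of y "{0..y + 1}"] by simp
    then show ?thesis
      unfolding q_HK[abs_def] has_real_derivative_iff_has_vector_derivative[symmetric]
      by (auto intro!: derivative_eq_intros)
  qed
  have cq: "continuous_on {0..y} q" for y
    unfolding q_HK[abs_def] by (intro continuous_intros indefinite_integral_continuous_1 fi)
  show qm[measurable]: "q \<in> borel_measurable borel"
  proof -
    \<comment> \<open>Monotonicity gives measurability on the whole line, including negative
      arguments, where \<open>q\<close> is constant.\<close>
    have "mono (\<lambda>y. - q y)"
      unfolding q_def tail_integral_def using set_integral_subset_le[OF ints ints] f0 by (intro monoI) simp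
    from borel_measurable_uminus[OF borel_measurable_mono[OF this]] show ?thesis by simp
  qed
  let ?g = "\<lambda>x. exp (- x) * ((1 - f (s + x)) * exp (- q (s + x)))"
  \<comment> \<open>Differentiating \<open>exp (- x)\<close> gives the 1 and differentiating
    \<open>exp (- q (s + x))\<close> gives the \<open>- f (s + x)\<close> of the integrand.\<close>
  let ?G = "\<lambda>x. - (exp (- x) * exp (- q (s + x)))"
  have dqs: "((\<lambda>x. q (s + x)) has_real_derivative - f (s + x)) (at x)" if "0 < x" for x
    using dq[of "s + x"] DERIV_shift[of q "- f (s + x)" x s] that s by (simp add: add.commute)
  have eG: "(?G has_real_derivative ?g x) (at x)" if "0 < x" for x
  proof -
    note dqs[OF that]
    then show ?thesis by (auto intro!: derivative_eq_intros simp: algebra_simps)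
  qed
  have gint: "set_integrable lborel {0<..} ?g"
    unfolding set_integrable_def
  proof (rule Bochner_Integration.integrable_bound)
    show "integrable lborel (exponential_density 1)"
    proof (rule integrableI_nonneg)
      have "(\<integral>\<^sup>+x. ennreal (exponential_density 1 x) \<partial>lborel) = emeasure (density lborel (exponential_density 1)) UNIV"
        by (simp add: emeasure_density)
      also have "\<dots> = 1"
        using prob_space.emeasure_space_1[OF prob_space_exponential_density[of 1]] by simp
      finally show "(\<integral>\<^sup>+x. ennreal (exponential_density 1 x) \<partial>lborel) < \<infinity>" by simp
    qed (auto simp: exponential_density_def)
    show "AE x in lborel. norm (indicator {0<..} x *\<^sub>R ?g x) \<le> norm (exponential_density 1 x)"
    proof (rule AE_I2)
      fix x :: real
      \<comment> \<open>Values of \<open>f\<close> between 0 and 2 make \<open>1 - f\<close> at most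
        1 in modulus.\<close>
      have "\<bar>1 - f (s + x)\<bar> * exp (- q (s + x)) \<le> 1 * 1"
        using f0[of "s + x"] f2[of "s + x"] q_nonneg[of "s + x"] by (intro mult_mono) auto
      then have "exp (- x) * (\<bar>1 - f (s + x)\<bar> * exp (- q (s + x))) \<le> exp (- x) * 1"
        by (intro mult_left_mono) auto
      then show "norm (indicator {0<..} x *\<^sub>R ?g x) \<le> norm (exponential_density 1 x)"
        by (auto simp: exponential_density_def indicator_def abs_mult)
    qed
  qed measurable
  \<comment> \<open>For \<open>s = 0\<close> continuity of \<open>f\<close> at the left end is not
    given, so the boundary value rests on the continuity of the indefinite integral alone.\<close>
  have lim0: "(?G \<longlongrightarrow> - exp (- q s)) (at_right 0)"
  proof -
    have "continuous_on {0..1} (\<lambda>x. q (s + x))"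
      using s by (intro continuous_on_compose2[OF cq[of "s + 1"]] continuous_intros) auto
    then have "continuous (at 0 within {0..1}) (\<lambda>x. q (s + x))"
      by (auto simp: continuous_on_eq_continuous_within)
    then have "((\<lambda>x. q (s + x)) \<longlongrightarrow> q (s + 0)) (at 0 within {0..1})"
      by (simp add: continuous_within)
    then have "((\<lambda>x. q (s + x)) \<longlongrightarrow> q s) (at_right 0)"
      by (simp add: at_within_Icc_at_right)
    then have "(?G \<longlongrightarrow> - (exp (- 0) * exp (- q s))) (at_right 0)"
      by (intro tendsto_intros)
    then show ?thesis by simp
  qed
  have liminf: "(?G \<longlongrightarrow> 0) at_top"
  proof (rule Lim_null_comparison)
    show "((\<lambda>x::real. exp (- x)) \<longlongrightarrow> 0) at_top"
      by (rule exp_at_bot[THEN filterlim_compose]) (rule filterlim_uminus_at_bot_at_top)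
    show "\<forall>\<^sub>F x in at_top. norm (?G x) \<le> exp (- x)"
      using q_nonneg by (auto simp: mult_le_cancel_left1)
  qed
  have "(LBINT x=0..\<infinity>. ?g x) = 0 - (- exp (- q s))"
  proof (rule interval_integral_FTC_integrable[where F = ?G])
    fix x :: real assume x: "0 < ereal x" "ereal x < \<infinity>"
    then show "(?G has_vector_derivative ?g x) (at x)"
      using eG[of x] by (simp add: has_real_derivative_iff_has_vector_derivative)
    have "isCont (\<lambda>x. q (s + x)) x" using dqs[THEN DERIV_isCont, of x] x by simp
    moreover have "isCont f (s + x)" using cont x s by (auto simp: continuous_on_eq_continuous_at)
    then have "isCont (\<lambda>x. f (s + x)) x" by (intro isCont_o2[of x "\<lambda>x. s + x" f] continuous_intros)
    ultimately show "isCont ?g x" by (intro continuous_intros)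
  next
    show "set_integrable lborel (einterval 0 \<infinity>) ?g"
      using gint by (simp add: zero_ereal_def)
    show "((?G \<circ> real_of_ereal) \<longlongrightarrow> - exp (- q s)) (at_right 0)"
      using lim0 by (simp add: zero_ereal_def ereal_tendsto_simps)
    show "((?G \<circ> real_of_ereal) \<longlongrightarrow> 0) (at_left \<infinity>)"
      using liminf by (simp add: ereal_tendsto_simps)
  qed simp
  then have "(LBINT x:{0<..}. ?g x) = exp (- q s)"
    by (simp add: interval_lebesgue_integral_0_infty)
  moreover have "(\<integral>x. (1 - f (s + x)) * exp (- q (s + x)) \<partial>density lborel (exponential_density 1)) = (LBINT x:{0<..}. ?g x)"
  proof -
    have "(\<integral>x. (1 - f (s + x)) * exp (- q (s + x)) \<partial>density lborel (exponential_density 1))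
        = (\<integral>x. exponential_density 1 x *\<^sub>R ((1 - f (s + x)) * exp (- q (s + x))) \<partial>lborel)"
      by (rule integral_density) (auto simp: exponential_density_def)
    also have "\<dots> = (\<integral>x. indicator {0<..} x *\<^sub>R ?g x \<partial>lborel)"
    proof (rule integral_cong_AE)
      have "AE x in lborel. x \<noteq> (0::real)" by (rule AE_lborel_singleton)
      then show "AE x in lborel. exponential_density 1 x *\<^sub>R ((1 - f (s + x)) * exp (- q (s + x)))
          = indicator {0<..} x *\<^sub>R ?g x"
        by eventually_elim (auto simp: exponential_density_def indicator_def)
    qed measurable
    finally show ?thesis by (simp add: set_lebesgue_integral_def)
  qed
  ultimately show "(\<integral>x. (1 - f (s + x)) * exp (- q (s + x)) \<partial>density lborel (exponential_density 1)) = exp (- q s)"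
    by simp
qed

text \<open>Adding the bound \<open>B\<close> makes the integrand nonnegative, which reduces the
  claim to \<open>nn_integral_sign_average\<close>.\<close>

lemma (in rademacher_filtration) expectation_sign_average:
  fixes g :: "'a \<Rightarrow> real \<Rightarrow> real"
  assumes g: "\<And>\<sigma>. \<sigma> \<in> {1, -1} \<Longrightarrow> (\<lambda>\<omega>. g \<omega> \<sigma>) \<in> borel_measurable (F n)"
    and gm[measurable]: "(\<lambda>\<omega>. g \<omega> (\<gamma> n \<omega>)) \<in> borel_measurable M"
    and B: "\<And>\<omega> \<sigma>. \<bar>g \<omega> \<sigma>\<bar> \<le> B"
  shows "expectation (\<lambda>\<omega>. g \<omega> (\<gamma> n \<omega>)) = expectation (\<lambda>\<omega>. (g \<omega> 1 + g \<omega> (-1)) / 2)"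
proof -
  have [measurable]: "(\<lambda>\<omega>. g \<omega> 1) \<in> borel_measurable M" "(\<lambda>\<omega>. g \<omega> (-1)) \<in> borel_measurable M"
    using measurable_F_M[OF g] by auto
  have nonneg: "0 \<le> g \<omega> \<sigma> + B" for \<omega> \<sigma> using B[of \<omega> \<sigma>] by auto
  have nonneg2: "0 \<le> (g \<omega> 1 + B) + (g \<omega> (-1) + B)" for \<omega>
    using nonneg[of \<omega> 1] nonneg[of \<omega> "-1"] by linarith
  have i0: "integrable M (\<lambda>\<omega>. g \<omega> (\<gamma> n \<omega>))" "integrable M (\<lambda>\<omega>. g \<omega> 1)" "integrable M (\<lambda>\<omega>. g \<omega> (-1))"
    using B by (auto intro!: integrable_const_bound[where B = B] simp: measurable_def)
  have "2 * (\<integral>\<^sup>+\<omega>. ennreal (g \<omega> (\<gamma> n \<omega>) + B) \<partial>M) = (\<integral>\<^sup>+\<omega>. ennreal (g \<omega> 1 + B) + ennreal (g \<omega> (-1) + B) \<partial>M)"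
    by (rule nn_integral_sign_average) (use g in auto)
  also have "\<dots> = (\<integral>\<^sup>+\<omega>. ennreal ((g \<omega> 1 + B) + (g \<omega> (-1) + B)) \<partial>M)"
    using nonneg by (intro nn_integral_cong ennreal_plus[symmetric])
  also have "\<dots> = ennreal (expectation (\<lambda>\<omega>. (g \<omega> 1 + B) + (g \<omega> (-1) + B)))"
    using i0 by (intro nn_integral_eq_integral AE_I2 nonneg2) auto
  also have "(\<integral>\<^sup>+\<omega>. ennreal (g \<omega> (\<gamma> n \<omega>) + B) \<partial>M) = ennreal (expectation (\<lambda>\<omega>. g \<omega> (\<gamma> n \<omega>) + B))"
    using nonneg i0 by (intro nn_integral_eq_integral) auto
  finally have "2 * ennreal (expectation (\<lambda>\<omega>. g \<omega> (\<gamma> n \<omega>) + B))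
      = ennreal (expectation (\<lambda>\<omega>. (g \<omega> 1 + B) + (g \<omega> (-1) + B)))" .
  moreover have n1: "0 \<le> expectation (\<lambda>\<omega>. g \<omega> (\<gamma> n \<omega>) + B)"
    by (rule integral_nonneg_AE, rule AE_I2, rule nonneg)
  moreover have "0 \<le> expectation (\<lambda>\<omega>. (g \<omega> 1 + B) + (g \<omega> (-1) + B))"
    by (rule integral_nonneg_AE, rule AE_I2, rule nonneg2)
  moreover have "2 * ennreal (expectation (\<lambda>\<omega>. g \<omega> (\<gamma> n \<omega>) + B)) = ennreal (2 * expectation (\<lambda>\<omega>. g \<omega> (\<gamma> n \<omega>) + B))"
    using n1 by (subst ennreal_mult) auto
  ultimately have "2 * expectation (\<lambda>\<omega>. g \<omega> (\<gamma> n \<omega>) + B) = expectation (\<lambda>\<omega>. (g \<omega> 1 + B) + (g \<omega> (-1) + B))"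
    by (metis ennreal_inj mult_nonneg_nonneg zero_le_numeral)
  then show ?thesis using i0 by (simp add: prob_space)
qed

context lepage
begin

text \<open>Fubini's theorem for the product of the laws of \<open>U\<close>, of the next waiting
  time and of its mark: the last two are averaged with \<open>U\<close> frozen. \<open>U\<close>
  will consist of the partial sum and the last arrival time.\<close>

lemma expectation_next_point:
  assumes U: "indep_var (borel \<Otimes>\<^sub>M borel) U (borel \<Otimes>\<^sub>M borel) (\<lambda>\<omega>. (T n \<omega>, V n \<omega>))"
    and g[measurable]: "g \<in> borel_measurable ((borel \<Otimes>\<^sub>M borel) \<Otimes>\<^sub>M (borel \<Otimes>\<^sub>M borel))"
    and B: "\<And>z. \<bar>g z\<bar> \<le> (B::real)"
  shows "expectation (\<lambda>\<omega>. g (U \<omega>, (T n \<omega>, V n \<omega>)))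
    = expectation (\<lambda>\<omega>. \<integral>x. \<integral>v. g (U \<omega>, (x, v)) \<partial>\<nu> \<partial>density lborel (exponential_density 1))"
proof -
  let ?Q = "density lborel (\<lambda>x. ennreal (exponential_density 1 x))"
  let ?U = "distr M (borel \<Otimes>\<^sub>M borel) U"
  have [measurable]: "U \<in> measurable M (borel \<Otimes>\<^sub>M borel)" using indep_var_rv1[OF U] .
  interpret \<nu>: prob_space \<nu> by (rule prob_space_\<nu>)
  interpret Q: prob_space ?Q by (rule prob_space_exponential_density) simp
  interpret Q\<nu>: pair_prob_space ?Q \<nu> ..
  interpret U: prob_space ?U by (rule prob_space_distr) measurable
  interpret UQ: pair_prob_space ?U "?Q \<Otimes>\<^sub>M \<nu>" ..
  have TQ: "distr M borel (T n) = ?Q"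
    using distributed_distr_eq_density[OF T_exponential[of n]] by (simp cong: distr_cong)
  have "indep_var borel (T n) borel (V n)"
    by (rule indep_function_of_blocks[of "{(0, n)}" "{(1, n)}" "\<lambda>f. f (0, n)" _ "\<lambda>f. f (1, n)"])
       (auto intro!: measurable_component_singleton)
  then have TV: "distr M (borel \<Otimes>\<^sub>M borel) (\<lambda>\<omega>. (T n \<omega>, V n \<omega>)) = ?Q \<Otimes>\<^sub>M \<nu>"
    using TQ V_distr by (simp add: indep_var_distribution_eq)
  have gi: "integrable (?U \<Otimes>\<^sub>M (?Q \<Otimes>\<^sub>M \<nu>)) g"
    by (rule UQ.P.integrable_const_bound[where B = B]) (use B in auto)
  have "expectation (\<lambda>\<omega>. g (U \<omega>, (T n \<omega>, V n \<omega>)))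
      = (\<integral>z. g z \<partial>distr M ((borel \<Otimes>\<^sub>M borel) \<Otimes>\<^sub>M (borel \<Otimes>\<^sub>M borel)) (\<lambda>\<omega>. (U \<omega>, (T n \<omega>, V n \<omega>))))"
    by (subst integral_distr) auto
  also have "distr M ((borel \<Otimes>\<^sub>M borel) \<Otimes>\<^sub>M (borel \<Otimes>\<^sub>M borel)) (\<lambda>\<omega>. (U \<omega>, (T n \<omega>, V n \<omega>))) = ?U \<Otimes>\<^sub>M (?Q \<Otimes>\<^sub>M \<nu>)"
    using U TV by (simp add: indep_var_distribution_eq)
  also have "(\<integral>z. g z \<partial>(?U \<Otimes>\<^sub>M (?Q \<Otimes>\<^sub>M \<nu>))) = (\<integral>u. \<integral>z. g (u, z) \<partial>(?Q \<Otimes>\<^sub>M \<nu>) \<partial>?U)"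
    using UQ.integral_fst'[OF gi] by simp
  also have "\<dots> = (\<integral>u. \<integral>x. \<integral>v. g (u, (x, v)) \<partial>\<nu> \<partial>?Q \<partial>?U)"
  proof (rule Bochner_Integration.integral_cong[OF refl])
    fix u
    have "(\<lambda>z. g (u, z)) \<in> borel_measurable (borel \<Otimes>\<^sub>M borel)"
      by (rule measurable_compose[OF measurable_Pair1' g]) (simp add: space_pair_measure)
    then have "integrable (?Q \<Otimes>\<^sub>M \<nu>) (\<lambda>z. g (u, z))"
      by (intro Q\<nu>.P.integrable_const_bound[where B = B]) (use B in \<open>auto cong: measurable_cong_sets\<close>)
    then show "(\<integral>z. g (u, z) \<partial>(?Q \<Otimes>\<^sub>M \<nu>)) = (\<integral>x. \<integral>v. g (u, (x, v)) \<partial>\<nu> \<partial>?Q)"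
      by (rule Q\<nu>.integral_fst'[symmetric])
  qed
  also have "\<dots> = expectation (\<lambda>\<omega>. \<integral>x. \<integral>v. g (U \<omega>, (x, v)) \<partial>\<nu> \<partial>?Q)"
    by (subst integral_distr) auto
  finally show ?thesis .
qed

text \<open>The product of \<open>cos\<close> of the partial sum with the conjectured characteristic function of the remainder,
  given the last arrival time, has constant expectation in the number of terms.\<close>

theorem expectation_cos_series:
  assumes a[measurable]: "a \<in> borel_measurable (borel \<Otimes>\<^sub>M borel)"
    and cont: "\<And>v. continuous_on {0<..} (\<lambda>x. a (x, v))" and conv: "series_converges a"
    and q0: "0 \<le> q0" "(\<integral>\<^sup>+x\<in>{0..}. (\<integral>\<^sup>+v. ennreal (1 - cos (a (x, v))) \<partial>\<nu>) \<partial>lborel) = ennreal q0"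
  shows "expectation (\<lambda>\<omega>. cos (series a \<omega>)) = exp (- q0)"
proof -
  interpret \<nu>: prob_space \<nu> by (rule prob_space_\<nu>)
  interpret Q: prob_space "density lborel (\<lambda>x. ennreal (exponential_density 1 x))"
    by (rule prob_space_exponential_density) simp
  define \<phi> where "\<phi> x = (\<integral>v. cos (a (x, v)) \<partial>\<nu>)" for x
  \<comment> \<open>The mean of \<open>1 - cos\<close> at arrival time \<open>x\<close>; its
    integral over the half line is \<open>q0\<close>.\<close>
  define f where "f x = 1 - \<phi> x" for x
  have ci: "integrable \<nu> (\<lambda>v. cos (a (x, v)))" for x
    by (rule \<nu>.integrable_const_bound[where B = 1]) auto
  have [measurable]: "\<phi> \<in> borel_measurable borel" unfolding \<phi>_def[abs_def] by measurable
  then have [measurable]: "f \<in> borel_measurable borel" unfolding f_def[abs_def] by measurable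
  have fI: "f x = (\<integral>v. 1 - cos (a (x, v)) \<partial>\<nu>)" for x
    unfolding f_def \<phi>_def using ci by (simp add: \<nu>.prob_space)
  have f0: "0 \<le> f x" for x unfolding fI by (rule integral_nonneg_AE) auto
  have f2: "f x \<le> 2" for x
  proof -
    have "f x \<le> (\<integral>v. 2 \<partial>\<nu>)"
      unfolding fI using ci by (intro integral_mono) (auto simp: algebra_simps, smt (verit) cos_ge_minus_one)
    then show ?thesis by (simp add: \<nu>.prob_space)
  qed
  have f_cont: "continuous_on {0<..} f"
  proof -
    have "continuous_on {0<..} \<phi>"
      unfolding continuous_on_sequentially
    proof safe
      fix x :: "nat \<Rightarrow> real" and l assume l: "0 < l" and x: "\<forall>n. x n \<in> {0<..}" "x \<longlonglongrightarrow> l"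
      have "(\<lambda>n. \<integral>v. cos (a (x n, v)) \<partial>\<nu>) \<longlonglongrightarrow> (\<integral>v. cos (a (l, v)) \<partial>\<nu>)"
      proof (rule integral_dominated_convergence[where w = "\<lambda>_. 1"])
        show "AE v in \<nu>. (\<lambda>n. cos (a (x n, v))) \<longlonglongrightarrow> cos (a (l, v))"
        proof (rule AE_I2)
          fix v
          have "(\<lambda>n. a (x n, v)) \<longlonglongrightarrow> a (l, v)"
            using cont[of v] l x by (intro continuous_on_tendsto_compose[OF cont]) auto
          then show "(\<lambda>n. cos (a (x n, v))) \<longlonglongrightarrow> cos (a (l, v))" by (rule tendsto_cos)
        qed
      qed auto
      then show "(\<phi> \<circ> x) \<longlonglongrightarrow> \<phi> l" by (simp add: \<phi>_def comp_def)
    qed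
    then show ?thesis unfolding f_def[abs_def] by (intro continuous_intros)
  qed
  have fnn: "ennreal (f x) = (\<integral>\<^sup>+v. ennreal (1 - cos (a (x, v))) \<partial>\<nu>)" for x
    unfolding fI using ci by (intro nn_integral_eq_integral[symmetric]) auto
  have "has_bochner_integral lborel (\<lambda>x. indicator {0..} x *\<^sub>R f x) q0"
  proof (rule has_bochner_integral_nn_integral)
    show "(\<integral>\<^sup>+x. ennreal (indicator {0..} x *\<^sub>R f x) \<partial>lborel) = ennreal q0"
      unfolding q0(2)[symmetric] fnn[symmetric] by (intro nn_integral_cong) (auto simp: indicator_def)
  qed (use f0 q0 in auto)
  then have f_int: "set_integrable lborel {0..} f" and f_q0: "(LBINT y:{0..}. f y) = q0"
    by (auto simp: has_bochner_integral_iff set_integrable_def set_lebesgue_integral_def)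
  note renewal = renewal_fixed_point[OF _ f_cont f0 f2 f_int]
  define w where "w y = exp (- tail_integral f y)" for y
  have [measurable]: "w \<in> borel_measurable borel"
    using renewal(3)[of 0] unfolding w_def[abs_def] by measurable
  have w_nonneg: "0 \<le> w y" for y by (simp add: w_def)
  have w_le: "w y \<le> 1" for y
  proof -
    have "set_integrable lborel {0..y} f" by (rule set_integrable_subset[OF f_int]) auto
    from set_integral_subset_le[OF this f_int _ f0]
    have "(LBINT t:{0..y}. f t) \<le> (LBINT t:{0..}. f t)" by simp
    then show ?thesis by (simp add: w_def tail_integral_def)
  qed
  define S where "S n \<omega> = (\<Sum>i<n. \<gamma> i \<omega> * a (arrival i \<omega>, V i \<omega>))" for n \<omega>
  \<comment> \<open>The last arrival time before the term \<open>n\<close>, with the value 0 for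
    \<open>n = 0\<close>.\<close>
  define A where "A n \<omega> = (\<Sum>k<n. T k \<omega>)" for n \<omega>
  have arrival_A: "arrival n \<omega> = A n \<omega> + T n \<omega>" for n \<omega>
    by (simp add: arrival_def A_def lessThan_Suc_atMost[symmetric])
  have [measurable]: "S n \<in> borel_measurable M" "A n \<in> borel_measurable M" for n
    unfolding S_def[abs_def] A_def[abs_def] by measurable
  have [measurable]: "S n \<in> borel_measurable (past n)" for n
    unfolding S_def[abs_def] by (rule measurable_partial_sum) (rule term_past[OF a])
  have A_nonneg: "AE \<omega> in M. 0 \<le> A n \<omega>" for n
  proof -
    have "AE \<omega> in M. \<forall>i. 0 < T i \<omega>" using AE_T_pos by (simp add: AE_all_countable)
    then show ?thesis by eventually_elim (simp add: A_def sum_nonneg less_imp_le)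
  qed
  have step: "expectation (\<lambda>\<omega>. cos (S n \<omega>) * w (A n \<omega>)) = exp (- q0)" for n
  proof (induction n)
    case 0
    \<comment> \<open>With no terms and time 0, \<open>w\<close> already has the claimed
      value.\<close>
    then show ?case by (simp add: S_def A_def w_def tail_integral_zero f_q0 prob_space)
  next
    case (Suc n)
    let ?g = "\<lambda>\<omega> \<sigma>. cos (S n \<omega> + \<sigma> * a (arrival n \<omega>, V n \<omega>)) * w (arrival n \<omega>)"
    define G where "G z = cos (fst (fst z)) * cos (a (snd (fst z) + fst (snd z), snd (snd z)))
        * w (snd (fst z) + fst (snd z))" for z :: "(real \<times> real) \<times> (real \<times> real)"
    have [measurable]: "G \<in> borel_measurable ((borel \<Otimes>\<^sub>M borel) \<Otimes>\<^sub>M (borel \<Otimes>\<^sub>M borel))"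
      unfolding G_def[abs_def] by measurable
    have bound: "\<bar>cos x * w y\<bar> \<le> 1" for x y
      using w_nonneg[of y] w_le[of y] abs_cos_le_one[of x]
      by (simp add: abs_mult mult_le_one)
    have "expectation (\<lambda>\<omega>. cos (S (Suc n) \<omega>) * w (A (Suc n) \<omega>)) = expectation (\<lambda>\<omega>. ?g \<omega> (\<gamma> n \<omega>))"
      by (simp add: S_def arrival_A A_def)
    \<comment> \<open>Averaging over the sign leaves \<open>cos S * cos a\<close> of the addition
      formula; the sine terms cancel.\<close>
    also have "\<dots> = expectation (\<lambda>\<omega>. (?g \<omega> 1 + ?g \<omega> (-1)) / 2)"
      by (rule expectation_sign_average[where B = 1]) (measurable, rule bound)
    also have "\<dots> = expectation (\<lambda>\<omega>. cos (S n \<omega>) * cos (a (A n \<omega> + T n \<omega>, V n \<omega>)) * w (A n \<omega> + T n \<omega>))"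
      by (intro Bochner_Integration.integral_cong refl) (simp add: arrival_A cos_add cos_diff algebra_simps)
    also have "\<dots> = expectation (\<lambda>\<omega>. G ((S n \<omega>, A n \<omega>), (T n \<omega>, V n \<omega>)))" by (simp add: G_def)
    also have "\<dots> = expectation (\<lambda>\<omega>. \<integral>x. \<integral>v. G ((S n \<omega>, A n \<omega>), (x, v)) \<partial>\<nu> \<partial>density lborel (exponential_density 1))"
    proof (rule expectation_next_point[where B = 1])
      have [measurable]: "(\<lambda>f::nat\<times>nat\<Rightarrow>real. f j) \<in> borel_measurable (Pi\<^sub>M J (\<lambda>_. borel))" if "j \<in> J" for j J
        using that by (rule measurable_component_singleton)
      \<comment> \<open>Partial sum and last arrival time use indices below \<open>n\<close> only,
        disjoint from those of the next waiting time and mark.\<close>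
      let ?J = "{..<3::nat} \<times> {..<n}"
      show "indep_var (borel \<Otimes>\<^sub>M borel) (\<lambda>\<omega>. (S n \<omega>, A n \<omega>)) (borel \<Otimes>\<^sub>M borel) (\<lambda>\<omega>. (T n \<omega>, V n \<omega>))"
      proof (rule indep_function_of_blocks[of ?J "{(0, n), (1, n)}"
            "\<lambda>f. (\<Sum>i<n. f (2, i) * a (\<Sum>k\<le>i. f (0, k), f (1, i)), \<Sum>k<n. f (0, k))" _ "\<lambda>f. (f (0, n), f (1, n))"])
        show "(\<lambda>f. (\<Sum>i<n. f (2, i) * a (\<Sum>k\<le>i. f (0, k), f (1, i)), \<Sum>k<n. f (0, k)))
            \<in> measurable (Pi\<^sub>M ?J (\<lambda>_. borel)) (borel \<Otimes>\<^sub>M borel)"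
          by (intro measurable_Pair borel_measurable_sum borel_measurable_times measurable_compose[OF _ a]
              measurable_component_singleton) auto
        show "(\<lambda>f. (f (0, n), f (1, n))) \<in> measurable (Pi\<^sub>M {(0, n), (1::nat, n)} (\<lambda>_. borel)) (borel \<Otimes>\<^sub>M borel)"
          by (intro measurable_Pair measurable_component_singleton) auto
      qed (auto simp: S_def A_def arrival_def intro!: sum.cong)
      show "\<bar>G z\<bar> \<le> 1" for z
        using bound[of "a (snd (fst z) + fst (snd z), snd (snd z))" "snd (fst z) + fst (snd z)"]
          abs_cos_le_one[of "fst (fst z)"]
        by (simp add: G_def abs_mult mult.assoc mult_le_one)
    qed measurable
    also have "\<dots> = expectation (\<lambda>\<omega>. cos (S n \<omega>) * (\<integral>x. (1 - f (A n \<omega> + x)) * w (A n \<omega> + x) \<partial>density lborel (exponential_density 1)))"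
      by (simp add: G_def f_def \<phi>_def mult.assoc mult.left_commute)
    \<comment> \<open>The fixed-point identity, taken at the current arrival time, removes the
      averaged step.\<close>
    also have "\<dots> = expectation (\<lambda>\<omega>. cos (S n \<omega>) * w (A n \<omega>))"
    proof (rule integral_cong_AE)
      show "AE \<omega> in M. cos (S n \<omega>) * (\<integral>x. (1 - f (A n \<omega> + x)) * w (A n \<omega> + x) \<partial>density lborel (exponential_density 1))
          = cos (S n \<omega>) * w (A n \<omega>)"
        using A_nonneg[of n]
      proof eventually_elim
        case (elim \<omega>)
        then show ?case using renewal(1)[of "A n \<omega>"] by (simp add: w_def)
      qed
    qed measurable
    also have "\<dots> = exp (- q0)" by (rule Suc.IH)
    finally show ?case .
  qed
  \<comment> \<open>Arrival times tend to infinity, so \<open>w\<close> tends to 1 along them, while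
    the expectations do not change.\<close>
  have "(\<lambda>n. expectation (\<lambda>\<omega>. cos (S n \<omega>) * w (A n \<omega>))) \<longlonglongrightarrow> expectation (\<lambda>\<omega>. cos (series a \<omega>))"
  proof (rule integral_dominated_convergence[where w = "\<lambda>_. 1"])
    show "AE \<omega> in M. (\<lambda>n. cos (S n \<omega>) * w (A n \<omega>)) \<longlonglongrightarrow> cos (series a \<omega>)"
      using conv[unfolded series_converges_def] AE_arrival_at_top
    proof eventually_elim
      case (elim \<omega>)
      have "(\<lambda>n. S n \<omega>) \<longlonglongrightarrow> series a \<omega>"
        unfolding S_def series_def by (rule summable_LIMSEQ[OF elim(1)])
      moreover have "filterlim (\<lambda>n. A (Suc n) \<omega>) at_top sequentially"
        using elim(2) by (simp add: arrival_A A_def)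
      then have "filterlim (\<lambda>n. A n \<omega>) at_top sequentially"
        by (simp add: filterlim_sequentially_Suc[of "\<lambda>n. A n \<omega>"])
      then have "(\<lambda>n. tail_integral f (A n \<omega>)) \<longlonglongrightarrow> 0"
        by (rule filterlim_compose[OF tail_integral_at_top[OF f_int]])
      ultimately have "(\<lambda>n. cos (S n \<omega>) * exp (- tail_integral f (A n \<omega>))) \<longlonglongrightarrow> cos (series a \<omega>) * exp (- 0)"
        by (intro tendsto_intros)
      then show ?case by (simp add: w_def)
    qed
    show "AE \<omega> in M. norm (cos (S n \<omega>) * w (A n \<omega>)) \<le> 1" for n
      using w_nonneg w_le by (auto simp: abs_mult intro!: mult_le_one)
  qed auto
  then show ?thesis using step LIMSEQ_unique[OF tendsto_const] by (simp add: LIMSEQ_const_iff)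
qed

end

section \<open>Stable moments\<close>

text \<open>Below 1 the smallest exponent gives the largest power, above 1 the largest one does; the
  sum of both covers either case.\<close>

lemma powr_le_near_exponents:
  fixes z p p0 \<delta> :: real
  assumes "0 < z" "\<bar>p - p0\<bar> \<le> \<delta>"
  shows "z powr p \<le> z powr (p0 - \<delta>) + z powr (p0 + \<delta>)"
proof (cases "1 \<le> z")
  case True
  then have "z powr p \<le> z powr (p0 + \<delta>)" using assms by (intro powr_mono) auto
  then show ?thesis by (simp add: add_increasing)
next
  case False
  then have "z powr p \<le> z powr (p0 - \<delta>)" using assms by (intro powr_mono') auto
  then show ?thesis by (simp add: add_increasing2)
qed

text \<open>Half of the margin \<open>\<delta>\<close> covers the deviation of \<open>p\<close> from
  \<open>p0\<close>; the other half absorbs the logarithm through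
  \<open>ln y \<le> 2 / \<delta> * y powr (\<delta> / 2)\<close>, applied to \<open>z\<close> or to
  \<open>1 / z\<close>.\<close>

lemma abs_ln_mult_powr_le:
  fixes z p p0 \<delta> :: real
  assumes z: "0 < z" and d: "0 < \<delta>" and p: "\<bar>p - p0\<bar> \<le> \<delta> / 2"
  shows "\<bar>ln z\<bar> * z powr p \<le> 2 / \<delta> * (z powr (p0 - \<delta>) + z powr (p0 + \<delta>))"
proof -
  have pb: "p \<le> p0 + \<delta> / 2" "p0 - \<delta> / 2 \<le> p" using p by linarith+
  have *: "ln y * y powr - (\<delta> / 2) \<le> 2 / \<delta>" if "1 \<le> y" for y :: real
    using ln_powr_bound[OF that, of "\<delta> / 2"] that d by (simp add: powr_minus field_simps)
  show ?thesis
  proof (cases "1 \<le> z")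
    case True
    have "\<bar>ln z\<bar> * z powr p \<le> ln z * z powr (p0 + \<delta> / 2)"
      using True pb by (auto intro!: mult_left_mono powr_mono)
    also have "\<dots> = (ln z * z powr - (\<delta> / 2)) * z powr (p0 + \<delta>)"
      by (simp add: powr_add[symmetric] add.commute)
    also have "\<dots> \<le> 2 / \<delta> * z powr (p0 + \<delta>)" by (intro mult_right_mono *[OF True]) simp
    also have "\<dots> \<le> 2 / \<delta> * (z powr (p0 - \<delta>) + z powr (p0 + \<delta>))"
      using d by (intro mult_left_mono) auto
    finally show ?thesis .
  next
    case False
    then have y: "1 \<le> 1 / z" using z by simp
    have "\<bar>ln z\<bar> * z powr p \<le> ln (1 / z) * z powr (p0 - \<delta> / 2)"
      using False z pb by (auto simp: ln_div intro!: mult_left_mono powr_mono')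
    also have "\<dots> = (ln (1 / z) * (1 / z) powr - (\<delta> / 2)) * z powr (p0 - \<delta>)"
      using z by (simp add: powr_divide powr_minus_divide powr_add[symmetric] field_simps)
    also have "\<dots> \<le> 2 / \<delta> * z powr (p0 - \<delta>)" by (intro mult_right_mono *[OF y]) simp
    also have "\<dots> \<le> 2 / \<delta> * (z powr (p0 - \<delta>) + z powr (p0 + \<delta>))"
      using d by (intro mult_left_mono) auto
    finally show ?thesis .
  qed
qed

text \<open>The mean value theorem in the exponent, with the derivative
  \<open>ln z * z powr r\<close> bounded uniformly between the two exponents.\<close>

lemma abs_powr_diff_exponents_le:
  fixes z p q p0 \<delta> :: real
  assumes z: "0 < z" and d: "0 < \<delta>" and p: "\<bar>p - p0\<bar> \<le> \<delta> / 2" and q: "\<bar>q - p0\<bar> \<le> \<delta> / 2"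
  shows "\<bar>z powr q - z powr p\<bar> \<le> \<bar>q - p\<bar> * (2 / \<delta> * (z powr (p0 - \<delta>) + z powr (p0 + \<delta>)))"
proof -
  have "\<bar>z powr v - z powr u\<bar> \<le> \<bar>v - u\<bar> * (2 / \<delta> * (z powr (p0 - \<delta>) + z powr (p0 + \<delta>)))"
    if "u < v" "\<bar>u - p0\<bar> \<le> \<delta> / 2" "\<bar>v - p0\<bar> \<le> \<delta> / 2" for u v
  proof -
    have "\<exists>r>u. r < v \<and> z powr v - z powr u = (v - u) * (ln z * z powr r)"
      using z that(1) by (intro MVT2) (auto intro!: derivative_eq_intros)
    then obtain r where r: "u < r" "r < v" "z powr v - z powr u = (v - u) * (ln z * z powr r)" by blast
    have "\<bar>z powr v - z powr u\<bar> = \<bar>v - u\<bar> * (\<bar>ln z\<bar> * z powr r)"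
      unfolding r(3) by (simp add: abs_mult)
    also have "\<dots> \<le> \<bar>v - u\<bar> * (2 / \<delta> * (z powr (p0 - \<delta>) + z powr (p0 + \<delta>)))"
    proof (intro mult_left_mono abs_ln_mult_powr_le z d)
      show "\<bar>r - p0\<bar> \<le> \<delta> / 2" using r(1,2) that by linarith
    qed simp
    finally show ?thesis .
  qed
  from this[of p q] this[of q p] p q show ?thesis
    by (cases p q rule: linorder_cases) (auto simp: abs_minus_commute)
qed

section \<open>The scale constant of the stable law and the sine integral\<close>

lemma one_minus_cos_le: "1 - cos y \<le> y\<^sup>2 / 2" for y :: real
proof -
  have "1 - cos y = 2 * (sin (y / 2))\<^sup>2" using cos_double_sin[of "y / 2"] by simp
  also have "\<dots> \<le> 2 * (y / 2)\<^sup>2"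
    using abs_sin_x_le_abs_x[of "y / 2"] by (intro mult_left_mono) (auto simp: abs_le_square_iff[symmetric])
  finally show ?thesis by (simp add: power_divide)
qed

lemma one_minus_cos_le_square: "1 - cos y \<le> y\<^sup>2" for y :: real
  by (rule order_trans[OF one_minus_cos_le]) simp

lemma nn_integral_powr_unit_split:
  fixes f :: "real \<Rightarrow> real"
  assumes [measurable]: "f \<in> borel_measurable borel" and r: "r < 1" and s: "1 < s"
    and c: "0 \<le> c1" "0 \<le> c2"
    and "\<And>y. 0 < y \<Longrightarrow> y \<le> 1 \<Longrightarrow> f y \<le> c1 * y powr - r" "\<And>y. 1 \<le> y \<Longrightarrow> f y \<le> c2 * y powr - s"
  shows "(\<integral>\<^sup>+y\<in>{0<..}. ennreal (f y) \<partial>lborel) \<le> ennreal (c1 / (1 - r) + c2 / (s - 1))"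
proof -
  have "(\<integral>\<^sup>+y\<in>{0<..}. ennreal (f y) \<partial>lborel)
      \<le> (\<integral>\<^sup>+y. ennreal c1 * (ennreal (y powr - r) * indicator {0..1} y) + ennreal c2 * (ennreal (y powr - s) * indicator {1..} y) \<partial>lborel)"
  proof (rule nn_integral_mono)
    fix y :: real
    consider "y \<le> 0" | "0 < y" "y \<le> 1" | "1 < y" by linarith
    then show "ennreal (f y) * indicator {0<..} y
      \<le> ennreal c1 * (ennreal (y powr - r) * indicator {0..1} y) + ennreal c2 * (ennreal (y powr - s) * indicator {1..} y)"
    proof cases
      case 2
      then have "ennreal (f y) \<le> ennreal c1 * ennreal (y powr - r)"
        using assms(6) c by (simp add: ennreal_mult[symmetric] ennreal_leI)
      then show ?thesis using 2 by (simp add: add_increasing2)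
    next
      case 3
      then have "ennreal (f y) \<le> ennreal c2 * ennreal (y powr - s)"
        using assms(7)[of y] c by (simp add: ennreal_mult[symmetric] ennreal_leI)
      then show ?thesis using 3 by (simp add: add_increasing)
    qed simp
  qed
  also have "\<dots> = ennreal c1 * ennreal (1 / (1 - r)) + ennreal c2 * ennreal (1 / (s - 1))"
    using nn_integral_powr_near_0[OF r] nn_integral_powr_near_infinity[OF s]
    by (simp add: nn_integral_add nn_integral_cmult)
  also have "\<dots> = ennreal (c1 / (1 - r) + c2 / (s - 1))"
    using c r s by (simp add: ennreal_mult[symmetric])
  finally show ?thesis .
qed

lemma set_integrable_nonnegI:
  fixes f :: "real \<Rightarrow> real"
  assumes [measurable]: "f \<in> borel_measurable borel" "A \<in> sets borel" and "\<And>y. y \<in> A \<Longrightarrow> 0 \<le> f y"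
    and "(\<integral>\<^sup>+y\<in>A. ennreal (f y) \<partial>lborel) < \<infinity>"
  shows "set_integrable lborel A f"
  unfolding set_integrable_def
proof (rule integrableI_nonneg)
  have "(\<integral>\<^sup>+y. ennreal (indicator A y *\<^sub>R f y) \<partial>lborel) = (\<integral>\<^sup>+y\<in>A. ennreal (f y) \<partial>lborel)"
    by (intro nn_integral_cong) (auto simp: indicator_def)
  then show "(\<integral>\<^sup>+y. ennreal (indicator A y *\<^sub>R f y) \<partial>lborel) < \<infinity>" using assms(4) by simp
qed (use assms(3) in \<open>auto simp: indicator_def\<close>)

lemma nn_integral_eq_set_integral:
  fixes f :: "real \<Rightarrow> real"
  assumes "set_integrable lborel A f" "\<And>y. y \<in> A \<Longrightarrow> 0 \<le> f y"
  shows "(\<integral>\<^sup>+y\<in>A. ennreal (f y) \<partial>lborel) = ennreal (LBINT y:A. f y)"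
proof -
  have "(\<integral>\<^sup>+y\<in>A. ennreal (f y) \<partial>lborel) = (\<integral>\<^sup>+y. ennreal (indicator A y *\<^sub>R f y) \<partial>lborel)"
    by (intro nn_integral_cong) (auto simp: indicator_def)
  also have "\<dots> = ennreal (LBINT y:A. f y)"
    using assms unfolding set_lebesgue_integral_def set_integrable_def
    by (intro nn_integral_eq_integral) (auto simp: indicator_def)
  finally show ?thesis .
qed

text \<open>At 0 the quadratic bound on \<open>1 - cos\<close> suffices because
  \<open>r < 2\<close>, at infinity boundedness does because \<open>0 < r\<close>.\<close>

lemma one_minus_cos_powr_integrable:
  fixes r :: real
  assumes "0 < r" "r < 2"
  shows "set_integrable lborel {0<..} (\<lambda>y. (1 - cos y) * y powr (- r - 1))"
proof (rule set_integrable_nonnegI)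
  have "(\<integral>\<^sup>+y\<in>{0<..}. ennreal ((1 - cos y) * y powr (- r - 1)) \<partial>lborel)
      \<le> ennreal (1 / (1 - (r - 1)) + 2 / (r + 1 - 1))"
  proof (rule nn_integral_powr_unit_split)
    fix y :: real assume y: "0 < y" "y \<le> 1"
    have "(1 - cos y) * y powr (- r - 1) \<le> y\<^sup>2 * y powr (- r - 1)"
      using one_minus_cos_le_square[of y] by (intro mult_right_mono) auto
    also have "\<dots> = y powr (2 + (- r - 1))" using y by (subst powr_add) (simp add: powr_numeral)
    finally show "(1 - cos y) * y powr (- r - 1) \<le> 1 * y powr - (r - 1)" by (simp add: algebra_simps)
  next
    fix y :: real assume y: "1 \<le> y"
    show "(1 - cos y) * y powr (- r - 1) \<le> 2 * y powr - (r + 1)"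
      using cos_ge_minus_one[of y] by (simp add: mult_right_mono)
  qed (use assms in auto)
  then show "(\<integral>\<^sup>+y\<in>{0<..}. ennreal ((1 - cos y) * y powr (- r - 1)) \<partial>lborel) < \<infinity>"
    by (rule le_less_trans) simp
qed auto

text \<open>By parts this is the conditionally convergent integral of
  \<open>y powr (- r) * sin y\<close>, the reciprocal of \<open>C_stable r\<close>; the form chosen
  here converges absolutely. It is also the integral of \<open>1 - cos (x powr (- 1 / r))\<close>
  over the positive half line.\<close>

definition stable_const :: "real \<Rightarrow> real" where
  "stable_const r = r * (LBINT y:{0<..}. (1 - cos y) * y powr (- r - 1))"

lemma integral_lborel_pos:
  fixes f :: "real \<Rightarrow> real"
  assumes f: "integrable lborel f" and nonneg: "\<And>y. 0 \<le> f y"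
    and pos: "\<And>y. 0 < y \<Longrightarrow> y < u \<Longrightarrow> 0 < f y" and u: "0 < u"
  shows "0 < (\<integral>y. f y \<partial>lborel)"
proof -
  have "0 \<le> (\<integral>y. f y \<partial>lborel)" using nonneg by (intro integral_nonneg_AE) auto
  moreover have "(\<integral>y. f y \<partial>lborel) \<noteq> 0"
  proof
    assume "(\<integral>y. f y \<partial>lborel) = 0"
    then have "AE y in lborel. f y = 0"
      using f nonneg by (subst (asm) integral_nonneg_eq_0_iff_AE) auto
    then have "AE y in lborel. y \<notin> {0<..<u}"
    proof eventually_elim
      case (elim y)
      then show ?case using pos[of y] by fastforce
    qed
    then have "emeasure lborel {0<..<u} = 0"
      by (subst (asm) AE_iff_measurable[of "{0<..<u}"]) auto
    then show False using u by simp
  qed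
  ultimately show ?thesis by simp
qed

lemma set_integral_pos:
  fixes f :: "real \<Rightarrow> real"
  assumes "set_integrable lborel {0<..} f" "\<And>y. 0 < y \<Longrightarrow> 0 \<le> f y"
    and "\<And>y. 0 < y \<Longrightarrow> y < 1 \<Longrightarrow> 0 < f y"
  shows "0 < (LBINT y:{0<..}. f y)"
  using assms unfolding set_integrable_def set_lebesgue_integral_def
  by (intro integral_lborel_pos[where u = 1]) (auto simp: indicator_def)

lemma stable_const_pos:
  assumes "0 < r" "r < 2"
  shows "0 < stable_const r"
proof -
  have "0 < (LBINT y:{0<..}. (1 - cos y) * y powr (- r - 1))"
  proof (rule set_integral_pos[OF one_minus_cos_powr_integrable[OF assms]])
    fix y :: real assume y: "0 < y" "y < 1"
    have "cos y < cos 0" using y pi_gt3 by (intro cos_monotone_0_pi) auto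
    then show "0 < (1 - cos y) * y powr (- r - 1)" using y by simp
  qed auto
  then show ?thesis using assms by (simp add: stable_const_def)
qed

text \<open>Integration by parts: \<open>F\<close> is an antiderivative of \<open>y powr (- r) * sin y\<close> that tends to the
  absolutely convergent integral.\<close>

lemma C_stable_eq:
  assumes r: "0 < r" "r < 2"
  shows "C_stable r = inverse (stable_const r)"
proof -
  let ?f = "\<lambda>y::real. y powr (- r) * sin y"
  let ?k = "\<lambda>y::real. (1 - cos y) * y powr (- r - 1)"
  have ki: "set_integrable lborel {0<..} ?k" by (rule one_minus_cos_powr_integrable[OF r])
  have k0: "indicator {0..} y *\<^sub>R ?k y = indicator {0<..} y *\<^sub>R ?k y" for y by (auto simp: indicator_def)
  have ki': "set_integrable lborel {0..} ?k" and Ik: "(LBINT y:{0..}. ?k y) = (LBINT y:{0<..}. ?k y)"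
    using ki unfolding set_integrable_def set_lebesgue_integral_def k0 by auto
  have kint: "?k integrable_on {0..y}" and kI: "(LBINT t:{0..y}. ?k t) = integral {0..y} ?k" for y
    using set_borel_integral_eq_integral[OF set_integrable_subset[OF ki', of "{0..y}"]] by auto
  define u where "u y = integral {0..y} ?k" for y
  define F where "F y = y powr (- r) * (1 - cos y) + r * u y" for y
  have u_lim: "(u \<longlongrightarrow> (LBINT y:{0<..}. ?k y)) at_top"
    using tendsto_set_lebesgue_integral_at_top[OF _ ki'] by (simp add: kI u_def[abs_def] Ik)
  have F_lim: "(F \<longlongrightarrow> stable_const r) at_top"
  proof -
    have "((\<lambda>y. y powr (- r) * (1 - cos y)) \<longlongrightarrow> 0) at_top"
    proof (rule Lim_null_comparison)
      show "\<forall>\<^sub>F y in at_top. norm (y powr (- r) * (1 - cos y)) \<le> 2 * y powr (- r)"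
      proof (rule always_eventually, rule allI)
        fix y :: real
        have "y powr (- r) * (1 - cos y) \<le> y powr (- r) * 2"
          using cos_ge_minus_one[of y] by (intro mult_left_mono) auto
        then show "norm (y powr (- r) * (1 - cos y)) \<le> 2 * y powr (- r)" by (simp add: abs_mult)
      qed
      show "((\<lambda>y::real. 2 * y powr (- r)) \<longlongrightarrow> 0) at_top"
        using tendsto_mult[OF tendsto_const[of 2] tendsto_neg_powr[of "- r" "\<lambda>x. x" at_top]] r
        by (simp add: filterlim_ident)
    qed
    then have "(F \<longlongrightarrow> 0 + r * (LBINT y:{0<..}. ?k y)) at_top"
      unfolding F_def[abs_def] by (intro tendsto_intros u_lim)
    then show ?thesis by (simp add: stable_const_def)
  qed
  have F_deriv: "(F has_vector_derivative ?f y) (at y)" if y: "0 < y" for y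
  proof -
    have "continuous (at y within {0..y + 1}) ?k"
      using y by (intro continuous_intros) auto
    then have "(u has_vector_derivative ?k y) (at y within {0..y + 1})"
      unfolding u_def[abs_def]
      using integral_has_vector_derivative_continuous_at[OF kint, of y "y + 1" "{}"] y by simp
    then have "(u has_real_derivative ?k y) (at y)"
      using y at_within_interior[of y "{0..y + 1}"] by (simp add: has_real_derivative_iff_has_vector_derivative)
    then have "(F has_real_derivative (- r) * y powr (- r - 1) * (1 - cos y) + y powr (- r) * sin y + r * ?k y) (at y)"
      unfolding F_def[abs_def] using y by (auto intro!: derivative_eq_intros)
    then show ?thesis by (simp add: has_real_derivative_iff_has_vector_derivative algebra_simps)
  qed
  have F_cont: "continuous_on {0..b} F" for b
    unfolding continuous_on_eq_continuous_within
  proof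
    fix y assume y: "y \<in> {0..b}"
    show "continuous (at y within {0..b}) F"
    proof (cases "y = 0")
      case False
      with y have "0 < y" by simp
      from has_vector_derivative_continuous[OF F_deriv[OF this]] show ?thesis
        by (rule continuous_at_imp_continuous_at_within)
    next
      case True
      have "(u \<longlongrightarrow> u 0) (at 0 within {0..b})"
      proof -
        have "continuous_on {0..b} u"
          unfolding u_def[abs_def] by (rule indefinite_integral_continuous_1[OF kint])
        then show ?thesis using y True unfolding continuous_on_def by blast
      qed
      \<comment> \<open>The quadratic bound on \<open>1 - cos\<close> beats the singular power
        because \<open>r < 2\<close>.\<close>
      moreover have "((\<lambda>y. y powr (- r) * (1 - cos y)) \<longlongrightarrow> 0) (at 0 within {0..b})"
      proof (rule Lim_null_comparison)
        show "\<forall>\<^sub>F y in at 0 within {0..b}. norm (y powr (- r) * (1 - cos y)) \<le> y powr (2 - r)"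
        proof (rule eventually_mono[OF eventually_at_topological[THEN iffD2]])
          show "\<exists>S. open S \<and> 0 \<in> S \<and> (\<forall>x\<in>S. x \<noteq> 0 \<longrightarrow> x \<in> {0..b} \<longrightarrow> 0 < x)" by (intro exI[of _ UNIV]) auto
          fix y :: real assume y: "0 < y"
          have "y powr (- r) * (1 - cos y) \<le> y powr (- r) * y powr 2"
            using y one_minus_cos_le_square[of y] by (intro mult_left_mono) (auto simp: powr_numeral)
          then show "norm (y powr (- r) * (1 - cos y)) \<le> y powr (2 - r)"
            by (simp add: abs_mult powr_add[symmetric])
        qed
        have "((\<lambda>y::real. y powr (2 - r)) \<longlongrightarrow> 0 powr (2 - r)) (at 0 within {0..b})"
          using r by (intro tendsto_powr' tendsto_ident_at tendsto_const) (auto simp: eventually_at_filter)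
        then show "((\<lambda>y::real. y powr (2 - r)) \<longlongrightarrow> 0) (at 0 within {0..b})" by simp
      qed
      ultimately have "(F \<longlongrightarrow> 0 + r * u 0) (at 0 within {0..b})"
        unfolding F_def[abs_def] by (intro tendsto_intros)
      then show ?thesis using True by (simp add: continuous_within F_def)
    qed
  qed
  \<comment> \<open>The integral over an unbounded set is a limit over large boxes of the extension
    by zero, and on a box around 0 that integral is \<open>F\<close> at the right end.\<close>
  define g where "g y = (if y \<in> {0<..} then ?f y else 0)" for y
  have F0: "F 0 = 0" by (simp add: F_def u_def)
  have g0: "(g has_integral F b) {0..b}" if "0 \<le> b" for b
  proof -
    have "(g has_integral F b - F 0) {0..b}"
      using that F_cont F_deriv by (intro fundamental_theorem_of_calculus_interior) (auto simp: g_def)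
    then show ?thesis by (simp add: F0)
  qed
  have gm: "(g has_integral 0) {a..0}" for a
    by (rule has_integral_is_0) (auto simp: g_def)
  have gab: "(g has_integral F b) {a..b}" if "a \<le> 0" "0 \<le> b" for a b
    using has_integral_combine[OF that gm g0[OF that(2)]] by simp
  have "(?f has_integral stable_const r) {0<..}"
    unfolding has_integral_alt' g_def[symmetric, abs_def]
  proof safe
    fix a b :: real
    have "g integrable_on {min a 0..max b 0}" using gab[of "min a 0" "max b 0"] by (auto simp: integrable_on_def)
    from integrable_subinterval_real[OF this, of a b] show "g integrable_on cbox a b" by auto
  next
    fix e :: real assume "0 < e"
    with F_lim obtain N where N: "\<And>y. N \<le> y \<Longrightarrow> \<bar>F y - stable_const r\<bar> < e"
      by (auto simp: tendsto_iff dist_real_def eventually_at_top_linorder)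
    show "\<exists>B>0. \<forall>a b. ball 0 B \<subseteq> cbox a b \<longrightarrow> norm (integral (cbox a b) g - stable_const r) < e"
    proof (intro exI[of _ "\<bar>N\<bar> + 1"] conjI allI impI)
      fix a b :: real assume "ball 0 (\<bar>N\<bar> + 1) \<subseteq> cbox a b"
      moreover have "- \<bar>N\<bar> \<in> ball 0 (\<bar>N\<bar> + 1)" "\<bar>N\<bar> \<in> ball 0 (\<bar>N\<bar> + 1)" by (auto simp: dist_real_def)
      ultimately have "- \<bar>N\<bar> \<in> cbox a b" "\<bar>N\<bar> \<in> cbox a b" by blast+
      then have ab: "a \<le> 0" "0 \<le> b" "N \<le> b" by auto
      then have "integral (cbox a b) g = F b" using gab[of a b] by (simp add: integral_unique)
      then show "norm (integral (cbox a b) g - stable_const r) < e" using N ab by simp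
    qed simp
  qed
  then have "integral {0<..} ?f = stable_const r" by (rule integral_unique)
  then show ?thesis by (simp add: C_stable_def)
qed

text \<open>The substitution \<open>x = \<bar>k\<bar> powr r * y powr (- r)\<close> turns the
  argument of the cosine into \<open>y\<close> up to sign, and its Jacobian supplies the weight in
  \<open>stable_const\<close> together with the factor \<open>\<bar>k\<bar> powr r\<close>.\<close>

lemma nn_integral_one_minus_cos_powr:
  fixes k r :: real
  assumes r: "0 < r" "r < 2"
  shows "(\<integral>\<^sup>+x\<in>{0<..}. ennreal (1 - cos (x powr (- 1 / r) * k)) \<partial>lborel) = ennreal (stable_const r * \<bar>k\<bar> powr r)"
proof (cases "k = 0")
  case False
  let ?k = "\<lambda>y::real. (1 - cos y) * y powr (- r - 1)"
  let ?f = "\<lambda>x::real. 1 - cos (x powr (- 1 / r) * k)"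
  define g where "g y = \<bar>k\<bar> powr r * y powr (- r)" for y :: real
  define g' where "g' y = - (r * \<bar>k\<bar> powr r * y powr (- r - 1))" for y :: real
  have img: "g ` {0<..} = {0<..}"
  proof (intro equalityI subsetI)
    fix x :: real assume x: "x \<in> {0<..}"
    have "(\<bar>k\<bar> * x powr (- 1 / r)) powr (- r) = \<bar>k\<bar> powr (- r) * x"
      using x r False by (simp add: powr_mult powr_powr)
    moreover have "\<bar>k\<bar> powr r * \<bar>k\<bar> powr (- r) = 1" using False by (simp add: powr_add[symmetric])
    ultimately have *: "x = g (\<bar>k\<bar> * x powr (- 1 / r))" by (simp add: g_def mult.assoc[symmetric])
    have "\<bar>k\<bar> * x powr (- 1 / r) \<in> {0<..}" using x False by simp
    from imageI[OF this, of g] show "x \<in> g ` {0<..}" by (simp only: *[symmetric])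
  qed (use False in \<open>auto simp: g_def\<close>)
  have gf: "\<bar>g' y\<bar> * ?f (g y) = (r * \<bar>k\<bar> powr r) * ?k y" if "0 < y" for y
  proof -
    have "g y powr (- 1 / r) = \<bar>k\<bar> powr (- 1) * y"
      using that r False by (simp add: g_def powr_mult powr_powr)
    then have "g y powr (- 1 / r) = y / \<bar>k\<bar>"
      using False by (simp add: powr_minus_divide)
    then have "\<bar>g y powr (- 1 / r) * k\<bar> = \<bar>y\<bar>" using that False by (simp add: abs_mult)
    then have "cos (g y powr (- 1 / r) * k) = cos y" by (metis cos_abs_real)
    then show ?thesis using r by (simp add: g'_def abs_mult)
  qed
  have ki: "set_integrable lborel {0<..} ?k" by (rule one_minus_cos_powr_integrable[OF r])
  have "(\<lambda>y. (r * \<bar>k\<bar> powr r) * ?k y) absolutely_integrable_on {0<..} \<and>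
      integral {0<..} (\<lambda>y. (r * \<bar>k\<bar> powr r) * ?k y) = stable_const r * \<bar>k\<bar> powr r"
    using set_borel_integral_eq_integral[OF ki] set_integrable_mult_right[OF ki, of "r * \<bar>k\<bar> powr r"]
    by (auto simp: stable_const_def set_integrable_def intro!: integrable_completion[THEN iffD2])
  note prem = this
  have "(\<lambda>y. \<bar>g' y\<bar> * ?f (g y)) absolutely_integrable_on {0<..} \<and>
      integral {0<..} (\<lambda>y. \<bar>g' y\<bar> * ?f (g y)) = stable_const r * \<bar>k\<bar> powr r"
  proof -
    have "set_integrable lebesgue {0<..} (\<lambda>y. \<bar>g' y\<bar> * ?f (g y)) = set_integrable lebesgue {0<..} (\<lambda>y. (r * \<bar>k\<bar> powr r) * ?k y)"
      by (rule set_integrable_cong) (use gf in auto)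
    moreover have "integral {0<..} (\<lambda>y. \<bar>g' y\<bar> * ?f (g y)) = integral {0<..} (\<lambda>y. (r * \<bar>k\<bar> powr r) * ?k y)"
      by (rule Henstock_Kurzweil_Integration.integral_cong) (use gf in auto)
    ultimately show ?thesis using prem by simp
  qed
  moreover have "(g has_field_derivative g' y) (at y within {0<..})" if "y \<in> {0<..}" for y
    unfolding g_def[abs_def] g'_def using that by (auto intro!: derivative_eq_intros)
  moreover have "inj_on g {0<..}"
  proof (rule inj_onI)
    fix x y :: real assume "x \<in> {0<..}" "y \<in> {0<..}" "g x = g y"
    then have "0 < x" "0 < y" "x powr (- r) = y powr (- r)" using False by (auto simp: g_def)
    then have "(x powr (- r)) powr (- 1 / r) = (y powr (- r)) powr (- 1 / r)" by simp
    then show "x = y" using r \<open>0 < x\<close> \<open>0 < y\<close> by (simp add: powr_powr)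
  qed
  moreover have "{0<..} \<in> sets (lebesgue :: real measure)" by simp
  ultimately have "?f absolutely_integrable_on g ` {0<..} \<and> integral (g ` {0<..}) ?f = stable_const r * \<bar>k\<bar> powr r"
    using has_absolute_integral_change_of_variables_1'[of "{0<..}" g g' ?f "stable_const r * \<bar>k\<bar> powr r"]
    by blast
  then have "(?f has_integral stable_const r * \<bar>k\<bar> powr r) {0<..}"
    unfolding img by (metis integrable_integral set_lebesgue_integral_eq_integral(1))
  then show ?thesis
    by (intro nn_integral_has_integral_lebesgue') auto
qed simp

text \<open>A difference of powers with exponents near \<open>r\<close> is dominated by the two
  integrands belonging to \<open>r + d\<close> and \<open>r - d\<close>, both still
  integrable.\<close>

lemma stable_const_lipschitz:
  assumes r: "0 < r" "r < 2"
  obtains \<delta> L where "0 < \<delta>" "0 \<le> L"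
    "\<And>s. \<bar>s - r\<bar> \<le> \<delta> \<Longrightarrow> \<bar>stable_const s - stable_const r\<bar> \<le> L * \<bar>s - r\<bar>"
proof -
  \<comment> \<open>Half the distance from \<open>r\<close> to the ends of the interval (0, 2), so
    that \<open>r - d\<close> and \<open>r + d\<close> stay inside.\<close>
  define d where "d = min r (2 - r) / 2"
  have d: "0 < d" "0 < r - d" "r + d < 2" using r by (auto simp: d_def min_def field_simps)
  let ?k = "\<lambda>s y::real. (1 - cos y) * y powr (- s - 1)"
  define I where "I s = (LBINT y:{0<..}. ?k s y)" for s
  define D where "D = 2 / d * (I (r + d) + I (r - d))"
  have I_nonneg: "0 \<le> I s" for s
    unfolding I_def set_lebesgue_integral_def by (intro integral_nonneg_AE) (auto simp: indicator_def)
  have D: "0 \<le> D" unfolding D_def using d I_nonneg by (intro mult_nonneg_nonneg add_nonneg_nonneg) auto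
  have diff: "\<bar>I s - I r\<bar> \<le> D * \<bar>s - r\<bar>" if s: "\<bar>s - r\<bar> \<le> d / 2" for s
  proof -
    have s': "0 < s" "s < 2" using s d by linarith+
    have i: "set_integrable lborel {0<..} (?k s)" "set_integrable lborel {0<..} (?k r)"
      "set_integrable lborel {0<..} (?k (r + d))" "set_integrable lborel {0<..} (?k (r - d))"
      by (rule one_minus_cos_powr_integrable; use r d s' in linarith)+
    have "\<bar>I s - I r\<bar> = \<bar>LBINT y:{0<..}. ?k s y - ?k r y\<bar>"
      unfolding I_def by (subst set_integral_diff(2)[OF i(1,2)]) simp
    also have "\<dots> \<le> (LBINT y:{0<..}. \<bar>?k s y - ?k r y\<bar>)"
      using set_integral_norm_bound[OF set_integral_diff(1)[OF i(1,2)]] by simp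
    also have "\<dots> \<le> (LBINT y:{0<..}. \<bar>s - r\<bar> * (2 / d) * (?k (r + d) y + ?k (r - d) y))"
    proof (rule set_integral_mono)
      show "set_integrable lborel {0<..} (\<lambda>y. \<bar>?k s y - ?k r y\<bar>)"
        by (intro set_integrable_abs set_integral_diff i)
      show "set_integrable lborel {0<..} (\<lambda>y. \<bar>s - r\<bar> * (2 / d) * (?k (r + d) y + ?k (r - d) y))"
        by (intro set_integrable_mult_right set_integral_add i)
      fix y :: real assume "y \<in> {0<..}"
      then have y: "0 < y" by simp
      have "\<bar>y powr (- s - 1) - y powr (- r - 1)\<bar>
          \<le> \<bar>(- s - 1) - (- r - 1)\<bar> * (2 / d * (y powr ((- r - 1) - d) + y powr ((- r - 1) + d)))"
        using s d by (intro abs_powr_diff_exponents_le y) (auto simp: abs_minus_commute)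
      also have "\<dots> = \<bar>s - r\<bar> * (2 / d) * (y powr (- (r + d) - 1) + y powr (- (r - d) - 1))"
      proof -
        have "(- r - 1) - d = - (r + d) - 1" "(- r - 1) + d = - (r - d) - 1" "\<bar>(- s - 1) - (- r - 1)\<bar> = \<bar>s - r\<bar>"
          by simp_all
        then show ?thesis by (simp only: mult.assoc)
      qed
      finally have "(1 - cos y) * \<bar>y powr (- s - 1) - y powr (- r - 1)\<bar>
          \<le> (1 - cos y) * (\<bar>s - r\<bar> * (2 / d) * (y powr (- (r + d) - 1) + y powr (- (r - d) - 1)))"
        by (intro mult_left_mono) auto
      moreover have "\<bar>?k s y - ?k r y\<bar> = (1 - cos y) * \<bar>y powr (- s - 1) - y powr (- r - 1)\<bar>"
        by (simp add: right_diff_distrib[symmetric] abs_mult)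
      ultimately show "\<bar>?k s y - ?k r y\<bar> \<le> \<bar>s - r\<bar> * (2 / d) * (?k (r + d) y + ?k (r - d) y)"
        by (simp add: distrib_left mult_ac)
    qed
    also have "\<dots> = D * \<bar>s - r\<bar>"
      using i by (simp add: D_def I_def set_integral_add(2))
    finally show ?thesis .
  qed
  show thesis
  proof (rule that)
    show "0 < d / 2" using d by simp
    show "0 \<le> I r + D * d + r * D" using I_nonneg[of r] D d r by (intro add_nonneg_nonneg mult_nonneg_nonneg) auto
    fix s assume s: "\<bar>s - r\<bar> \<le> d / 2"
    have "I s \<le> I r + D * \<bar>s - r\<bar>" using diff[OF s] by linarith
    also have "\<dots> \<le> I r + D * d" using s d D by (intro add_left_mono mult_left_mono) auto
    finally have Is: "\<bar>I s\<bar> \<le> I r + D * d" using I_nonneg[of s] by simp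
    have "stable_const s - stable_const r = (s - r) * I s + r * (I s - I r)"
      by (simp add: stable_const_def I_def algebra_simps)
    also have "\<bar>\<dots>\<bar> \<le> \<bar>s - r\<bar> * \<bar>I s\<bar> + r * \<bar>I s - I r\<bar>"
      using r abs_triangle_ineq[of "(s - r) * I s" "r * (I s - I r)"] by (simp add: abs_mult)
    also have "\<dots> \<le> \<bar>s - r\<bar> * (I r + D * d) + r * (D * \<bar>s - r\<bar>)"
      using Is diff[OF s] r by (intro add_mono mult_left_mono) auto
    finally show "\<bar>stable_const s - stable_const r\<bar> \<le> (I r + D * d + r * D) * \<bar>s - r\<bar>"
      by (simp add: algebra_simps)
  qed
qed

section \<open>Absolute moments from characteristic functions\<close>

lemma nn_integral_exp_Icc:
  fixes y :: real
  assumes "0 \<le> y"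
  shows "(\<integral>\<^sup>+w\<in>{0..y}. ennreal (exp (- w)) \<partial>lborel) = ennreal (1 - exp (- y))"
proof (rule nn_integral_has_integral_lebesgue')
  have "((\<lambda>w. exp (- w)) has_integral (- exp (- y)) - (- exp (- 0))) {0..y}"
    using assms
    by (intro fundamental_theorem_of_calculus)
       (auto intro!: derivative_eq_intros simp: has_real_derivative_iff_has_vector_derivative[symmetric])
  then show "((\<lambda>w. exp (- w)) has_integral 1 - exp (- y)) {0..y}" by simp
qed simp

text \<open>Layer cake: write \<open>1 - exp (- d * u powr r)\<close> as the exponential measure of \<open>[0, d * u powr r]\<close> and integrate over
  \<open>u\<close> first.\<close>

lemma nn_integral_powr_one_minus_exp:
  fixes d r \<eta> :: real
  assumes d: "0 \<le> d" and e: "0 < \<eta>" "\<eta> < r"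
  shows "(\<integral>\<^sup>+u\<in>{0<..}. ennreal (u powr (- \<eta> - 1) * (1 - exp (- (d * u powr r)))) \<partial>lborel)
    = ennreal (d powr (\<eta> / r) * Gamma (1 - \<eta> / r) / \<eta>)"
proof (cases "d = 0")
  case False
  with d have d: "0 < d" by simp
  have r: "0 < r" using e by simp
  let ?F = "\<lambda>(u, w). ennreal (u powr (- \<eta> - 1) * exp (- w)) * (if 0 < u \<and> 0 < w \<and> w \<le> d * u powr r then 1 else 0)"
  have Fm: "?F \<in> borel_measurable (lborel \<Otimes>\<^sub>M lborel)" by measurable
  have "(\<integral>\<^sup>+u\<in>{0<..}. ennreal (u powr (- \<eta> - 1) * (1 - exp (- (d * u powr r)))) \<partial>lborel)
      = (\<integral>\<^sup>+u. \<integral>\<^sup>+w. ?F (u, w) \<partial>lborel \<partial>lborel)"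
  proof (rule nn_integral_cong)
    fix u :: real
    show "ennreal (u powr (- \<eta> - 1) * (1 - exp (- (d * u powr r)))) * indicator {0<..} u = (\<integral>\<^sup>+w. ?F (u, w) \<partial>lborel)"
    proof (cases "0 < u")
      case True
      have "(\<integral>\<^sup>+w. ?F (u, w) \<partial>lborel)
          = (\<integral>\<^sup>+w. ennreal (u powr (- \<eta> - 1)) * (ennreal (exp (- w)) * indicator {0..d * u powr r} w) \<partial>lborel)"
      proof (rule nn_integral_cong_AE)
        have "AE w in lborel. w \<noteq> (0::real)" by (rule AE_lborel_singleton)
        then show "AE w in lborel. ?F (u, w)
            = ennreal (u powr (- \<eta> - 1)) * (ennreal (exp (- w)) * indicator {0..d * u powr r} w)"
        proof eventually_elim
          case (elim w)
          then show ?case using True by (auto simp: indicator_def ennreal_mult)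
        qed
      qed
      also have "\<dots> = ennreal (u powr (- \<eta> - 1)) * ennreal (1 - exp (- (d * u powr r)))"
        using d by (subst nn_integral_cmult) (auto simp: nn_integral_exp_Icc)
      finally show ?thesis using True d by (simp add: ennreal_mult)
    qed simp
  qed
  also have "\<dots> = (\<integral>\<^sup>+w. \<integral>\<^sup>+u. ?F (u, w) \<partial>lborel \<partial>lborel)"
    using lborel_pair.Fubini'[OF Fm] by simp
  also have "\<dots> = (\<integral>\<^sup>+w. ennreal (d powr (\<eta> / r) / \<eta>) * (ennreal (w powr (1 - \<eta> / r - 1) / exp w) * indicator {0..} w) \<partial>lborel)"
  proof (rule nn_integral_cong_AE)
    have "AE w in lborel. w \<noteq> (0::real)" by (rule AE_lborel_singleton)
    then show "AE w in lborel. (\<integral>\<^sup>+u. ?F (u, w) \<partial>lborel)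
        = ennreal (d powr (\<eta> / r) / \<eta>) * (ennreal (w powr (1 - \<eta> / r - 1) / exp w) * indicator {0..} w)"
    proof eventually_elim
      case (elim w)
      show ?case
      proof (cases "0 < w")
        case True
        \<comment> \<open>For fixed \<open>w\<close> the inner domain is a half line, starting where
          \<open>d * u powr r\<close> reaches \<open>w\<close>.\<close>
        define u0 where "u0 = (w / d) powr (1 / r)"
        have u0: "0 < u0" using True d by (simp add: u0_def)
        have iff: "0 < u \<and> w \<le> d * u powr r \<longleftrightarrow> u0 \<le> u" for u
        proof (cases "0 < u")
          case u: True
          have "u0 powr r = w / d" using True d r by (simp add: u0_def powr_powr)
          moreover have "u0 powr r \<le> u powr r \<longleftrightarrow> u0 \<le> u"
            using u u0 r by (meson less_imp_le not_le powr_less_mono2 powr_mono2)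
          moreover have "w \<le> d * u powr r \<longleftrightarrow> w / d \<le> u powr r" using d by (simp add: field_simps)
          ultimately show ?thesis using u by simp
        qed (use u0 in auto)
        have "(\<integral>\<^sup>+u. ?F (u, w) \<partial>lborel)
            = (\<integral>\<^sup>+u. ennreal (exp (- w)) * (ennreal (u powr (- \<eta> - 1)) * indicator {u0..} u) \<partial>lborel)"
          using iff True by (intro nn_integral_cong) (auto simp: indicator_def ennreal_mult mult.commute)
        also have "\<dots> = ennreal (exp (- w)) * (\<integral>\<^sup>+u\<in>{u0..}. ennreal (u powr (- \<eta> - 1)) \<partial>lborel)"
          by (rule nn_integral_cmult) measurable
        also have "(\<integral>\<^sup>+u\<in>{u0..}. ennreal (u powr (- \<eta> - 1)) \<partial>lborel) = ennreal (u0 powr (- \<eta>) / \<eta>)"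
        proof (rule nn_integral_has_integral_lebesgue')
          have "- (u0 powr ((- \<eta> - 1) + 1)) / ((- \<eta> - 1) + 1) = u0 powr (- \<eta>) / \<eta>"
            using e by (simp add: field_simps)
          then show "((\<lambda>u. u powr (- \<eta> - 1)) has_integral u0 powr (- \<eta>) / \<eta>) {u0..}"
            using has_integral_powr_to_inf[of "- \<eta> - 1" u0] u0 e by simp
        qed simp
        also have "u0 powr (- \<eta>) = w powr (- (\<eta> / r)) * d powr (\<eta> / r)"
          using True d by (simp add: u0_def powr_powr powr_divide powr_minus field_simps)
        finally have "(\<integral>\<^sup>+u. ?F (u, w) \<partial>lborel)
            = ennreal (exp (- w)) * ennreal (w powr (- (\<eta> / r)) * d powr (\<eta> / r) / \<eta>)" .
        \<comment> \<open>What the inner integral leaves is the integrand of the Gamma function at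
          \<open>1 - \<eta> / r\<close>, positive because \<open>\<eta> < r\<close>.\<close>
        also have "\<dots> = ennreal (d powr (\<eta> / r) / \<eta>) * ennreal (w powr (1 - \<eta> / r - 1) / exp w)"
          using e by (simp add: ennreal_mult[symmetric] exp_minus field_simps)
        finally show ?thesis using True by simp
      next
        case False
        with elim show ?thesis by simp
      qed
    qed
  qed
  also have "\<dots> = ennreal (d powr (\<eta> / r) / \<eta>) * ennreal (Gamma (1 - \<eta> / r))"
  proof -
    have "(\<integral>\<^sup>+w\<in>{0..}. ennreal (w powr (1 - \<eta> / r - 1) / exp w) \<partial>lborel) = ennreal (Gamma (1 - \<eta> / r))"
      using e by (intro nn_integral_has_integral_lebesgue' Gamma_integral_real) auto
    then show ?thesis by (subst nn_integral_cmult) auto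
  qed
  also have "\<dots> = ennreal (d powr (\<eta> / r) * Gamma (1 - \<eta> / r) / \<eta>)"
    using e by (simp add: ennreal_mult[symmetric])
  finally show ?thesis .
qed simp

definition sine_const :: "real \<Rightarrow> real" where
  "sine_const \<eta> = (LBINT u:{0<..}. u powr (- \<eta> - 1) * (sin u)\<^sup>2)"

lemma sine_const_integrable:
  fixes \<eta> :: real
  assumes "0 < \<eta>" "\<eta> < 2"
  shows "set_integrable lborel {0<..} (\<lambda>u. u powr (- \<eta> - 1) * (sin u)\<^sup>2)"
proof (rule set_integrable_nonnegI)
  have "(\<integral>\<^sup>+u\<in>{0<..}. ennreal (u powr (- \<eta> - 1) * (sin u)\<^sup>2) \<partial>lborel)
      \<le> ennreal (1 / (1 - (\<eta> - 1)) + 1 / (\<eta> + 1 - 1))"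
  proof (rule nn_integral_powr_unit_split)
    fix u :: real assume u: "0 < u" "u \<le> 1"
    have "u powr (- \<eta> - 1) * (sin u)\<^sup>2 \<le> u powr (- \<eta> - 1) * u powr 2"
      using u abs_sin_x_le_abs_x[of u] by (intro mult_left_mono) (auto simp: powr_numeral abs_le_square_iff[symmetric])
    also have "\<dots> = u powr ((- \<eta> - 1) + 2)" by (subst powr_add) simp
    finally show "u powr (- \<eta> - 1) * (sin u)\<^sup>2 \<le> 1 * u powr - (\<eta> - 1)" by (simp add: algebra_simps)
  next
    fix u :: real assume u: "1 \<le> u"
    have "(sin u)\<^sup>2 \<le> 1" by (simp add: abs_square_le_1)
    then have "u powr (- \<eta> - 1) * (sin u)\<^sup>2 \<le> u powr (- \<eta> - 1) * 1" by (intro mult_left_mono) auto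
    then show "u powr (- \<eta> - 1) * (sin u)\<^sup>2 \<le> 1 * u powr - (\<eta> + 1)" by simp
  qed (use assms in auto)
  then show "(\<integral>\<^sup>+u\<in>{0<..}. ennreal (u powr (- \<eta> - 1) * (sin u)\<^sup>2) \<partial>lborel) < \<infinity>"
    by (rule le_less_trans) simp
qed auto

lemma sine_const_pos:
  assumes "0 < \<eta>" "\<eta> < 2"
  shows "0 < sine_const \<eta>"
  unfolding sine_const_def
proof (rule set_integral_pos[OF sine_const_integrable[OF assms]])
  fix y :: real assume y: "0 < y" "y < 1"
  then have "0 < sin y" using pi_gt3 by (intro sin_gt_zero) auto
  then show "0 < y powr (- \<eta> - 1) * (sin y)\<^sup>2" using y by simp
qed auto

text \<open>Rescaling \<open>u\<close> by \<open>\<bar>x\<bar>\<close>. This represents the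
  unbounded function \<open>\<bar>x\<bar> powr \<eta>\<close> by bounded ones whose expectations are
  read off the characteristic function.\<close>

lemma nn_integral_sine_scaled:
  fixes \<eta> x :: real
  assumes e: "0 < \<eta>" "\<eta> < 2"
  shows "(\<integral>\<^sup>+u\<in>{0<..}. ennreal (u powr (- \<eta> - 1) * (sin (u * x))\<^sup>2) \<partial>lborel) = ennreal (sine_const \<eta> * \<bar>x\<bar> powr \<eta>)"
proof (cases "x = 0")
  case False
  let ?f = "\<lambda>u::real. u powr (- \<eta> - 1) * (sin u)\<^sup>2"
  have sq: "(sin (\<bar>x\<bar> * u))\<^sup>2 = (sin (u * x))\<^sup>2" for u by (cases "0 \<le> x") (auto simp: mult.commute)
  have "ennreal (sine_const \<eta>) = (\<integral>\<^sup>+u. ennreal (?f u) * indicator {0<..} u \<partial>lborel)"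
    unfolding sine_const_def by (intro nn_integral_eq_set_integral[symmetric] sine_const_integrable e) auto
  also have "\<dots> = ennreal \<bar>\<bar>x\<bar>\<bar> * (\<integral>\<^sup>+u. ennreal (?f (0 + \<bar>x\<bar> * u)) * indicator {0<..} (0 + \<bar>x\<bar> * u) \<partial>lborel)"
    using False by (intro nn_integral_real_affine) auto
  also have "\<dots> = ennreal \<bar>\<bar>x\<bar>\<bar> * (\<integral>\<^sup>+u. ennreal (\<bar>x\<bar> powr (- \<eta> - 1)) * (ennreal (u powr (- \<eta> - 1) * (sin (u * x))\<^sup>2) * indicator {0<..} u) \<partial>lborel)"
    using False by (intro arg_cong[where f = "\<lambda>z. _ * z"] nn_integral_cong)
      (auto simp: indicator_def powr_mult sq ennreal_mult[symmetric] zero_less_mult_iff mult.assoc)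
  also have "\<dots> = ennreal (\<bar>x\<bar> powr (- \<eta>)) * (\<integral>\<^sup>+u\<in>{0<..}. ennreal (u powr (- \<eta> - 1) * (sin (u * x))\<^sup>2) \<partial>lborel)"
  proof -
    have "\<bar>x\<bar> * \<bar>x\<bar> powr (- \<eta> - 1) = \<bar>x\<bar> powr (- \<eta>)"
      using powr_add[of "\<bar>x\<bar>" 1 "- \<eta> - 1"] by simp
    then have "ennreal \<bar>\<bar>x\<bar>\<bar> * ennreal (\<bar>x\<bar> powr (- \<eta> - 1)) = ennreal (\<bar>x\<bar> powr (- \<eta>))"
      using False by (simp add: ennreal_mult[symmetric])
    then show ?thesis by (subst nn_integral_cmult) (auto simp: mult.assoc[symmetric])
  qed
  finally have "ennreal (\<bar>x\<bar> powr \<eta>) * ennreal (sine_const \<eta>) = (ennreal (\<bar>x\<bar> powr \<eta>) * ennreal (\<bar>x\<bar> powr (- \<eta>)))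
      * (\<integral>\<^sup>+u\<in>{0<..}. ennreal (u powr (- \<eta> - 1) * (sin (u * x))\<^sup>2) \<partial>lborel)"
    by (simp add: mult.assoc)
  moreover have "ennreal (\<bar>x\<bar> powr \<eta>) * ennreal (\<bar>x\<bar> powr (- \<eta>)) = 1"
    using False by (simp add: ennreal_mult[symmetric] powr_add[symmetric])
  ultimately show ?thesis using sine_const_pos[OF e] by (simp add: ennreal_mult[symmetric] mult.commute)
qed simp

text \<open>In the representation by squared sines the double-angle formula produces
  \<open>(1 - cos (2 * u * S)) / 2\<close>. The doubled argument contributes
  \<open>2 powr \<eta>\<close>, which the half turns into
  \<open>2 powr (\<eta> - 1)\<close>.\<close>

lemma (in prob_space) abs_moment_of_stable:
  assumes S[measurable]: "S \<in> borel_measurable M" and e: "0 < \<eta>" "\<eta> < r" "r < 2" and c: "0 \<le> c"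
    and char: "\<And>\<theta>. 0 < \<theta> \<Longrightarrow> expectation (\<lambda>\<omega>. cos (\<theta> * S \<omega>)) = exp (- (c * \<theta> powr r))"
  shows "(\<integral>\<^sup>+\<omega>. ennreal (\<bar>S \<omega>\<bar> powr \<eta>) \<partial>M)
    = ennreal (2 powr (\<eta> - 1) * Gamma (1 - \<eta> / r) / (\<eta> * sine_const \<eta>) * c powr (\<eta> / r))"
proof -
  have e2: "\<eta> < 2" using e by simp
  let ?J = "sine_const \<eta>"
  have J: "0 < ?J" by (rule sine_const_pos[OF e(1) e2])
  interpret MR: pair_sigma_finite M "lborel :: real measure" ..
  let ?F = "\<lambda>(\<omega>, u). ennreal (u powr (- \<eta> - 1) * (sin (u * S \<omega>))\<^sup>2) * indicator {0<..} u"
  have Fm: "?F \<in> borel_measurable (M \<Otimes>\<^sub>M lborel)" by measurable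
  have "ennreal ?J * (\<integral>\<^sup>+\<omega>. ennreal (\<bar>S \<omega>\<bar> powr \<eta>) \<partial>M) = (\<integral>\<^sup>+\<omega>. ennreal (?J * \<bar>S \<omega>\<bar> powr \<eta>) \<partial>M)"
    using J by (subst nn_integral_cmult[symmetric]) (auto simp: ennreal_mult)
  also have "\<dots> = (\<integral>\<^sup>+\<omega>. \<integral>\<^sup>+u. ?F (\<omega>, u) \<partial>lborel \<partial>M)"
    using nn_integral_sine_scaled[OF e(1) e2] by simp
  also have "\<dots> = (\<integral>\<^sup>+u. \<integral>\<^sup>+\<omega>. ?F (\<omega>, u) \<partial>M \<partial>lborel)"
    using MR.Fubini'[OF Fm] by simp
  also have "\<dots> = (\<integral>\<^sup>+u. ennreal (1 / 2) * (ennreal (u powr (- \<eta> - 1) * (1 - exp (- ((c * 2 powr r) * u powr r)))) * indicator {0<..} u) \<partial>lborel)"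
  proof (rule nn_integral_cong)
    fix u :: real
    show "(\<integral>\<^sup>+\<omega>. ?F (\<omega>, u) \<partial>M) = ennreal (1 / 2) * (ennreal (u powr (- \<eta> - 1) * (1 - exp (- ((c * 2 powr r) * u powr r)))) * indicator {0<..} u)"
    proof (cases "0 < u")
      case True
      have ci: "integrable M (\<lambda>\<omega>. cos (2 * u * S \<omega>))" by (rule integrable_const_bound[where B = 1]) auto
      have sin_sq: "(sin (u * S \<omega>))\<^sup>2 = (1 - cos (2 * u * S \<omega>)) / 2" for \<omega>
        using cos_double_sin[of "u * S \<omega>"] by (simp add: mult.assoc)
      have "(\<integral>\<^sup>+\<omega>. ?F (\<omega>, u) \<partial>M) = (\<integral>\<^sup>+\<omega>. ennreal (u powr (- \<eta> - 1) * ((1 - cos (2 * u * S \<omega>)) / 2)) \<partial>M)"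
        using True by (simp add: sin_sq)
      also have "\<dots> = ennreal (expectation (\<lambda>\<omega>. u powr (- \<eta> - 1) * ((1 - cos (2 * u * S \<omega>)) / 2)))"
        using ci by (intro nn_integral_eq_integral) auto
      also have "expectation (\<lambda>\<omega>. u powr (- \<eta> - 1) * ((1 - cos (2 * u * S \<omega>)) / 2))
          = u powr (- \<eta> - 1) * ((1 - exp (- (c * (2 * u) powr r))) / 2)"
        using ci char[of "2 * u"] True by (simp add: prob_space)
      also have "\<dots> = 1 / 2 * (u powr (- \<eta> - 1) * (1 - exp (- ((c * 2 powr r) * u powr r))))"
        using True by (simp add: powr_mult mult_ac)
      also have "ennreal \<dots> = ennreal (1 / 2) * ennreal (u powr (- \<eta> - 1) * (1 - exp (- ((c * 2 powr r) * u powr r))))"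
        using c by (intro ennreal_mult) auto
      finally show ?thesis using True by simp
    qed simp
  qed
  also have "\<dots> = ennreal (1 / 2) * ennreal ((c * 2 powr r) powr (\<eta> / r) * Gamma (1 - \<eta> / r) / \<eta>)"
    using nn_integral_powr_one_minus_exp[of "c * 2 powr r" \<eta> r] c e by (subst nn_integral_cmult) auto
  also have "\<dots> = ennreal (2 powr (\<eta> - 1) * Gamma (1 - \<eta> / r) / \<eta> * c powr (\<eta> / r))"
  proof -
    have "(c * 2 powr r) powr (\<eta> / r) = c powr (\<eta> / r) * 2 powr \<eta>"
      using c e by (simp add: powr_mult powr_powr)
    moreover have "2 powr (\<eta> - 1) = 2 powr \<eta> / (2::real)" by (simp add: powr_diff)
    moreover have "0 < Gamma (1 - \<eta> / r)" using e by (intro Gamma_real_pos) auto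
    moreover have "ennreal (1 / 2) * ennreal ((c * 2 powr r) powr (\<eta> / r) * Gamma (1 - \<eta> / r) / \<eta>)
        = ennreal (1 / 2 * ((c * 2 powr r) powr (\<eta> / r) * Gamma (1 - \<eta> / r) / \<eta>))"
      using e \<open>0 < Gamma (1 - \<eta> / r)\<close> by (intro ennreal_mult[symmetric]) auto
    moreover have "1 / 2 * ((c powr (\<eta> / r) * 2 powr \<eta>) * Gamma (1 - \<eta> / r) / \<eta>)
        = 2 powr \<eta> / 2 * Gamma (1 - \<eta> / r) / \<eta> * c powr (\<eta> / r)" by simp
    ultimately show ?thesis by (simp only:)
  qed
  finally have *: "ennreal ?J * (\<integral>\<^sup>+\<omega>. ennreal (\<bar>S \<omega>\<bar> powr \<eta>) \<partial>M)
      = ennreal (2 powr (\<eta> - 1) * Gamma (1 - \<eta> / r) / \<eta> * c powr (\<eta> / r))" .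
  have "(\<integral>\<^sup>+\<omega>. ennreal (\<bar>S \<omega>\<bar> powr \<eta>) \<partial>M)
      = ennreal (1 / ?J) * (ennreal ?J * (\<integral>\<^sup>+\<omega>. ennreal (\<bar>S \<omega>\<bar> powr \<eta>) \<partial>M))"
    using J by (simp add: mult.assoc[symmetric] ennreal_mult[symmetric])
  also have "\<dots> = ennreal (2 powr (\<eta> - 1) * Gamma (1 - \<eta> / r) / (\<eta> * ?J) * c powr (\<eta> / r))"
    unfolding * using J by (simp add: ennreal_mult'[symmetric] field_simps)
  finally show ?thesis .
qed

text \<open>Integrating \<open>1 - cos\<close> over the arrival time first leaves an
  \<open>r\<close>-th power for each mark, so the exponent of the characteristic function is
  homogeneous of degree \<open>r\<close> in \<open>\<theta>\<close>.\<close>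

theorem (in lepage) stable_series_abs_moment:
  assumes k[measurable]: "k \<in> borel_measurable borel" and e: "0 < \<eta>" "\<eta> < r" "r < 2"
    and m: "0 \<le> m" "(\<integral>\<^sup>+v. ennreal (\<bar>k v\<bar> powr r) \<partial>\<nu>) = ennreal m"
    and conv: "series_converges (\<lambda>(x, v). x powr (- 1 / r) * k v)"
  shows "(\<integral>\<^sup>+\<omega>. ennreal (\<bar>series (\<lambda>(x, v). x powr (- 1 / r) * k v) \<omega>\<bar> powr \<eta>) \<partial>M)
    = ennreal (2 powr (\<eta> - 1) * Gamma (1 - \<eta> / r) / (\<eta> * sine_const \<eta>) * (stable_const r * m) powr (\<eta> / r))"
proof -
  let ?a = "\<lambda>z. case z of (x, v) \<Rightarrow> x powr (- 1 / r) * k v"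
  interpret \<nu>: prob_space \<nu> by (rule prob_space_\<nu>)
  interpret R\<nu>: pair_sigma_finite "lborel :: real measure" \<nu> ..
  have r: "0 < r" "r < 2" using e by auto
  have am[measurable]: "?a \<in> borel_measurable (borel \<Otimes>\<^sub>M borel)" by measurable
  have K: "0 < stable_const r" by (rule stable_const_pos[OF r])
  have char: "expectation (\<lambda>\<omega>. cos (\<theta> * series ?a \<omega>)) = exp (- (stable_const r * m * \<theta> powr r))" if t: "0 < \<theta>" for \<theta>
  proof -
    let ?F = "\<lambda>(x, v). ennreal (1 - cos (x powr (- 1 / r) * (\<theta> * k v))) * indicator {0<..} x"
    have Fm: "?F \<in> borel_measurable (lborel \<Otimes>\<^sub>M \<nu>)" by measurable
    have "(\<integral>\<^sup>+x\<in>{0..}. (\<integral>\<^sup>+v. ennreal (1 - cos (\<theta> * ?a (x, v))) \<partial>\<nu>) \<partial>lborel) = (\<integral>\<^sup>+x. \<integral>\<^sup>+v. ?F (x, v) \<partial>\<nu> \<partial>lborel)"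
    proof (intro nn_integral_cong)
      fix x :: real
      \<comment> \<open>At \<open>x = 0\<close> the convention \<open>0 powr a = 0\<close> makes the
        integrand vanish, so the closed and the open half line agree pointwise.\<close>
      consider "x < 0" | "x = 0" | "0 < x" by linarith
      then show "(\<integral>\<^sup>+v. ennreal (1 - cos (\<theta> * ?a (x, v))) \<partial>\<nu>) * indicator {0..} x = (\<integral>\<^sup>+v. ?F (x, v) \<partial>\<nu>)"
        by cases (auto simp: mult_ac)
    qed
    also have "\<dots> = (\<integral>\<^sup>+v. \<integral>\<^sup>+x. ?F (x, v) \<partial>lborel \<partial>\<nu>)" using R\<nu>.Fubini'[OF Fm] by simp
    also have "\<dots> = (\<integral>\<^sup>+v. ennreal (stable_const r * \<theta> powr r) * ennreal (\<bar>k v\<bar> powr r) \<partial>\<nu>)"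
    proof (rule nn_integral_cong)
      fix v
      have "(\<integral>\<^sup>+x. ?F (x, v) \<partial>lborel) = ennreal (stable_const r * \<bar>\<theta> * k v\<bar> powr r)"
        using nn_integral_one_minus_cos_powr[OF r, of "\<theta> * k v"] by simp
      also have "stable_const r * \<bar>\<theta> * k v\<bar> powr r = (stable_const r * \<theta> powr r) * \<bar>k v\<bar> powr r"
        using t by (simp add: abs_mult powr_mult)
      also have "ennreal \<dots> = ennreal (stable_const r * \<theta> powr r) * ennreal (\<bar>k v\<bar> powr r)"
        using K by (intro ennreal_mult) auto
      finally show "(\<integral>\<^sup>+x. ?F (x, v) \<partial>lborel) = \<dots>" .
    qed
    also have "\<dots> = ennreal (stable_const r * \<theta> powr r) * ennreal m"
      using m by (subst nn_integral_cmult) auto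
    also have "\<dots> = ennreal (stable_const r * m * \<theta> powr r)"
      using K m by (simp add: ennreal_mult[symmetric] mult_ac)
    finally have I: "(\<integral>\<^sup>+x\<in>{0..}. (\<integral>\<^sup>+v. ennreal (1 - cos (\<theta> * ?a (x, v))) \<partial>\<nu>) \<partial>lborel) = \<dots>" .
    have "expectation (\<lambda>\<omega>. cos (\<theta> * series ?a \<omega>)) = expectation (\<lambda>\<omega>. cos (series (\<lambda>z. \<theta> * ?a z) \<omega>))"
      by (rule integral_cong_AE, measurable, rule AE_mp[OF series_scale(2)[OF conv, of \<theta>]]) auto
    also have "\<dots> = exp (- (stable_const r * m * \<theta> powr r))"
    proof (rule expectation_cos_series[OF _ _ series_scale(1)[OF conv] _ I])
      show "continuous_on {0<..} (\<lambda>x. \<theta> * ?a (x, v))" for v by (auto intro!: continuous_intros)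
    qed (use K m in auto)
    finally show ?thesis .
  qed
  show ?thesis using abs_moment_of_stable[OF _ e _ char] K m by simp
qed

section \<open>Cells and kernel increments\<close>

text \<open>The one-based index of the cell that contains \<open>v\<close>, real-valued so that it
  can be inserted directly for \<open>real (Suc j)\<close>.\<close>

definition cell_num :: "real \<Rightarrow> real" where
  "cell_num v = (if 0 \<le> v then of_int \<lfloor>v\<rfloor> + 1 else - of_int \<lfloor>v\<rfloor>)"

text \<open>The reciprocal of the density of the marks. In the series it carries the exponent
  \<open>1 / \<alpha>\<close>, so in an \<open>\<alpha>\<close>-th power it cancels that
  density.\<close>

definition weight :: "real \<Rightarrow> real" where
  "weight v = pi\<^sup>2 * (cell_num v)\<^sup>2 / 3"

lemma cell_num_measurable [measurable]: "cell_num \<in> borel_measurable borel"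
  unfolding cell_num_def[abs_def] by measurable

lemma weight_measurable [measurable]: "weight \<in> borel_measurable borel"
  unfolding weight_def[abs_def] by measurable

lemma cell_num_bounds: "1 \<le> cell_num v" "cell_num v \<le> \<bar>v\<bar> + 1"
proof -
  show "1 \<le> cell_num v"
  proof (cases "0 \<le> v")
    case False
    then have "\<lfloor>v\<rfloor> \<le> -1" by (simp add: floor_le_iff)
    then have "real_of_int \<lfloor>v\<rfloor> \<le> of_int (-1)" by (simp only: of_int_le_iff)
    then show ?thesis using False by (simp add: cell_num_def)
  qed (simp add: cell_num_def)
  show "cell_num v \<le> \<bar>v\<bar> + 1"
    using of_int_floor_le[of v] real_of_int_floor_add_one_gt[of v]
    by (cases "0 \<le> v"; simp add: cell_num_def; linarith)
qed

lemma weight_bounds: "1 \<le> weight v" "weight v \<le> 6 * (\<bar>v\<bar> + 1)\<^sup>2"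
proof -
  have "1\<^sup>2 \<le> (cell_num v)\<^sup>2" using cell_num_bounds[of v] by (intro power_mono) auto
  moreover have "3\<^sup>2 \<le> pi\<^sup>2" using pi_gt3 by (intro power_mono) auto
  ultimately have "3\<^sup>2 * 1\<^sup>2 \<le> pi\<^sup>2 * (cell_num v)\<^sup>2" by (intro mult_mono) auto
  then show "1 \<le> weight v" by (simp add: weight_def)
  have "(cell_num v)\<^sup>2 \<le> (\<bar>v\<bar> + 1)\<^sup>2" using cell_num_bounds[of v] by (intro power_mono) auto
  moreover have "pi\<^sup>2 \<le> 4\<^sup>2" using pi_less_4 by (intro power_mono) auto
  ultimately have "pi\<^sup>2 * (cell_num v)\<^sup>2 \<le> 4\<^sup>2 * (\<bar>v\<bar> + 1)\<^sup>2" by (intro mult_mono) auto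
  \<comment> \<open>16 is rounded up to 18 so that the division by 3 yields 6.\<close>
  then have "pi\<^sup>2 * (cell_num v)\<^sup>2 \<le> 18 * (\<bar>v\<bar> + 1)\<^sup>2" by (rule order_trans) simp
  then show "weight v \<le> 6 * (\<bar>v\<bar> + 1)\<^sup>2" by (simp add: weight_def)
qed

lemma weight_pos: "0 < weight v"
  using weight_bounds(1)[of v] by linarith

lemma mem_cell_iff: "v \<in> cell j \<longleftrightarrow> real (Suc j) = cell_num v"
proof (cases "0 \<le> v")
  case True
  have "v \<in> cell j \<longleftrightarrow> real j \<le> v \<and> v < real j + 1"
    using True by (auto simp: cell_def)
  also have "\<dots> \<longleftrightarrow> \<lfloor>v\<rfloor> = int j" by (simp add: floor_eq_iff)
  also have "\<dots> \<longleftrightarrow> real_of_int \<lfloor>v\<rfloor> = real j" by (metis of_int_eq_iff of_int_of_nat_eq)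
  finally show ?thesis using True by (auto simp: cell_num_def)
next
  case False
  have "v \<in> cell j \<longleftrightarrow> - real (Suc j) \<le> v \<and> v < - real (Suc j) + 1"
    using False by (auto simp: cell_def)
  also have "\<dots> \<longleftrightarrow> \<lfloor>v\<rfloor> = - int (Suc j)" by (simp add: floor_eq_iff)
  also have "\<dots> \<longleftrightarrow> real_of_int \<lfloor>v\<rfloor> = - real (Suc j)" by (metis of_int_eq_iff of_int_of_nat_eq of_int_minus)
  finally show ?thesis using False by (auto simp: cell_num_def)
qed

text \<open>Stated for arbitrary \<open>f\<close> so that it evaluates both the density of the marks
  and the inner series of the field.\<close>

lemma suminf_cell:
  fixes f :: "real \<Rightarrow> real"
  shows "(\<Sum>j. f (real (Suc j)) * indicator (cell j) v) = f (cell_num v)"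
proof -
  obtain j0 where j0: "real (Suc j0) = cell_num v"
  proof -
    define n where "n = (if 0 \<le> v then \<lfloor>v\<rfloor> + 1 else - \<lfloor>v\<rfloor>)"
    have n: "real_of_int n = cell_num v" by (simp add: n_def cell_num_def)
    then have "1 \<le> n" using cell_num_bounds(1)[of v] by linarith
    then have "real (Suc (nat (n - 1))) = cell_num v" using n by (simp add: of_nat_nat)
    then show thesis by (rule that)
  qed
  have "(\<Sum>j. f (real (Suc j)) * indicator (cell j) v) = (\<Sum>j\<in>{j0}. f (real (Suc j)) * indicator (cell j) v)"
  proof (rule suminf_finite)
    fix j assume "j \<notin> {j0}"
    then have "real (Suc j) \<noteq> cell_num v" unfolding j0[symmetric] by simp
    then have "v \<notin> cell j" by (simp only: mem_cell_iff not_False_eq_True)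
    then show "f (real (Suc j)) * indicator (cell j) v = 0" by simp
  qed simp
  also have "\<dots> = f (real (Suc j0))" using mem_cell_iff[of v j0] j0 by simp
  finally show ?thesis by (simp only: j0)
qed

lemma m_hat_density_eq: "m_hat_density v = 1 / weight v"
  using suminf_cell[of "\<lambda>x. 1 / x\<^sup>2" v] by (simp add: m_hat_density_def weight_def)

section \<open>Kernel increments and their envelope\<close>

definition increment :: "real \<Rightarrow> real \<Rightarrow> real \<Rightarrow> real" where
  "increment \<kappa> s v = \<bar>s - v\<bar> powr \<kappa> - \<bar>v\<bar> powr \<kappa>"

text \<open>A majorant of \<open>r powr \<kappa>'\<close> for all \<open>\<kappa>'\<close> within
  \<open>\<delta>\<close> of \<open>\<kappa>\<close>, for small and for large \<open>r\<close>. It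
  does not depend on \<open>\<kappa>'\<close> and so remains valid while the parameters
  vary.\<close>

definition two_powers :: "real \<Rightarrow> real \<Rightarrow> real \<Rightarrow> real" where
  "two_powers \<kappa> \<delta> r = r powr (\<kappa> - \<delta>) + r powr (\<kappa> + \<delta>)"

text \<open>For \<open>\<bar>v\<bar>\<close> large the two powers in \<open>increment\<close> cancel to first order, whence the exponent \<open>\<kappa> - 1\<close>.\<close>

definition envelope :: "real \<Rightarrow> real \<Rightarrow> real \<Rightarrow> real \<Rightarrow> real \<Rightarrow> real" where
  "envelope \<kappa> \<delta> A s v = (if \<bar>v\<bar> < 2 * A then two_powers \<kappa> \<delta> \<bar>s - v\<bar> + two_powers \<kappa> \<delta> \<bar>v\<bar>
     else \<bar>v\<bar> powr (\<kappa> - 1 + \<delta>))"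

text \<open>The summands belong to the cases of the estimate: 1 and \<open>2 / \<delta>\<close> to
  values and differences for \<open>\<bar>v\<bar> < 2 * A\<close>. In the last one \<open>A\<close>
  bounds the shift, \<open>2 powr (1 - \<kappa> - \<delta>)\<close> comes from passing from
  \<open>\<bar>v\<bar> / 2\<close> to \<open>\<bar>v\<bar>\<close>, and the bracket bounds the
  derivatives.\<close>

definition envelope_const :: "real \<Rightarrow> real \<Rightarrow> real \<Rightarrow> real" where
  "envelope_const \<kappa> \<delta> A = 1 + 2 / \<delta> + A * 2 powr (1 - \<kappa> - \<delta>) * (\<bar>\<kappa>\<bar> + \<delta> + 1 + 4 * \<bar>\<kappa>\<bar> / \<delta>)"

lemma increment_measurable [measurable]: "increment \<kappa> s \<in> borel_measurable borel"
  unfolding increment_def[abs_def] by measurable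

lemma envelope_measurable [measurable]: "envelope \<kappa> \<delta> A s \<in> borel_measurable borel"
  unfolding envelope_def[abs_def] two_powers_def[abs_def] by measurable

lemma two_powers_nonneg: "0 \<le> two_powers \<kappa> \<delta> r"
  by (simp add: two_powers_def)

lemma envelope_nonneg: "0 \<le> envelope \<kappa> \<delta> A s v"
  by (simp add: envelope_def two_powers_nonneg)

lemma two_powers_bounds:
  assumes r: "0 \<le> r" and d: "0 < \<delta>" and k: "\<bar>\<kappa>' - \<kappa>\<bar> \<le> \<delta> / 2"
  shows "r powr \<kappa>' \<le> two_powers \<kappa> \<delta> r"
    and "\<bar>r powr \<kappa>' - r powr \<kappa>\<bar> \<le> \<bar>\<kappa>' - \<kappa>\<bar> * (2 / \<delta> * two_powers \<kappa> \<delta> r)"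
proof -
  show "r powr \<kappa>' \<le> two_powers \<kappa> \<delta> r"
    using powr_le_near_exponents[of r \<kappa>' \<kappa> \<delta>] r d k by (cases "r = 0") (auto simp: two_powers_def)
  show "\<bar>r powr \<kappa>' - r powr \<kappa>\<bar> \<le> \<bar>\<kappa>' - \<kappa>\<bar> * (2 / \<delta> * two_powers \<kappa> \<delta> r)"
    using abs_powr_diff_exponents_le[of r \<delta> \<kappa> \<kappa> \<kappa>'] r d k by (cases "r = 0") (auto simp: two_powers_def)
qed

text \<open>For \<open>\<bar>v\<bar> < 2 * A\<close> the triangle inequality suffices. Beyond, the
  mean value theorem in the position is applied to \<open>r powr \<kappa>'\<close> and, for the
  second bound, to \<open>r powr \<kappa>' - r powr \<kappa>\<close>: the cancellation in the
  position and the smallness in the exponent have to be kept at the same time.\<close>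

lemma increment_le_envelope:
  assumes d: "0 < \<delta>" and kd: "\<kappa> + \<delta> < 1" and A: "1 \<le> A" and s: "\<bar>s\<bar> \<le> A" and k: "\<bar>\<kappa>' - \<kappa>\<bar> \<le> \<delta> / 2"
  shows "\<bar>increment \<kappa>' s v\<bar> \<le> envelope_const \<kappa> \<delta> A * envelope \<kappa> \<delta> A s v" (is ?A)
    and "\<bar>increment \<kappa>' s v - increment \<kappa> s v\<bar>
      \<le> \<bar>\<kappa>' - \<kappa>\<bar> * (envelope_const \<kappa> \<delta> A * envelope \<kappa> \<delta> A s v)" (is ?B)
proof -
  let ?c = "envelope_const \<kappa> \<delta> A" and ?e = "envelope \<kappa> \<delta> A s v"
  have e0: "0 \<le> ?e" by (rule envelope_nonneg)
  have far_nonneg: "0 \<le> A * 2 powr (1 - \<kappa> - \<delta>) * (\<bar>\<kappa>\<bar> + \<delta> + 1 + 4 * \<bar>\<kappa>\<bar> / \<delta>)"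
    using A d by (intro mult_nonneg_nonneg add_nonneg_nonneg) auto
  have c1: "1 \<le> ?c" "2 / \<delta> \<le> ?c" using far_nonneg d by (auto simp: envelope_const_def)
  have far_le: "A * 2 powr (1 - \<kappa> - \<delta>) * (\<bar>\<kappa>\<bar> + \<delta> + 1 + 4 * \<bar>\<kappa>\<bar> / \<delta>) \<le> ?c"
    using d by (simp add: envelope_const_def add_nonneg_nonneg)
  have "?A \<and> ?B"
  proof (cases "\<bar>v\<bar> < 2 * A")
    case True
    then have e: "?e = two_powers \<kappa> \<delta> \<bar>s - v\<bar> + two_powers \<kappa> \<delta> \<bar>v\<bar>" by (simp add: envelope_def)
    note b1 = two_powers_bounds[of "\<bar>s - v\<bar>", OF _ d k] and b2 = two_powers_bounds[of "\<bar>v\<bar>", OF _ d k]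
    have "\<bar>increment \<kappa>' s v\<bar> \<le> \<bar>s - v\<bar> powr \<kappa>' + \<bar>v\<bar> powr \<kappa>'"
      unfolding increment_def by (rule abs_triangle_ineq4[THEN order_trans]) simp
    also have "\<dots> \<le> 1 * ?e" using b1(1) b2(1) by (simp add: e)
    also have "\<dots> \<le> ?c * ?e" using c1 e0 by (intro mult_right_mono) auto
    finally have ?A .
    have "\<bar>increment \<kappa>' s v - increment \<kappa> s v\<bar>
        = \<bar>(\<bar>s - v\<bar> powr \<kappa>' - \<bar>s - v\<bar> powr \<kappa>) - (\<bar>v\<bar> powr \<kappa>' - \<bar>v\<bar> powr \<kappa>)\<bar>"
      unfolding increment_def by (rule arg_cong[where f = abs]) simp
    also have "\<dots> \<le> \<bar>\<bar>s - v\<bar> powr \<kappa>' - \<bar>s - v\<bar> powr \<kappa>\<bar> + \<bar>\<bar>v\<bar> powr \<kappa>' - \<bar>v\<bar> powr \<kappa>\<bar>"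
      by (rule abs_triangle_ineq4)
    also have "\<dots> \<le> \<bar>\<kappa>' - \<kappa>\<bar> * (2 / \<delta> * ?e)"
      using add_mono[OF b1(2) b2(2)] by (simp add: e algebra_simps)
    also have "\<dots> \<le> \<bar>\<kappa>' - \<kappa>\<bar> * (?c * ?e)"
      using c1 e0 by (intro mult_left_mono mult_right_mono) auto
    finally show ?thesis using \<open>?A\<close> by blast
  next
    case False
    define y where "y = \<bar>v\<bar>"
    have y: "2 * A \<le> y" using False by (simp add: y_def)
    have y2: "1 \<le> y / 2" using y A by simp
    \<comment> \<open>\<open>s\<close> is at most half of \<open>y\<close> in modulus, so both radii
      lie in \<open>{y / 2..}\<close>, away from the singularity.\<close>
    have "y \<le> 2 * \<bar>s - v\<bar>" using abs_triangle_ineq4[of s "s - v"] y s by (simp add: y_def)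
    then have mem: "\<bar>s - v\<bar> \<in> {y / 2..}" "y \<in> {y / 2..}" using y A by auto
    have dist: "\<bar>\<bar>s - v\<bar> - y\<bar> \<le> A" using abs_triangle_ineq3[of "s - v" "- v"] s by (simp add: y_def)
    have e: "?e = y powr (\<kappa> - 1 + \<delta>)" using False by (simp add: envelope_def y_def)
    let ?E = "(y / 2) powr (\<kappa> - 1 + \<delta>)"
    have E: "?E = 2 powr (1 - \<kappa> - \<delta>) * ?e"
    proof -
      have "?E = y powr (\<kappa> - 1 + \<delta>) / 2 powr (\<kappa> - 1 + \<delta>)" using y A by (simp add: powr_divide)
      also have "\<dots> = y powr (\<kappa> - 1 + \<delta>) * 2 powr (- (\<kappa> - 1 + \<delta>))"
        by (simp only: powr_minus divide_inverse)
      finally show ?thesis by (simp add: e algebra_simps)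
    qed
    \<comment> \<open>The exponent \<open>\<kappa> - 1 + \<delta>\<close> is negative and
      \<open>y / 2\<close> is at least 1, so on this half line all powers with exponents up to it
      are at most \<open>?E\<close>.\<close>
    have pw: "r powr q \<le> ?E" if "r \<in> {y / 2..}" "q \<le> \<kappa> - 1 + \<delta>" for r q
    proof -
      have "r powr q \<le> r powr (\<kappa> - 1 + \<delta>)" using that y2 by (intro powr_mono) auto
      also have "\<dots> \<le> ?E" using that y2 kd by (intro powr_mono2') auto
      finally show ?thesis .
    qed
    have k': "\<bar>\<kappa>'\<bar> \<le> \<bar>\<kappa>\<bar> + \<delta>" "\<kappa>' \<le> \<kappa> + \<delta>" using k d by linarith+
    have E0: "0 \<le> ?E" by simp
    have "norm (\<bar>s - v\<bar> powr \<kappa>' - y powr \<kappa>') \<le> (\<bar>\<kappa>\<bar> + \<delta>) * ?E * norm (\<bar>s - v\<bar> - y)"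
    proof (rule field_differentiable_bound[OF convex_real_interval(1) _ _ mem])
      fix r assume r: "r \<in> {y / 2..}"
      then show "((\<lambda>r. r powr \<kappa>') has_field_derivative \<kappa>' * r powr (\<kappa>' - 1)) (at r within {y / 2..})"
        using y2 by (auto intro!: derivative_eq_intros)
      have "\<bar>\<kappa>'\<bar> * r powr (\<kappa>' - 1) \<le> (\<bar>\<kappa>\<bar> + \<delta>) * ?E"
        using k' pw[OF r, of "\<kappa>' - 1"] by (intro mult_mono) auto
      then show "norm (\<kappa>' * r powr (\<kappa>' - 1)) \<le> (\<bar>\<kappa>\<bar> + \<delta>) * ?E" by (simp add: abs_mult)
    qed
    then have "\<bar>increment \<kappa>' s v\<bar> \<le> (\<bar>\<kappa>\<bar> + \<delta>) * ?E * \<bar>\<bar>s - v\<bar> - y\<bar>" by (simp add: increment_def y_def)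
    also have "\<dots> \<le> (\<bar>\<kappa>\<bar> + \<delta>) * ?E * A" using dist d by (intro mult_left_mono) auto
    also have "\<dots> = (A * 2 powr (1 - \<kappa> - \<delta>) * (\<bar>\<kappa>\<bar> + \<delta>)) * ?e" by (simp add: E)
    also have "\<dots> \<le> ?c * ?e"
    proof (rule mult_right_mono[OF _ e0])
      have "A * 2 powr (1 - \<kappa> - \<delta>) * (\<bar>\<kappa>\<bar> + \<delta>) \<le> A * 2 powr (1 - \<kappa> - \<delta>) * (\<bar>\<kappa>\<bar> + \<delta> + 1 + 4 * \<bar>\<kappa>\<bar> / \<delta>)"
        using A d by (intro mult_left_mono) auto
      then show "A * 2 powr (1 - \<kappa> - \<delta>) * (\<bar>\<kappa>\<bar> + \<delta>) \<le> ?c" using far_le by (rule order_trans)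
    qed
    finally have ?A .
    let ?D = "\<bar>\<kappa>' - \<kappa>\<bar> * ((1 + 4 * \<bar>\<kappa>\<bar> / \<delta>) * ?E)"
    have "norm ((\<bar>s - v\<bar> powr \<kappa>' - \<bar>s - v\<bar> powr \<kappa>) - (y powr \<kappa>' - y powr \<kappa>)) \<le> ?D * norm (\<bar>s - v\<bar> - y)"
    proof (rule field_differentiable_bound[OF convex_real_interval(1) _ _ mem])
      fix r assume r: "r \<in> {y / 2..}"
      then show "((\<lambda>r. r powr \<kappa>' - r powr \<kappa>) has_field_derivative \<kappa>' * r powr (\<kappa>' - 1) - \<kappa> * r powr (\<kappa> - 1)) (at r within {y / 2..})"
        using y2 by (auto intro!: derivative_eq_intros)
      have r0: "0 < r" using r y2 by auto
      \<comment> \<open>Both parts of this splitting are of order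
        \<open>\<kappa>' - \<kappa>\<close>: the first explicitly, the second by the Lipschitz bound
        in the exponent.\<close>
      have "\<kappa>' * r powr (\<kappa>' - 1) - \<kappa> * r powr (\<kappa> - 1)
          = (\<kappa>' - \<kappa>) * r powr (\<kappa>' - 1) + \<kappa> * (r powr (\<kappa>' - 1) - r powr (\<kappa> - 1))"
        by (simp add: algebra_simps)
      also have "\<bar>\<dots>\<bar> \<le> \<bar>\<kappa>' - \<kappa>\<bar> * r powr (\<kappa>' - 1) + \<bar>\<kappa>\<bar> * \<bar>r powr (\<kappa>' - 1) - r powr (\<kappa> - 1)\<bar>"
        by (rule order_trans[OF abs_triangle_ineq]) (simp add: abs_mult)
      also have "\<dots> \<le> \<bar>\<kappa>' - \<kappa>\<bar> * ?E + \<bar>\<kappa>\<bar> * (\<bar>\<kappa>' - \<kappa>\<bar> * (2 / \<delta> * (?E + ?E)))"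
      proof (intro add_mono mult_left_mono)
        show "r powr (\<kappa>' - 1) \<le> ?E" using k' by (intro pw r) simp
        have "\<bar>r powr (\<kappa>' - 1) - r powr (\<kappa> - 1)\<bar>
            \<le> \<bar>(\<kappa>' - 1) - (\<kappa> - 1)\<bar> * (2 / \<delta> * (r powr (\<kappa> - 1 - \<delta>) + r powr (\<kappa> - 1 + \<delta>)))"
          using k d by (intro abs_powr_diff_exponents_le r0) auto
        also have "\<dots> \<le> \<bar>\<kappa>' - \<kappa>\<bar> * (2 / \<delta> * (?E + ?E))"
          using d pw[OF r, of "\<kappa> - 1 - \<delta>"] pw[OF r, of "\<kappa> - 1 + \<delta>"]
          by (simp only: diff_diff_eq2 diff_add_cancel add_diff_cancel_right')
             (intro mult_mono mult_left_mono add_mono; simp)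
        finally show "\<bar>r powr (\<kappa>' - 1) - r powr (\<kappa> - 1)\<bar> \<le> \<bar>\<kappa>' - \<kappa>\<bar> * (2 / \<delta> * (?E + ?E))" .
      qed auto
      also have "\<dots> = ?D" by (simp add: algebra_simps)
      finally show "norm (\<kappa>' * r powr (\<kappa>' - 1) - \<kappa> * r powr (\<kappa> - 1)) \<le> ?D" by simp
    qed
    then have "\<bar>increment \<kappa>' s v - increment \<kappa> s v\<bar> \<le> ?D * \<bar>\<bar>s - v\<bar> - y\<bar>"
      by (simp add: increment_def y_def algebra_simps)
    also have "\<dots> \<le> ?D * A" using dist d by (intro mult_left_mono mult_nonneg_nonneg) auto
    also have "\<dots> = \<bar>\<kappa>' - \<kappa>\<bar> * ((A * 2 powr (1 - \<kappa> - \<delta>) * (1 + 4 * \<bar>\<kappa>\<bar> / \<delta>)) * ?e)" by (simp add: E)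
    also have "\<dots> \<le> \<bar>\<kappa>' - \<kappa>\<bar> * (?c * ?e)"
    proof (intro mult_left_mono mult_right_mono)
      have "A * 2 powr (1 - \<kappa> - \<delta>) * (1 + 4 * \<bar>\<kappa>\<bar> / \<delta>) \<le> A * 2 powr (1 - \<kappa> - \<delta>) * (\<bar>\<kappa>\<bar> + \<delta> + 1 + 4 * \<bar>\<kappa>\<bar> / \<delta>)"
        using A d by (intro mult_left_mono) auto
      then show "A * 2 powr (1 - \<kappa> - \<delta>) * (1 + 4 * \<bar>\<kappa>\<bar> / \<delta>) \<le> ?c" using far_le by (rule order_trans)
    qed (use e0 in auto)
    finally show ?thesis using \<open>?A\<close> by blast
  qed
  then show ?A ?B by blast+
qed

lemma nn_integral_even_le:
  fixes f :: "real \<Rightarrow> ennreal"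
  assumes [measurable]: "f \<in> borel_measurable borel"
  shows "(\<integral>\<^sup>+v. f \<bar>v\<bar> \<partial>lborel) \<le> 2 * (\<integral>\<^sup>+v\<in>{0..}. f v \<partial>lborel)"
proof -
  have "(\<integral>\<^sup>+v. f \<bar>v\<bar> \<partial>lborel) \<le> (\<integral>\<^sup>+v. f v * indicator {0..} v + f (- v) * indicator {0..} (- v) \<partial>lborel)"
    by (intro nn_integral_mono) (auto simp: indicator_def abs_if)
  also have "\<dots> = (\<integral>\<^sup>+v\<in>{0..}. f v \<partial>lborel) + (\<integral>\<^sup>+v. f (- v) * indicator {0..} (- v) \<partial>lborel)"
    by (intro nn_integral_add) measurable
  also have "(\<integral>\<^sup>+v. f (- v) * indicator {0..} (- v) \<partial>lborel) = (\<integral>\<^sup>+v\<in>{0..}. f v \<partial>lborel)"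
    using nn_integral_real_affine[of "\<lambda>v. f v * indicator {0..} v" "-1" 0] by simp
  finally show ?thesis by (simp add: mult_2)
qed

lemma nn_integral_abs_powr_near:
  fixes q B :: real
  assumes "-1 < q" "0 \<le> B"
  shows "(\<integral>\<^sup>+v\<in>{-B..B}. ennreal (\<bar>v\<bar> powr q) \<partial>lborel) \<le> ennreal (2 * (B powr (q + 1) / (q + 1)))"
proof -
  have "(\<integral>\<^sup>+v\<in>{-B..B}. ennreal (\<bar>v\<bar> powr q) \<partial>lborel) = (\<integral>\<^sup>+v. ennreal (\<bar>v\<bar> powr q) * indicator {..B} \<bar>v\<bar> \<partial>lborel)"
    by (intro nn_integral_cong) (auto simp: indicator_def abs_le_iff)
  also have "\<dots> \<le> 2 * (\<integral>\<^sup>+v\<in>{0..}. ennreal (v powr q) * indicator {..B} v \<partial>lborel)"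
    using nn_integral_even_le[of "\<lambda>v. ennreal (v powr q) * indicator {..B} v"] by simp
  also have "(\<integral>\<^sup>+v\<in>{0..}. ennreal (v powr q) * indicator {..B} v \<partial>lborel) = (\<integral>\<^sup>+v\<in>{0..B}. ennreal (v powr q) \<partial>lborel)"
    by (intro nn_integral_cong) (auto simp: indicator_def)
  also have "\<dots> = ennreal (B powr (q + 1) / (q + 1))"
    using assms by (intro nn_integral_has_integral_lebesgue' has_integral_powr_from_0) auto
  also have "2 * ennreal (B powr (q + 1) / (q + 1)) = ennreal (2 * (B powr (q + 1) / (q + 1)))"
    using assms by (subst ennreal_mult) auto
  finally show ?thesis .
qed

lemma nn_integral_abs_powr_far:
  fixes q :: real
  assumes "q < -1"
  shows "(\<integral>\<^sup>+v\<in>{v. 1 \<le> \<bar>v\<bar>}. ennreal (\<bar>v\<bar> powr q) \<partial>lborel) \<le> ennreal (2 * (1 / (- q - 1)))"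
proof -
  have "(\<integral>\<^sup>+v\<in>{v. 1 \<le> \<bar>v\<bar>}. ennreal (\<bar>v\<bar> powr q) \<partial>lborel) = (\<integral>\<^sup>+v. ennreal (\<bar>v\<bar> powr q) * indicator {1..} \<bar>v\<bar> \<partial>lborel)"
    by (intro nn_integral_cong) (auto simp: indicator_def)
  also have "\<dots> \<le> 2 * (\<integral>\<^sup>+v\<in>{0..}. ennreal (v powr q) * indicator {1..} v \<partial>lborel)"
    using nn_integral_even_le[of "\<lambda>v. ennreal (v powr q) * indicator {1..} v"] by simp
  also have "(\<integral>\<^sup>+v\<in>{0..}. ennreal (v powr q) * indicator {1..} v \<partial>lborel) = (\<integral>\<^sup>+v\<in>{1..}. ennreal (v powr q) \<partial>lborel)"
    by (intro nn_integral_cong) (auto simp: indicator_def)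
  also have "\<dots> = ennreal (1 / (- q - 1))"
    using assms nn_integral_powr_near_infinity[of "- q"] by simp
  also have "2 * ennreal (1 / (- q - 1)) = ennreal (2 * (1 / (- q - 1)))"
    using assms by (subst ennreal_mult) auto
  finally show ?thesis .
qed

text \<open>\<open>near\<close> makes the lowest power, \<open>p * (\<kappa> - \<delta>)\<close>,
  integrable at the singularities 0 and \<open>s\<close>; \<open>far\<close> balances the quadratic
  growth of the weight against the decay of the envelope. The bound is uniform in \<open>s\<close>
  since the singular part is only translated.\<close>

lemma envelope_moment_bound:
  assumes p: "0 < p" "p \<le> 2" and near: "p * (\<delta> - \<kappa>) < 1" and d: "0 < \<delta>" and q: "0 \<le> q"
    and far: "2 * q + p * (\<kappa> - 1 + \<delta>) < - 1" and A: "1 \<le> A"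
  obtains m where "0 \<le> m"
    "\<And>s. \<bar>s\<bar> \<le> A \<Longrightarrow> (\<integral>\<^sup>+v. ennreal (weight v powr q * envelope \<kappa> \<delta> A s v powr p) \<partial>lborel) \<le> ennreal m"
proof -
  \<comment> \<open>16 stands for two uses of \<open>powr_abs_add_le\<close>, on the envelope and on
    \<open>two_powers\<close>; the other factor bounds the weight for
    \<open>\<bar>v\<bar> < 2 * A\<close>.\<close>
  define w0 where "w0 = (6 * (2 * A + 1)\<^sup>2) powr q * 16"
  define e1 where "e1 = p * (\<kappa> - \<delta>)"
  define e2 where "e2 = p * (\<kappa> + \<delta>)"
  define e3 where "e3 = 2 * q + p * (\<kappa> - 1 + \<delta>)"
  have e1: "-1 < e1" using near by (simp add: e1_def algebra_simps)
  have e12: "e1 \<le> e2" unfolding e1_def e2_def using p d by (intro mult_left_mono) auto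
  have e2: "-1 < e2" using e1 e12 by simp
  have e3: "e3 < -1" using far by (simp add: e3_def)
  let ?P = "\<lambda>e v. ennreal (\<bar>v\<bar> powr e) * indicator {- (3 * A)..3 * A} v"
  let ?Q = "\<lambda>v. ennreal (\<bar>v\<bar> powr e3) * indicator {v. 1 \<le> \<bar>v\<bar>} v"
  define J where "J e = 2 * ((3 * A) powr (e + 1) / (e + 1))" for e
  have J: "(\<integral>\<^sup>+v. ?P e v \<partial>lborel) \<le> ennreal (J e)" if "-1 < e" for e
    unfolding J_def using that A by (intro nn_integral_abs_powr_near) auto
  have Jn: "0 \<le> J e1" "0 \<le> J e2" using e1 e2 by (auto simp: J_def)
  define m where "m = w0 * (2 * J e1 + 2 * J e2) + 24 powr q * (2 * (1 / (- e3 - 1)))"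
  show thesis
  proof (rule that)
    show "0 \<le> m" unfolding m_def w0_def using Jn e3 by (intro add_nonneg_nonneg mult_nonneg_nonneg) auto
    fix s assume s: "\<bar>s\<bar> \<le> A"
    have pt: "ennreal (weight v powr q * envelope \<kappa> \<delta> A s v powr p)
        \<le> ennreal w0 * (?P e1 (s - v) + ?P e2 (s - v) + (?P e1 v + ?P e2 v)) + ennreal (24 powr q) * ?Q v" for v
    proof (cases "\<bar>v\<bar> < 2 * A")
      case True
      have "weight v \<le> 6 * (\<bar>v\<bar> + 1)\<^sup>2" by (rule weight_bounds)
      also have "\<dots> \<le> 6 * (2 * A + 1)\<^sup>2" using True by (intro mult_left_mono power_mono) auto
      finally have w: "weight v powr q \<le> (6 * (2 * A + 1)\<^sup>2) powr q"
        using weight_pos[of v] q by (intro powr_mono2) auto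
      have tp: "two_powers \<kappa> \<delta> r powr p \<le> 4 * (r powr e1 + r powr e2)" for r
        using powr_abs_add_le[of p "r powr (\<kappa> - \<delta>)" "r powr (\<kappa> + \<delta>)"] p
        by (simp add: two_powers_def powr_powr e1_def e2_def mult.commute)
      have "envelope \<kappa> \<delta> A s v powr p \<le> 4 * (two_powers \<kappa> \<delta> \<bar>s - v\<bar> powr p + two_powers \<kappa> \<delta> \<bar>v\<bar> powr p)"
        using True powr_abs_add_le[of p "two_powers \<kappa> \<delta> \<bar>s - v\<bar>" "two_powers \<kappa> \<delta> \<bar>v\<bar>"] p
        by (simp add: envelope_def two_powers_nonneg)
      also have "\<dots> \<le> 16 * (\<bar>s - v\<bar> powr e1 + \<bar>s - v\<bar> powr e2 + (\<bar>v\<bar> powr e1 + \<bar>v\<bar> powr e2))"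
        using tp[of "\<bar>s - v\<bar>"] tp[of "\<bar>v\<bar>"] by simp
      finally have "weight v powr q * envelope \<kappa> \<delta> A s v powr p
          \<le> (6 * (2 * A + 1)\<^sup>2) powr q * (16 * (\<bar>s - v\<bar> powr e1 + \<bar>s - v\<bar> powr e2 + (\<bar>v\<bar> powr e1 + \<bar>v\<bar> powr e2)))"
        using w by (intro mult_mono) auto
      then have "ennreal (weight v powr q * envelope \<kappa> \<delta> A s v powr p)
          \<le> ennreal (w0 * (\<bar>s - v\<bar> powr e1 + \<bar>s - v\<bar> powr e2 + (\<bar>v\<bar> powr e1 + \<bar>v\<bar> powr e2)))"
        by (intro ennreal_leI) (simp add: w0_def mult.assoc)
      also have "\<dots> = ennreal w0 * (?P e1 (s - v) + ?P e2 (s - v) + (?P e1 v + ?P e2 v))"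
      proof -
        \<comment> \<open>The range \<open>3 * A\<close> of the near integrals comes from
          \<open>\<bar>s\<bar> \<le> A\<close> and \<open>\<bar>v\<bar> < 2 * A\<close>.\<close>
        have "s - v \<in> {- (3 * A)..3 * A}" "v \<in> {- (3 * A)..3 * A}" using True s by auto
        then show ?thesis by (simp add: ennreal_mult' w0_def)
      qed
      finally show ?thesis by (simp add: add_increasing2)
    next
      case False
      have v: "1 \<le> \<bar>v\<bar>" using False A by simp
      have "weight v \<le> 6 * (\<bar>v\<bar> + 1)\<^sup>2" by (rule weight_bounds)
      also have "\<dots> \<le> 6 * (2 * \<bar>v\<bar>)\<^sup>2" using v by (intro mult_left_mono power_mono) auto
      also have "\<dots> = 24 * \<bar>v\<bar> powr 2" using v by (simp add: powr_numeral power_mult_distrib)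
      finally have "weight v powr q \<le> (24 * \<bar>v\<bar> powr 2) powr q"
        using weight_pos[of v] q by (intro powr_mono2) auto
      also have "\<dots> = 24 powr q * (\<bar>v\<bar> powr 2) powr q" by (rule powr_mult)
      also have "(\<bar>v\<bar> powr 2) powr q = \<bar>v\<bar> powr (2 * q)" by (rule powr_powr)
      finally have "weight v powr q * envelope \<kappa> \<delta> A s v powr p
          \<le> (24 powr q * \<bar>v\<bar> powr (2 * q)) * \<bar>v\<bar> powr ((\<kappa> - 1 + \<delta>) * p)"
        using False by (intro mult_mono) (auto simp: envelope_def powr_powr)
      also have "\<dots> = 24 powr q * \<bar>v\<bar> powr e3"
        by (simp add: e3_def powr_add[symmetric] mult.commute mult.assoc)
      finally have "ennreal (weight v powr q * envelope \<kappa> \<delta> A s v powr p) \<le> ennreal (24 powr q) * ?Q v"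
        using v by (simp add: ennreal_mult[symmetric] ennreal_leI)
      then show ?thesis by (simp add: add_increasing)
    qed
    \<comment> \<open>Reflection and translation remove the dependence on \<open>s\<close>.\<close>
    have refl: "(\<integral>\<^sup>+v. ?P e (s - v) \<partial>lborel) = (\<integral>\<^sup>+v. ?P e v \<partial>lborel)" for e
      using nn_integral_real_affine[of "?P e" "-1" s] by simp
    have "(\<integral>\<^sup>+v. ennreal (weight v powr q * envelope \<kappa> \<delta> A s v powr p) \<partial>lborel)
        \<le> (\<integral>\<^sup>+v. ennreal w0 * (?P e1 (s - v) + ?P e2 (s - v) + (?P e1 v + ?P e2 v)) + ennreal (24 powr q) * ?Q v \<partial>lborel)"
      by (intro nn_integral_mono pt)
    also have "\<dots> = ennreal w0 * ((\<integral>\<^sup>+v. ?P e1 (s - v) \<partial>lborel) + (\<integral>\<^sup>+v. ?P e2 (s - v) \<partial>lborel)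
        + ((\<integral>\<^sup>+v. ?P e1 v \<partial>lborel) + (\<integral>\<^sup>+v. ?P e2 v \<partial>lborel))) + ennreal (24 powr q) * (\<integral>\<^sup>+v. ?Q v \<partial>lborel)"
      by (simp add: nn_integral_add nn_integral_cmult)
    also have "\<dots> \<le> ennreal w0 * (ennreal (J e1) + ennreal (J e2) + (ennreal (J e1) + ennreal (J e2)))
        + ennreal (24 powr q) * ennreal (2 * (1 / (- e3 - 1)))"
      unfolding refl by (intro add_mono mult_left_mono J e1 e2 nn_integral_abs_powr_far e3) auto
    also have "\<dots> = ennreal m"
    proof -
      have "ennreal (J e1) + ennreal (J e2) + (ennreal (J e1) + ennreal (J e2)) = ennreal (2 * J e1 + 2 * J e2)"
        using Jn by (simp add: ennreal_plus[symmetric] del: ennreal_plus)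
      moreover have "ennreal m = ennreal (w0 * (2 * J e1 + 2 * J e2)) + ennreal (24 powr q * (2 * (1 / (- e3 - 1))))"
        unfolding m_def using Jn e3 by (intro ennreal_plus mult_nonneg_nonneg) (auto simp: w0_def)
      moreover have "ennreal (w0 * (2 * J e1 + 2 * J e2)) = ennreal w0 * ennreal (2 * J e1 + 2 * J e2)"
        using Jn by (intro ennreal_mult) (auto simp: w0_def)
      moreover have "ennreal (24 powr q * (2 * (1 / (- e3 - 1)))) = ennreal (24 powr q) * ennreal (2 * (1 / (- e3 - 1)))"
        using e3 by (intro ennreal_mult) auto
      ultimately show ?thesis by (simp only:)
    qed
    finally show "(\<integral>\<^sup>+v. ennreal (weight v powr q * envelope \<kappa> \<delta> A s v powr p) \<partial>lborel) \<le> ennreal m" .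
  qed
qed

section \<open>Moment bounds for the kernel\<close>

text \<open>A condition with one reference point: all comparisons are with the parameters at a
  single time, it survives composition and products, and for \<open>stable_const\<close> it follows
  from dominating integrands without differentiating under the integral.\<close>

definition lipschitz_at :: "(real \<Rightarrow> real) \<Rightarrow> real \<Rightarrow> bool" where
  "lipschitz_at f x \<longleftrightarrow> (\<exists>L\<ge>0. \<exists>\<delta>>0. \<forall>y. \<bar>y - x\<bar> \<le> \<delta> \<longrightarrow> \<bar>f y - f x\<bar> \<le> L * \<bar>y - x\<bar>)"

lemma lipschitz_at_compose:
  assumes "lipschitz_at f x" "lipschitz_at g (f x)"
  shows "lipschitz_at (\<lambda>y. g (f y)) x"
proof -
  from assms(1) obtain L1 d1 where 1: "0 \<le> L1" "0 < d1" "\<And>y. \<bar>y - x\<bar> \<le> d1 \<Longrightarrow> \<bar>f y - f x\<bar> \<le> L1 * \<bar>y - x\<bar>"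
    by (auto simp: lipschitz_at_def)
  from assms(2) obtain L2 d2 where 2: "0 \<le> L2" "0 < d2" "\<And>z. \<bar>z - f x\<bar> \<le> d2 \<Longrightarrow> \<bar>g z - g (f x)\<bar> \<le> L2 * \<bar>z - f x\<bar>"
    by (auto simp: lipschitz_at_def)
  define d where "d = min d1 (d2 / (L1 + 1))"
  have d: "0 < d" using 1 2 by (simp add: d_def)
  have "\<bar>g (f y) - g (f x)\<bar> \<le> L2 * L1 * \<bar>y - x\<bar>" if y: "\<bar>y - x\<bar> \<le> d" for y
  proof -
    have fy: "\<bar>f y - f x\<bar> \<le> L1 * \<bar>y - x\<bar>" using 1(3) y by (simp add: d_def)
    also have "\<dots> \<le> L1 * (d2 / (L1 + 1))" using y 1(1) by (intro mult_left_mono) (auto simp: d_def)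
    also have "\<dots> \<le> d2" using 1(1) 2(2) by (simp add: field_simps)
    finally have "\<bar>g (f y) - g (f x)\<bar> \<le> L2 * \<bar>f y - f x\<bar>" by (rule 2(3))
    also have "\<dots> \<le> L2 * (L1 * \<bar>y - x\<bar>)" using 2(1) fy by (rule mult_left_mono[rotated])
    finally show ?thesis by (simp add: mult.assoc)
  qed
  then show ?thesis unfolding lipschitz_at_def using d 1(1) 2(1) by (intro exI[of _ "L2 * L1"] conjI exI[of _ d]) auto
qed

lemma lipschitz_at_mult:
  assumes "lipschitz_at f x" "lipschitz_at g x"
  shows "lipschitz_at (\<lambda>y. f y * g y) x"
proof -
  from assms(1) obtain L1 d1 where 1: "0 \<le> L1" "0 < d1" "\<And>y. \<bar>y - x\<bar> \<le> d1 \<Longrightarrow> \<bar>f y - f x\<bar> \<le> L1 * \<bar>y - x\<bar>"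
    by (auto simp: lipschitz_at_def)
  from assms(2) obtain L2 d2 where 2: "0 \<le> L2" "0 < d2" "\<And>y. \<bar>y - x\<bar> \<le> d2 \<Longrightarrow> \<bar>g y - g x\<bar> \<le> L2 * \<bar>y - x\<bar>"
    by (auto simp: lipschitz_at_def)
  define d where "d = min d1 d2"
  have d: "0 < d" using 1 2 by (simp add: d_def)
  let ?L = "L1 * (\<bar>g x\<bar> + L2 * d) + \<bar>f x\<bar> * L2"
  have "\<bar>f y * g y - f x * g x\<bar> \<le> ?L * \<bar>y - x\<bar>" if y: "\<bar>y - x\<bar> \<le> d" for y
  proof -
    have fy: "\<bar>f y - f x\<bar> \<le> L1 * \<bar>y - x\<bar>" and gy: "\<bar>g y - g x\<bar> \<le> L2 * \<bar>y - x\<bar>"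
      using 1(3) 2(3) y by (auto simp: d_def)
    have "\<bar>g y - g x\<bar> \<le> L2 * d" using gy mult_left_mono[OF y 2(1)] by linarith
    then have gb: "\<bar>g y\<bar> \<le> \<bar>g x\<bar> + L2 * d" by linarith
    have "f y * g y - f x * g x = (f y - f x) * g y + f x * (g y - g x)" by (simp add: algebra_simps)
    also have "\<bar>\<dots>\<bar> \<le> \<bar>f y - f x\<bar> * \<bar>g y\<bar> + \<bar>f x\<bar> * \<bar>g y - g x\<bar>"
      by (rule order_trans[OF abs_triangle_ineq]) (simp add: abs_mult)
    also have "\<dots> \<le> (L1 * \<bar>y - x\<bar>) * (\<bar>g x\<bar> + L2 * d) + \<bar>f x\<bar> * (L2 * \<bar>y - x\<bar>)"
      using fy gy gb 1 2 by (intro add_mono mult_mono) auto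
    finally show ?thesis by (simp add: algebra_simps)
  qed
  moreover have "0 \<le> ?L" using 1 2 d by (intro add_nonneg_nonneg mult_nonneg_nonneg) auto
  ultimately show ?thesis unfolding lipschitz_at_def using d by blast
qed

lemma lipschitz_at_DERIV:
  assumes "(f has_real_derivative D) (at x)"
  shows "lipschitz_at f x"
proof -
  from assms have "(f has_derivative (\<lambda>h. D * h)) (at x)" by (simp add: has_field_derivative_def)
  then obtain d where d: "0 < d" "\<And>y. norm (y - x) < d \<Longrightarrow> norm (f y - f x - D * (y - x)) \<le> 1 * norm (y - x)"
    unfolding has_derivative_at_alt by (metis zero_less_one)
  have "\<bar>f y - f x\<bar> \<le> (\<bar>D\<bar> + 1) * \<bar>y - x\<bar>" if "\<bar>y - x\<bar> \<le> d / 2" for y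
  proof -
    have "\<bar>f y - f x - D * (y - x)\<bar> \<le> \<bar>y - x\<bar>" using d that by simp
    then have "\<bar>f y - f x\<bar> \<le> \<bar>y - x\<bar> + \<bar>D * (y - x)\<bar>" by linarith
    then show ?thesis by (simp only: abs_mult distrib_right mult_1_left add.commute)
  qed
  then show ?thesis unfolding lipschitz_at_def using d(1) by (intro exI[of _ "\<bar>D\<bar> + 1"] conjI exI[of _ "d / 2"]) auto
qed

lemma lipschitz_at_add:
  assumes "lipschitz_at f x" "lipschitz_at g x"
  shows "lipschitz_at (\<lambda>y. f y + g y) x"
proof -
  from assms(1) obtain L1 d1 where 1: "0 \<le> L1" "0 < d1" "\<And>y. \<bar>y - x\<bar> \<le> d1 \<Longrightarrow> \<bar>f y - f x\<bar> \<le> L1 * \<bar>y - x\<bar>"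
    by (auto simp: lipschitz_at_def)
  from assms(2) obtain L2 d2 where 2: "0 \<le> L2" "0 < d2" "\<And>y. \<bar>y - x\<bar> \<le> d2 \<Longrightarrow> \<bar>g y - g x\<bar> \<le> L2 * \<bar>y - x\<bar>"
    by (auto simp: lipschitz_at_def)
  have "\<bar>f y + g y - (f x + g x)\<bar> \<le> (L1 + L2) * \<bar>y - x\<bar>" if "\<bar>y - x\<bar> \<le> min d1 d2" for y
    using 1(3)[of y] 2(3)[of y] that by (simp add: distrib_right)
  then show ?thesis unfolding lipschitz_at_def using 1 2
    by (intro exI[of _ "L1 + L2"] conjI exI[of _ "min d1 d2"]) auto
qed

definition scale_factor :: "real \<Rightarrow> real" where
  "scale_factor r = C_stable r powr (1 / r)"

text \<open>By \<open>C_stable_eq\<close> the factor is \<open>exp\<close> of a product of Lipschitz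
  functions, but only for \<open>s\<close> in (0, 2); the radius is cut down to stay there.\<close>

lemma scale_factor_lipschitz:
  assumes r: "0 < r" "r < 2"
  shows "lipschitz_at scale_factor r"
proof -
  have K: "0 < stable_const r" by (rule stable_const_pos[OF r])
  have eq: "scale_factor s = exp (- (1 / s) * ln (stable_const s))" if "0 < s" "s < 2" for s
    using stable_const_pos[OF that] C_stable_eq[OF that] that
    by (simp add: scale_factor_def powr_def ln_inverse)
  have "lipschitz_at stable_const r"
    using stable_const_lipschitz[OF r] unfolding lipschitz_at_def by (metis order.refl)
  then have "lipschitz_at (\<lambda>s. ln (stable_const s)) r"
    by (rule lipschitz_at_compose) (rule lipschitz_at_DERIV[OF DERIV_ln[OF K]])
  moreover have "lipschitz_at (\<lambda>s. - (1 / s)) r"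
    by (rule lipschitz_at_DERIV[where D = "1 / r\<^sup>2"])
       (use r in \<open>auto intro!: derivative_eq_intros simp: power2_eq_square field_simps\<close>)
  ultimately have "lipschitz_at (\<lambda>s. - (1 / s) * ln (stable_const s)) r" by (intro lipschitz_at_mult)
  then have "lipschitz_at (\<lambda>s. exp (- (1 / s) * ln (stable_const s))) r"
    by (rule lipschitz_at_compose) (rule lipschitz_at_DERIV[OF DERIV_exp])
  then obtain L d where L: "0 \<le> L" "0 < d" "\<And>s. \<bar>s - r\<bar> \<le> d \<Longrightarrow>
      \<bar>exp (- (1 / s) * ln (stable_const s)) - exp (- (1 / r) * ln (stable_const r))\<bar> \<le> L * \<bar>s - r\<bar>"
    by (auto simp: lipschitz_at_def)
  define d' where "d' = min d (min r (2 - r) / 2)"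
  have "\<bar>scale_factor s - scale_factor r\<bar> \<le> L * \<bar>s - r\<bar>" if "\<bar>s - r\<bar> \<le> d'" for s
  proof -
    have "\<bar>s - r\<bar> \<le> min r (2 - r) / 2" "\<bar>s - r\<bar> \<le> d" using that by (auto simp: d'_def)
    moreover from this(1) have "\<bar>s - r\<bar> \<le> r / 2" "\<bar>s - r\<bar> \<le> (2 - r) / 2"
      by (auto simp: min_def split: if_splits)
    then have "r / 2 \<le> s" "s \<le> r + (2 - r) / 2" by (simp_all only: abs_le_iff) linarith+
    ultimately have "0 < s" "s < 2" "\<bar>s - r\<bar> \<le> d" using r by (auto simp: field_simps)
    then show ?thesis using L(3)[OF \<open>\<bar>s - r\<bar> \<le> d\<close>] eq r by simp
  qed
  moreover have "0 < d'" using L r by (simp add: d'_def)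
  ultimately show ?thesis unfolding lipschitz_at_def using L(1) by blast
qed

text \<open>The purpose of the factor \<open>C_stable\<close> in the field: it removes
  \<open>stable_const\<close> from the characteristic exponent.\<close>

lemma scale_factor_powr:
  assumes r: "0 < r" "r < 2"
  shows "0 < scale_factor r" "scale_factor r powr r * stable_const r = 1"
  using stable_const_pos[OF r] C_stable_eq[OF r] r by (auto simp: scale_factor_def powr_powr)

text \<open>At \<open>p = 1 / b\<close> and \<open>\<delta> = 0\<close> all the inequalities but \<open>1 < p * (b - \<delta>)\<close> are strict, so there is room to increase
  \<open>p\<close> and then \<open>\<delta>\<close>.\<close>

lemma admissible_exponents:
  fixes b h \<eta> :: real
  assumes h: "0 < h" "h < 1" and b: "1 / 2 < b" and e: "0 < \<eta>" "\<eta> * b < 1"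
  obtains p \<delta> where "1 / b < p" "p \<le> 2" "0 < \<delta>" "(h - b) + \<delta> < 1" "p * (\<delta> - (h - b)) < 1"
    "0 \<le> p * (b + \<delta>) - 1" "2 * (p * (b + \<delta>) - 1) + p * ((h - b) - 1 + \<delta>) < - 1"
    "\<eta> * (b + \<delta>) < 1" "1 < p * (b - \<delta>)"
proof -
  have ev1: "\<forall>\<^sub>F p in at_right (1 / b). p < 2"
    using b by (intro order_tendstoD(2)[OF tendsto_ident_at]) (simp add: field_simps)
  \<comment> \<open>In the limit \<open>p = 1 / b\<close> this condition becomes
    \<open>0 < h\<close>.\<close>
  have ev2: "\<forall>\<^sub>F p in at_right (1 / b). p * - (h - b) < 1"
  proof (rule order_tendstoD(2))
    show "((\<lambda>p. p * - (h - b)) \<longlongrightarrow> 1 / b * - (h - b)) (at_right (1 / b))" by (intro tendsto_intros)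
    show "1 / b * - (h - b) < 1" using h b by (simp add: field_simps)
  qed
  \<comment> \<open>The decay condition at infinity for \<open>\<delta> = 0\<close>; in the limit
    \<open>p = 1 / b\<close> it becomes \<open>h < 1\<close>.\<close>
  have ev3: "\<forall>\<^sub>F p in at_right (1 / b). p * (h + b - 1) < 1"
  proof (rule order_tendstoD(2))
    show "((\<lambda>p. p * (h + b - 1)) \<longlongrightarrow> 1 / b * (h + b - 1)) (at_right (1 / b))" by (intro tendsto_intros)
    show "1 / b * (h + b - 1) < 1" using h b by (simp add: field_simps)
  qed
  have ev4: "\<forall>\<^sub>F p in at_right (1 / b). 1 / b < p" by (simp add: eventually_at_right_less)
  from eventually_happens[OF eventually_conj[OF ev1 eventually_conj[OF ev2 eventually_conj[OF ev3 ev4]]]]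
  obtain p where p: "p < 2" "p * - (h - b) < 1" "p * (h + b - 1) < 1" "1 / b < p"
    by (auto simp: trivial_limit_at_right_real)
  have pb: "1 < p * b" using p(4) b by (simp add: field_simps)
  have p0: "0 < p" using p(4) b by (meson less_trans zero_less_divide_1_iff half_gt_zero_iff zero_less_one)
  have t: "\<forall>\<^sub>F d in at_right 0. c + k * d < 1" if "c < 1" for c k :: real
  proof (rule order_tendstoD(2))
    show "((\<lambda>d. c + k * d) \<longlongrightarrow> c + k * 0) (at_right 0)" by (intro tendsto_intros)
  qed (use that in simp)
  have hb: "h - b < 1" using h b by simp
  \<comment> \<open>The required conditions as affine functions of \<open>d\<close>;
    \<open>3 * p * d\<close> collects twice the exponent of the weight and once that of the
    envelope.\<close>
  have ev: "\<forall>\<^sub>F d in at_right (0::real). 0 < d \<and> (h - b) + 1 * d < 1 \<and> p * - (h - b) + p * d < 1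
      \<and> p * (h + b - 1) + 3 * p * d < 1 \<and> \<eta> * b + \<eta> * d < 1 \<and> (2 - p * b) + p * d < 1"
    by (intro eventually_conj t eventually_at_right_less p hb e) (use pb in simp)
  from eventually_happens[OF ev] obtain d where d: "0 < d" "(h - b) + 1 * d < 1" "p * - (h - b) + p * d < 1"
      "p * (h + b - 1) + 3 * p * d < 1" "\<eta> * b + \<eta> * d < 1" "(2 - p * b) + p * d < 1"
    by (auto simp: trivial_limit_at_right_real)
  have "0 \<le> p * d" using p0 d by simp
  then have "0 \<le> p * (b + d) - 1" using pb by (simp only: distrib_left)
  with p d pb show thesis by (intro that[of p d]) (auto simp: algebra_simps)
qed

section \<open>LePage series with the kernel of the motion\<close>

locale lmmm_series = lepage M T V \<gamma> "density lborel (\<lambda>v. ennreal (m_hat_density v))"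
  for M :: "'a measure" and T V \<gamma>
begin

text \<open>Position and both exponents are independent parameters, so that the position can move
  with frozen exponents and the exponents can change at a fixed position.\<close>

definition kern :: "real \<Rightarrow> real \<Rightarrow> real \<Rightarrow> real \<times> real \<Rightarrow> real" where
  "kern s \<beta> \<kappa> = (\<lambda>(x, v). x powr - \<beta> * (weight v powr \<beta> * increment \<kappa> s v))"

lemma kern_measurable [measurable]: "kern s \<beta> \<kappa> \<in> borel_measurable (borel \<Otimes>\<^sub>M borel)"
  unfolding kern_def by measurable

lemma m_hat_measurable [measurable]: "m_hat_density \<in> borel_measurable borel"
  unfolding m_hat_density_eq[abs_def] by measurable

lemma nn_integral_\<nu>:
  assumes [measurable]: "g \<in> borel_measurable borel"
  shows "(\<integral>\<^sup>+v. ennreal (g v) \<partial>density lborel (\<lambda>v. ennreal (m_hat_density v))) = (\<integral>\<^sup>+v. ennreal (g v / weight v) \<partial>lborel)"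
proof -
  have "(\<integral>\<^sup>+v. ennreal (g v) \<partial>density lborel (\<lambda>v. ennreal (m_hat_density v)))
      = (\<integral>\<^sup>+v. ennreal (m_hat_density v) * ennreal (g v) \<partial>lborel)"
    by (rule nn_integral_density) measurable
  also have "\<dots> = (\<integral>\<^sup>+v. ennreal (g v / weight v) \<partial>lborel)"
    using weight_pos by (intro nn_integral_cong) (simp add: m_hat_density_eq ennreal_mult'[symmetric] less_imp_le)
  finally show ?thesis .
qed

lemma lmmm_field_eq:
  assumes "\<And>i. \<Gamma> i \<omega> = arrival i \<omega>"
  shows "lmmm_field \<alpha> H \<Gamma> V \<gamma> s u \<omega>
    = scale_factor (\<alpha> u) * series (kern s (1 / \<alpha> u) (H u - 1 / \<alpha> u)) \<omega>"
proof -
  have "(\<Sum>j. (pi\<^sup>2 * (real (Suc j))\<^sup>2 / 3) powr (1 / \<alpha> u) * \<gamma> i \<omega> * \<Gamma> i \<omega> powr (- 1 / \<alpha> u) *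
       (\<bar>s - V i \<omega>\<bar> powr (H u - 1 / \<alpha> u) - \<bar>V i \<omega>\<bar> powr (H u - 1 / \<alpha> u)) * indicator (cell j) (V i \<omega>))
     = \<gamma> i \<omega> * kern s (1 / \<alpha> u) (H u - 1 / \<alpha> u) (arrival i \<omega>, V i \<omega>)" for i
    using suminf_cell[of "\<lambda>y. (pi\<^sup>2 * y\<^sup>2 / 3) powr (1 / \<alpha> u) * \<gamma> i \<omega> * \<Gamma> i \<omega> powr (- 1 / \<alpha> u) *
       (\<bar>s - V i \<omega>\<bar> powr (H u - 1 / \<alpha> u) - \<bar>V i \<omega>\<bar> powr (H u - 1 / \<alpha> u))" "V i \<omega>"] assms
    by (simp add: kern_def weight_def increment_def mult_ac)
  then show ?thesis unfolding lmmm_field_def series_def scale_factor_def by simp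
qed

text \<open>Arrival time and weight enter only through their quotient, so a change of
  \<open>\<beta>\<close> alters the exponent of a single base.\<close>

lemma kern_scaled:
  assumes "0 < x"
  shows "kern s \<beta> \<kappa> (x, v) = (x / weight v) powr - \<beta> * increment \<kappa> s v"
  using assms weight_pos[of v] by (simp add: kern_def powr_divide powr_minus field_simps)

text \<open>A product rule: the change of \<open>\<beta>\<close> is paired with the bound for the
  increment, the change of \<open>\<kappa>\<close> with the bound for the power of the
  quotient.\<close>

lemma kern_le:
  assumes x: "0 < x" and d: "0 < \<delta>" and kd: "\<kappa> + \<delta> < 1" and A: "1 \<le> A" and s: "\<bar>s\<bar> \<le> A"
    and k: "\<bar>\<kappa>' - \<kappa>\<bar> \<le> \<delta> / 2" and b: "\<bar>\<beta> - b\<bar> \<le> \<delta> / 2"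
  defines "E \<equiv> \<lambda>v. two_powers (- b) \<delta> (x / weight v) * envelope \<kappa> \<delta> A s v"
  shows "\<bar>kern s \<beta> \<kappa>' (x, v)\<bar> \<le> envelope_const \<kappa> \<delta> A * E v"
    and "\<bar>kern s \<beta> \<kappa>' (x, v) - kern s b \<kappa> (x, v)\<bar>
      \<le> (envelope_const \<kappa> \<delta> A * (\<bar>\<beta> - b\<bar> * (2 / \<delta>) + \<bar>\<kappa>' - \<kappa>\<bar>)) * E v"
proof -
  let ?c = "envelope_const \<kappa> \<delta> A" and ?z = "x / weight v"
  let ?e = "envelope \<kappa> \<delta> A s v" and ?t = "two_powers (- b) \<delta> (x / weight v)"
  have z: "0 \<le> ?z" using x weight_pos[of v] by simp
  have b': "\<bar>- \<beta> - - b\<bar> \<le> \<delta> / 2" using b by (simp add: abs_minus_commute)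
  have b0: "\<bar>- b - - b\<bar> \<le> \<delta> / 2" using d by simp
  note T1 = two_powers_bounds[OF z d b'] and T0 = two_powers_bounds(1)[OF z d b0]
  note I = increment_le_envelope[OF d kd A s k, of v]
  have "\<bar>kern s \<beta> \<kappa>' (x, v)\<bar> = ?z powr - \<beta> * \<bar>increment \<kappa>' s v\<bar>"
    using x by (simp add: kern_scaled abs_mult)
  also have "\<dots> \<le> ?t * (?c * ?e)" using T1(1) I(1) by (intro mult_mono two_powers_nonneg) auto
  finally show "\<bar>kern s \<beta> \<kappa>' (x, v)\<bar> \<le> ?c * E v" by (simp add: E_def mult_ac)
  have "kern s \<beta> \<kappa>' (x, v) - kern s b \<kappa> (x, v)
      = (?z powr - \<beta> - ?z powr - b) * increment \<kappa>' s v + ?z powr - b * (increment \<kappa>' s v - increment \<kappa> s v)"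
    using x by (simp add: kern_scaled algebra_simps)
  also have "\<bar>\<dots>\<bar> \<le> \<bar>?z powr - \<beta> - ?z powr - b\<bar> * \<bar>increment \<kappa>' s v\<bar>
      + ?z powr - b * \<bar>increment \<kappa>' s v - increment \<kappa> s v\<bar>"
    by (rule order_trans[OF abs_triangle_ineq]) (simp add: abs_mult)
  also have "\<dots> \<le> (\<bar>- \<beta> - - b\<bar> * (2 / \<delta> * ?t)) * (?c * ?e) + ?t * (\<bar>\<kappa>' - \<kappa>\<bar> * (?c * ?e))"
    using T1(2) T0 I d two_powers_nonneg[of "- b" \<delta> ?z]
    by (intro add_mono mult_mono two_powers_nonneg mult_nonneg_nonneg) auto
  also have "\<bar>- \<beta> - - b\<bar> = \<bar>\<beta> - b\<bar>" by (simp add: abs_minus_commute)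
  finally show "\<bar>kern s \<beta> \<kappa>' (x, v) - kern s b \<kappa> (x, v)\<bar> \<le> (?c * (\<bar>\<beta> - b\<bar> * (2 / \<delta>) + \<bar>\<kappa>' - \<kappa>\<bar>)) * E v"
    by (simp add: E_def algebra_simps)
qed

text \<open>The coefficient \<open>a\<close> and the scale \<open>q\<close> are arbitrary because
  the bound is used for the kernels themselves and for the difference of kernels with changed
  exponents, where \<open>q\<close> is proportional to \<open>\<epsilon>\<close>; the factor
  \<open>q powr \<eta>\<close> is then the desired order. The last conclusion serves to show that
  the reference increment has finite norm.\<close>

lemma series_envelope_bound:
  assumes e: "0 < \<eta>" "\<eta> \<le> p" "p \<le> 2" and d: "0 < \<delta>" and near: "p * (\<delta> - \<kappa>) < 1"
    and q: "0 \<le> p * (b + \<delta>) - 1" and far: "2 * (p * (b + \<delta>) - 1) + p * (\<kappa> - 1 + \<delta>) < - 1"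
    and small: "\<eta> * (b + \<delta>) < 1" and large: "1 < p * (b - \<delta>)" and A: "1 \<le> A"
  obtains C where "0 \<le> C"
    "\<forall>a s q. a \<in> borel_measurable (borel \<Otimes>\<^sub>M borel) \<longrightarrow> \<bar>s\<bar> \<le> A \<longrightarrow> 0 < q \<longrightarrow>
      (\<forall>x v. 0 < x \<longrightarrow> \<bar>a (x, v)\<bar> \<le> q * (two_powers (- b) \<delta> (x / weight v) * envelope \<kappa> \<delta> A s v)) \<longrightarrow>
      series_converges a \<and> (\<integral>\<^sup>+\<omega>. ennreal (\<bar>series a \<omega>\<bar> powr \<eta>) \<partial>M) \<le> ennreal (C * q powr \<eta>)"
    "\<forall>s. \<bar>s\<bar> \<le> A \<longrightarrow> (\<integral>\<^sup>+v. ennreal ((weight v powr b * envelope \<kappa> \<delta> A s v) powr p) \<partial>density lborel (\<lambda>v. ennreal (m_hat_density v))) < \<infinity>"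
proof -
  let ?\<nu> = "density lborel (\<lambda>v. ennreal (m_hat_density v))"
  have p0: "0 < p" using e by simp
  obtain m where m: "0 \<le> m" "\<And>s. \<bar>s\<bar> \<le> A \<Longrightarrow>
      (\<integral>\<^sup>+v. ennreal (weight v powr (p * (b + \<delta>) - 1) * envelope \<kappa> \<delta> A s v powr p) \<partial>lborel) \<le> ennreal m"
    using envelope_moment_bound[OF p0 e(3) near d q far A] by blast
  \<comment> \<open>The 2 arises from bounding both powers of \<open>two_powers\<close> by the worse
    one; as the weight is at least 1, its exponent \<open>b + \<delta>\<close> covers both.\<close>
  define h where "h s v = 2 * (weight v powr (b + \<delta>) * envelope \<kappa> \<delta> A s v)" for s v
  have [measurable]: "h s \<in> borel_measurable borel" for s unfolding h_def[abs_def] by measurable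
  have hm: "(\<integral>\<^sup>+v. ennreal (h s v powr p) \<partial>?\<nu>) \<le> ennreal (4 * m)" if "\<bar>s\<bar> \<le> A" for s
  proof -
    have "(\<integral>\<^sup>+v. ennreal (h s v powr p) \<partial>?\<nu>) = (\<integral>\<^sup>+v. ennreal (h s v powr p / weight v) \<partial>lborel)"
      by (rule nn_integral_\<nu>) measurable
    also have "\<dots> \<le> (\<integral>\<^sup>+v. ennreal 4 * ennreal (weight v powr (p * (b + \<delta>) - 1) * envelope \<kappa> \<delta> A s v powr p) \<partial>lborel)"
    proof (rule nn_integral_mono)
      fix v
      \<comment> \<open>The density, the reciprocal of the weight, lowers the exponent of the weight
        by 1.\<close>
      have w: "weight v powr (p * (b + \<delta>) - 1) = weight v powr ((b + \<delta>) * p) / weight v"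
        using weight_pos[of v] by (simp add: powr_diff mult.commute)
      have "h s v powr p / weight v = 2 powr p * (weight v powr (p * (b + \<delta>) - 1) * envelope \<kappa> \<delta> A s v powr p)"
        unfolding h_def w by (simp add: powr_mult powr_powr envelope_nonneg)
      also have "\<dots> \<le> 2 powr 2 * (weight v powr (p * (b + \<delta>) - 1) * envelope \<kappa> \<delta> A s v powr p)"
        using e by (intro mult_right_mono powr_mono) auto
      finally show "ennreal (h s v powr p / weight v)
          \<le> ennreal 4 * ennreal (weight v powr (p * (b + \<delta>) - 1) * envelope \<kappa> \<delta> A s v powr p)"
        by (subst ennreal_mult[symmetric]) (auto intro!: ennreal_leI)
    qed
    also have "\<dots> = ennreal 4 * (\<integral>\<^sup>+v. ennreal (weight v powr (p * (b + \<delta>) - 1) * envelope \<kappa> \<delta> A s v powr p) \<partial>lborel)"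
      by (rule nn_integral_cmult) measurable
    also have "\<dots> \<le> ennreal 4 * ennreal m" by (intro mult_left_mono m(2) that) simp
    also have "\<dots> = ennreal (4 * m)" using m by (intro ennreal_mult[symmetric]) auto
    finally show ?thesis .
  qed
  define C where "C = 4 * (1 + 4 * m) * (1 / (1 - \<eta> * (b + \<delta>)) + 1 + 1 / (p * (b - \<delta>) - 1))"
  show thesis
  proof (rule that)
    show C0: "0 \<le> C" unfolding C_def using m small large by (intro mult_nonneg_nonneg add_nonneg_nonneg) auto
    show "\<forall>a s q. a \<in> borel_measurable (borel \<Otimes>\<^sub>M borel) \<longrightarrow> \<bar>s\<bar> \<le> A \<longrightarrow> 0 < q \<longrightarrow>
      (\<forall>x v. 0 < x \<longrightarrow> \<bar>a (x, v)\<bar> \<le> q * (two_powers (- b) \<delta> (x / weight v) * envelope \<kappa> \<delta> A s v)) \<longrightarrow>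
      series_converges a \<and> (\<integral>\<^sup>+\<omega>. ennreal (\<bar>series a \<omega>\<bar> powr \<eta>) \<partial>M) \<le> ennreal (C * q powr \<eta>)"
    proof (intro allI impI)
      fix a :: "real \<times> real \<Rightarrow> real" and s q :: real
      assume am[measurable]: "a \<in> borel_measurable (borel \<Otimes>\<^sub>M borel)" and s: "\<bar>s\<bar> \<le> A" and q: "0 < q"
        and bound: "\<forall>x v. 0 < x \<longrightarrow> \<bar>a (x, v)\<bar> \<le> q * (two_powers (- b) \<delta> (x / weight v) * envelope \<kappa> \<delta> A s v)"
      \<comment> \<open>Normalising to \<open>q = 1\<close> keeps the constant \<open>C\<close>
        independent of \<open>q\<close>.\<close>
      define a' where "a' z = (1 / q) * a z" for z
      have [measurable]: "a' \<in> borel_measurable (borel \<Otimes>\<^sub>M borel)" unfolding a'_def[abs_def] by measurable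
      have a'_le: "\<bar>a' (x, v)\<bar> \<le> two_powers (- b) \<delta> (x / weight v) * envelope \<kappa> \<delta> A s v" if "0 < x" for x v
        using bound[rule_format, OF that, of v] q by (simp add: a'_def abs_mult field_simps)
      have tp: "two_powers (- b) \<delta> (x / weight v) = x powr - (b + \<delta>) * weight v powr (b + \<delta>)
          + x powr - (b - \<delta>) * weight v powr (b - \<delta>)" if "0 < x" for x v
      proof -
        have r: "(x / weight v) powr - c = x powr - c * weight v powr c" for c
          using that weight_pos[of v] by (simp add: powr_divide powr_minus field_simps)
        have "two_powers (- b) \<delta> (x / weight v) = (x / weight v) powr - (b + \<delta>) + (x / weight v) powr - (b - \<delta>)"
          by (simp add: two_powers_def)
        then show ?thesis by (simp only: r)
      qed
      have wle: "weight v powr (b - \<delta>) \<le> weight v powr (b + \<delta>)" for v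
        using weight_bounds(1)[of v] d by (intro powr_mono) auto
      \<comment> \<open>Below 1 the steeper power of \<open>x\<close> dominates, from 1 on the
        flatter one; these give the exponents \<open>b + \<delta>\<close> and
        \<open>b - \<delta>\<close> of the two ranges in the moment bound.\<close>
      have aS: "\<bar>a' (x, v)\<bar> \<le> h s v * x powr - (b + \<delta>)" if x: "0 < x" "x < 1" for x v
      proof -
        have "x powr - (b - \<delta>) \<le> x powr - (b + \<delta>)" using x d by (intro powr_mono') auto
        then have "two_powers (- b) \<delta> (x / weight v) \<le> x powr - (b + \<delta>) * weight v powr (b + \<delta>)
            + x powr - (b + \<delta>) * weight v powr (b + \<delta>)"
          unfolding tp[OF x(1)] using wle by (intro add_mono mult_mono) auto
        then have "two_powers (- b) \<delta> (x / weight v) * envelope \<kappa> \<delta> A s v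
            \<le> (x powr - (b + \<delta>) * weight v powr (b + \<delta>) + x powr - (b + \<delta>) * weight v powr (b + \<delta>)) * envelope \<kappa> \<delta> A s v"
          by (rule mult_right_mono) (rule envelope_nonneg)
        with a'_le[OF x(1), of v] show ?thesis by (simp add: h_def algebra_simps)
      qed
      have aL: "\<bar>a' (x, v)\<bar> \<le> h s v * x powr - (b - \<delta>)" if x: "1 \<le> x" for x v
      proof -
        have x0: "0 < x" using x by simp
        have "x powr - (b + \<delta>) \<le> x powr - (b - \<delta>)" using x d by (intro powr_mono) auto
        then have "two_powers (- b) \<delta> (x / weight v) \<le> x powr - (b - \<delta>) * weight v powr (b + \<delta>)
            + x powr - (b - \<delta>) * weight v powr (b + \<delta>)"
          unfolding tp[OF x0] using wle by (intro add_mono mult_mono) auto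
        then have "two_powers (- b) \<delta> (x / weight v) * envelope \<kappa> \<delta> A s v
            \<le> (x powr - (b - \<delta>) * weight v powr (b + \<delta>) + x powr - (b - \<delta>) * weight v powr (b + \<delta>)) * envelope \<kappa> \<delta> A s v"
          by (rule mult_right_mono) (rule envelope_nonneg)
        with a'_le[OF x0, of v] show ?thesis by (simp add: h_def algebra_simps)
      qed
      have h0: "0 \<le> h s v" for v by (simp add: h_def envelope_nonneg)
      have m4: "0 \<le> 4 * m" using m by simp
      note bd = series_moment_bound[of a' "h s", OF _ _ h0 e small large aS aL hm[OF s] m4, folded C_def]
      have conv: "series_converges a'" by (rule bd(1)) auto
      have mom: "(\<integral>\<^sup>+\<omega>. ennreal (\<bar>series a' \<omega>\<bar> powr \<eta>) \<partial>M) \<le> ennreal C" by (rule bd(2)) auto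
      have a_eq: "(\<lambda>z. q * a' z) = a" using q by (auto simp: a'_def)
      have "(\<integral>\<^sup>+\<omega>. ennreal (\<bar>series a \<omega>\<bar> powr \<eta>) \<partial>M) = (\<integral>\<^sup>+\<omega>. ennreal (q powr \<eta>) * ennreal (\<bar>series a' \<omega>\<bar> powr \<eta>) \<partial>M)"
        by (rule nn_integral_cong_AE, rule AE_mp[OF series_scale(2)[OF conv, of q]])
           (use q in \<open>simp add: a_eq abs_mult powr_mult ennreal_mult\<close>)
      also have "\<dots> = ennreal (q powr \<eta>) * (\<integral>\<^sup>+\<omega>. ennreal (\<bar>series a' \<omega>\<bar> powr \<eta>) \<partial>M)"
        by (rule nn_integral_cmult) measurable
      also have "\<dots> \<le> ennreal (q powr \<eta>) * ennreal C" by (intro mult_left_mono mom) simp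
      also have "\<dots> = ennreal (C * q powr \<eta>)" using C0 by (simp add: ennreal_mult[symmetric] mult.commute)
      finally show "series_converges a \<and> (\<integral>\<^sup>+\<omega>. ennreal (\<bar>series a \<omega>\<bar> powr \<eta>) \<partial>M) \<le> ennreal (C * q powr \<eta>)"
        using series_scale(1)[OF conv, of q] by (simp add: a_eq)
    qed
    show "\<forall>s. \<bar>s\<bar> \<le> A \<longrightarrow> (\<integral>\<^sup>+v. ennreal ((weight v powr b * envelope \<kappa> \<delta> A s v) powr p) \<partial>?\<nu>) < \<infinity>"
    proof (intro allI impI)
      fix s assume s: "\<bar>s\<bar> \<le> A"
      have "(\<integral>\<^sup>+v. ennreal ((weight v powr b * envelope \<kappa> \<delta> A s v) powr p) \<partial>?\<nu>) \<le> (\<integral>\<^sup>+v. ennreal (h s v powr p) \<partial>?\<nu>)"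
      proof (intro nn_integral_mono ennreal_leI powr_mono2)
        fix v
        have "weight v powr b * envelope \<kappa> \<delta> A s v \<le> weight v powr (b + \<delta>) * envelope \<kappa> \<delta> A s v"
          using weight_bounds(1)[of v] d by (intro mult_right_mono powr_mono envelope_nonneg) auto
        also have "\<dots> \<le> h s v" by (simp add: h_def envelope_nonneg)
        finally show "weight v powr b * envelope \<kappa> \<delta> A s v \<le> h s v" .
      qed (use p0 in \<open>auto simp: envelope_nonneg\<close>)
      also have "\<dots> < \<infinity>" using hm[OF s] by (rule le_less_trans) simp
      finally show "(\<integral>\<^sup>+v. ennreal ((weight v powr b * envelope \<kappa> \<delta> A s v) powr p) \<partial>?\<nu>) < \<infinity>" .
    qed
  qed
qed

end

section \<open>The increment of the motion\<close>

text \<open>Either \<open>\<bar>y\<bar>\<close> is at most \<open>d * \<bar>x\<bar>\<close>, or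
  \<open>\<bar>x\<bar>\<close> is less than \<open>\<bar>y\<bar> / d\<close>. For small
  \<open>d\<close> the coefficient of the leading term is close to 1, for orders below and above 1
  alike, and the large coefficient falls on the negligible term.\<close>

lemma powr_abs_add_le_weighted:
  fixes x y e d :: real
  assumes e: "0 < e" and d: "0 < d"
  shows "\<bar>x + y\<bar> powr e \<le> (1 + d) powr e * \<bar>x\<bar> powr e + (1 + 1 / d) powr e * \<bar>y\<bar> powr e"
proof (cases "\<bar>y\<bar> \<le> d * \<bar>x\<bar>")
  case True
  then have "\<bar>x + y\<bar> \<le> (1 + d) * \<bar>x\<bar>" using abs_triangle_ineq[of x y] by (simp add: distrib_right)
  then have "\<bar>x + y\<bar> powr e \<le> ((1 + d) * \<bar>x\<bar>) powr e" using e by (intro powr_mono2) auto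
  also have "\<dots> = (1 + d) powr e * \<bar>x\<bar> powr e" by (rule powr_mult)
  finally show ?thesis by (simp add: add_increasing2)
next
  case False
  then have "\<bar>x\<bar> \<le> 1 / d * \<bar>y\<bar>" using d by (simp add: field_simps)
  then have "\<bar>x + y\<bar> \<le> (1 + 1 / d) * \<bar>y\<bar>" using abs_triangle_ineq[of x y] by (simp add: distrib_right)
  then have "\<bar>x + y\<bar> powr e \<le> ((1 + 1 / d) * \<bar>y\<bar>) powr e" using e by (intro powr_mono2) auto
  also have "\<dots> = (1 + 1 / d) powr e * \<bar>y\<bar> powr e" by (rule powr_mult)
  finally show ?thesis by (simp add: add_increasing)
qed

lemma nn_integral_powr_perturb:
  fixes A B Y :: "'b \<Rightarrow> real"
  assumes [measurable]: "A \<in> borel_measurable N" "B \<in> borel_measurable N" "Y \<in> borel_measurable N"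
    and Y: "AE \<omega> in N. Y \<omega> = A \<omega> + B \<omega>" and e: "0 < e" and d: "0 < d"
  shows "(\<integral>\<^sup>+\<omega>. ennreal (\<bar>Y \<omega>\<bar> powr e) \<partial>N) \<le> ennreal ((1 + d) powr e) * (\<integral>\<^sup>+\<omega>. ennreal (\<bar>A \<omega>\<bar> powr e) \<partial>N)
    + ennreal ((1 + 1 / d) powr e) * (\<integral>\<^sup>+\<omega>. ennreal (\<bar>B \<omega>\<bar> powr e) \<partial>N)"
proof -
  have "(\<integral>\<^sup>+\<omega>. ennreal (\<bar>Y \<omega>\<bar> powr e) \<partial>N) \<le> (\<integral>\<^sup>+\<omega>. ennreal ((1 + d) powr e) * ennreal (\<bar>A \<omega>\<bar> powr e)
      + ennreal ((1 + 1 / d) powr e) * ennreal (\<bar>B \<omega>\<bar> powr e) \<partial>N)"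
  proof (rule nn_integral_mono_AE, use Y in eventually_elim)
    case (elim \<omega>)
    then have "ennreal (\<bar>Y \<omega>\<bar> powr e) \<le> ennreal ((1 + d) powr e * \<bar>A \<omega>\<bar> powr e + (1 + 1 / d) powr e * \<bar>B \<omega>\<bar> powr e)"
      by (simp only: powr_abs_add_le_weighted[OF e d] ennreal_leI)
    then show ?case by (simp add: ennreal_mult)
  qed
  then show ?thesis by (simp add: nn_integral_add nn_integral_cmult)
qed

text \<open>Relative to the main term the error has the factor
  \<open>M / K * \<epsilon> powr (\<eta> * (1 - h))\<close>, which vanishes since
  \<open>h < 1\<close>. For a given tolerance, \<open>d\<close> is fixed so that
  \<open>(1 + d) powr \<eta>\<close> is close to 1, and only afterwards \<open>\<epsilon>\<close> is
  made small against \<open>(1 + 1 / d) powr \<eta>\<close>.\<close>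

lemma ratio_tendsto_one:
  fixes f :: "real \<Rightarrow> real"
  assumes K: "0 < K" and M: "0 \<le> M" and h: "h < 1" and e: "0 < \<eta>" and e0: "0 < \<epsilon>0"
    and up: "\<And>\<epsilon> d. 0 < \<epsilon> \<Longrightarrow> \<epsilon> < \<epsilon>0 \<Longrightarrow> 0 < d \<Longrightarrow>
      f \<epsilon> \<le> (1 + d) powr \<eta> * (K * \<epsilon> powr (\<eta> * h)) + (1 + 1 / d) powr \<eta> * (M * \<epsilon> powr \<eta>)"
    and lo: "\<And>\<epsilon> d. 0 < \<epsilon> \<Longrightarrow> \<epsilon> < \<epsilon>0 \<Longrightarrow> 0 < d \<Longrightarrow>
      K * \<epsilon> powr (\<eta> * h) \<le> (1 + d) powr \<eta> * f \<epsilon> + (1 + 1 / d) powr \<eta> * (M * \<epsilon> powr \<eta>)"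
  shows "((\<lambda>\<epsilon>. f \<epsilon> / (K * \<epsilon> powr (\<eta> * h))) \<longlongrightarrow> 1) (at_right 0)"
proof -
  define g where "g \<epsilon> = \<epsilon> powr (\<eta> * (1 - h))" for \<epsilon> :: real
  have g0: "(g \<longlongrightarrow> 0) (at_right 0)"
  proof -
    have "((\<lambda>\<epsilon>::real. \<epsilon> powr (\<eta> * (1 - h))) \<longlongrightarrow> 0 powr (\<eta> * (1 - h))) (at_right 0)"
      using e h by (intro tendsto_powr' tendsto_ident_at tendsto_const) (auto simp: eventually_at_filter)
    then show ?thesis by (simp add: g_def[abs_def])
  qed
  have g: "M * \<epsilon> powr \<eta> = (M / K * g \<epsilon>) * (K * \<epsilon> powr (\<eta> * h))" for \<epsilon>
  proof -
    have "\<epsilon> powr \<eta> = \<epsilon> powr (\<eta> * (1 - h)) * \<epsilon> powr (\<eta> * h)"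
      by (simp add: powr_add[symmetric] algebra_simps)
    then show ?thesis using K by (simp add: g_def)
  qed
  have alg: "(1 - x * y) / z * w = (w - x * (y * w)) / z" for x y z w :: real
    by (simp add: left_diff_distrib mult.assoc)
  have near: "\<forall>\<^sub>F \<epsilon> in at_right 0. 0 < \<epsilon> \<and> \<epsilon> < \<epsilon>0"
    using e0 by (auto simp: eventually_at_right_field)
  have d_lim: "((\<lambda>d::real. (1 + d) powr \<eta>) \<longlongrightarrow> (1 + 0) powr \<eta>) (at_right 0)"
    by (intro tendsto_intros) auto
  show ?thesis
  proof (rule order_tendstoI)
    fix a :: real assume a: "1 < a"
    have "\<forall>\<^sub>F d in at_right 0. (1 + d) powr \<eta> < a"
      using a by (intro order_tendstoD(2)[OF d_lim]) simp
    from eventually_happens[OF eventually_conj[OF this eventually_at_right_less[of 0]]]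
    obtain d where d: "(1 + d) powr \<eta> < a" "0 < d" by (auto simp: trivial_limit_at_right_real)
    have "((\<lambda>\<epsilon>. (1 + d) powr \<eta> + (1 + 1 / d) powr \<eta> * (M / K * g \<epsilon>)) \<longlongrightarrow>
        (1 + d) powr \<eta> + (1 + 1 / d) powr \<eta> * (M / K * 0)) (at_right 0)"
      by (intro tendsto_intros g0)
    then have "\<forall>\<^sub>F \<epsilon> in at_right 0. (1 + d) powr \<eta> + (1 + 1 / d) powr \<eta> * (M / K * g \<epsilon>) < a"
      using d by (intro order_tendstoD(2)) auto
    then show "\<forall>\<^sub>F \<epsilon> in at_right 0. f \<epsilon> / (K * \<epsilon> powr (\<eta> * h)) < a"
      using near
    proof eventually_elim
      case (elim \<epsilon>)
      have pos: "0 < K * \<epsilon> powr (\<eta> * h)" using elim K by simp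
      have "f \<epsilon> \<le> ((1 + d) powr \<eta> + (1 + 1 / d) powr \<eta> * (M / K * g \<epsilon>)) * (K * \<epsilon> powr (\<eta> * h))"
        using up[of \<epsilon> d] elim d unfolding g by (simp only: distrib_right mult.assoc)
      also have "\<dots> < a * (K * \<epsilon> powr (\<eta> * h))" using elim pos by (intro mult_strict_right_mono) auto
      finally show ?case using pos by (simp add: divide_less_eq)
    qed
  next
    fix a :: real assume a: "a < 1"
    have "((\<lambda>d::real. 1 / (1 + d) powr \<eta>) \<longlongrightarrow> 1 / (1 + 0) powr \<eta>) (at_right 0)"
      by (intro tendsto_divide d_lim tendsto_const) simp
    then have "\<forall>\<^sub>F d in at_right 0. a < 1 / (1 + d) powr \<eta>"
      using a by (intro order_tendstoD(1)) auto
    from eventually_happens[OF eventually_conj[OF this eventually_at_right_less[of 0]]]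
    obtain d where d: "a < 1 / (1 + d) powr \<eta>" "0 < d" by (auto simp: trivial_limit_at_right_real)
    have "((\<lambda>\<epsilon>. (1 - (1 + 1 / d) powr \<eta> * (M / K * g \<epsilon>)) / (1 + d) powr \<eta>) \<longlongrightarrow>
        (1 - (1 + 1 / d) powr \<eta> * (M / K * 0)) / (1 + d) powr \<eta>) (at_right 0)"
      using d by (intro tendsto_intros g0) auto
    then have "\<forall>\<^sub>F \<epsilon> in at_right 0. a < (1 - (1 + 1 / d) powr \<eta> * (M / K * g \<epsilon>)) / (1 + d) powr \<eta>"
      using d by (intro order_tendstoD(1)) auto
    then show "\<forall>\<^sub>F \<epsilon> in at_right 0. a < f \<epsilon> / (K * \<epsilon> powr (\<eta> * h))"
      using near
    proof eventually_elim
      case (elim \<epsilon>)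
      have pos: "0 < K * \<epsilon> powr (\<eta> * h)" using elim K by simp
      have dp: "0 < (1 + d) powr \<eta>" using d by simp
      have "a * (K * \<epsilon> powr (\<eta> * h))
          < (1 - (1 + 1 / d) powr \<eta> * (M / K * g \<epsilon>)) / (1 + d) powr \<eta> * (K * \<epsilon> powr (\<eta> * h))"
        using elim pos by (intro mult_strict_right_mono) auto
      also have "\<dots> = (K * \<epsilon> powr (\<eta> * h) - (1 + 1 / d) powr \<eta> * ((M / K * g \<epsilon>) * (K * \<epsilon> powr (\<eta> * h)))) / (1 + d) powr \<eta>"
        by (rule alg)
      also have "\<dots> \<le> ((1 + d) powr \<eta> * f \<epsilon>) / (1 + d) powr \<eta>"
        using lo[of \<epsilon> d] elim d dp unfolding g by (intro divide_right_mono) auto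
      also have "\<dots> = f \<epsilon>" using dp by simp
      finally show ?case using pos by (simp add: less_divide_eq)
    qed
  qed
qed

lemma envelope_const_pos: "0 < \<delta> \<Longrightarrow> 0 \<le> A \<Longrightarrow> 0 < envelope_const \<kappa> \<delta> A"
  unfolding envelope_const_def by (intro add_pos_nonneg mult_nonneg_nonneg add_nonneg_nonneg) auto

text \<open>The \<open>r\<close>-th power of the norm rather than the norm, as it enters the
  exponent of the characteristic function.\<close>

definition increment_norm :: "real \<Rightarrow> real \<Rightarrow> real" where
  "increment_norm \<kappa> r = (LBINT x. \<bar>\<bar>1 - x\<bar> powr \<kappa> - \<bar>x\<bar> powr \<kappa>\<bar> powr r)"

text \<open>The terms \<open>\<bar>v\<bar> powr \<kappa>\<close> cancel and the rest is homogeneous: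
  substituting \<open>v = t + (s - t) * x\<close> takes \<open>(s - t) powr \<kappa>\<close> out of
  the kernel and one factor \<open>s - t\<close> out of the measure.\<close>

lemma nn_integral_increment_scaled:
  fixes s t \<kappa> r :: real
  assumes "t < s"
  shows "(\<integral>\<^sup>+v. ennreal (\<bar>increment \<kappa> s v - increment \<kappa> t v\<bar> powr r) \<partial>lborel)
    = ennreal ((s - t) powr (1 + \<kappa> * r)) * (\<integral>\<^sup>+x. ennreal (\<bar>\<bar>1 - x\<bar> powr \<kappa> - \<bar>x\<bar> powr \<kappa>\<bar> powr r) \<partial>lborel)"
proof -
  define c where "c = s - t"
  have c: "0 < c" "s = t + c" using assms by (auto simp: c_def)
  have "(\<integral>\<^sup>+v. ennreal (\<bar>increment \<kappa> s v - increment \<kappa> t v\<bar> powr r) \<partial>lborel)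
      = ennreal \<bar>c\<bar> * (\<integral>\<^sup>+x. ennreal (\<bar>increment \<kappa> s (t + c * x) - increment \<kappa> t (t + c * x)\<bar> powr r) \<partial>lborel)"
    using c by (intro nn_integral_real_affine) auto
  also have "(\<integral>\<^sup>+x. ennreal (\<bar>increment \<kappa> s (t + c * x) - increment \<kappa> t (t + c * x)\<bar> powr r) \<partial>lborel)
      = (\<integral>\<^sup>+x. ennreal (c powr (\<kappa> * r)) * ennreal (\<bar>\<bar>1 - x\<bar> powr \<kappa> - \<bar>x\<bar> powr \<kappa>\<bar> powr r) \<partial>lborel)"
  proof (rule nn_integral_cong)
    fix x
    have "s - (t + c * x) = c * (1 - x)" "t - (t + c * x) = - (c * x)" using c by (auto simp: algebra_simps)
    then have "\<bar>s - (t + c * x)\<bar> = c * \<bar>1 - x\<bar>" "\<bar>t - (t + c * x)\<bar> = c * \<bar>x\<bar>" using c by (auto simp: abs_mult)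
    then have "increment \<kappa> s (t + c * x) - increment \<kappa> t (t + c * x) = c powr \<kappa> * (\<bar>1 - x\<bar> powr \<kappa> - \<bar>x\<bar> powr \<kappa>)"
      by (simp add: increment_def powr_mult right_diff_distrib)
    then have "\<bar>increment \<kappa> s (t + c * x) - increment \<kappa> t (t + c * x)\<bar> powr r
        = c powr (\<kappa> * r) * \<bar>\<bar>1 - x\<bar> powr \<kappa> - \<bar>x\<bar> powr \<kappa>\<bar> powr r"
      by (simp add: abs_mult powr_mult powr_powr)
    then show "ennreal (\<bar>increment \<kappa> s (t + c * x) - increment \<kappa> t (t + c * x)\<bar> powr r)
        = ennreal (c powr (\<kappa> * r)) * ennreal (\<bar>\<bar>1 - x\<bar> powr \<kappa> - \<bar>x\<bar> powr \<kappa>\<bar> powr r)"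
      by (simp add: ennreal_mult)
  qed
  also have "\<dots> = ennreal (c powr (\<kappa> * r)) * (\<integral>\<^sup>+x. ennreal (\<bar>\<bar>1 - x\<bar> powr \<kappa> - \<bar>x\<bar> powr \<kappa>\<bar> powr r) \<partial>lborel)"
    by (rule nn_integral_cmult) measurable
  also have "ennreal \<bar>c\<bar> * (ennreal (c powr (\<kappa> * r)) * X) = ennreal (c powr (1 + \<kappa> * r)) * X" for X
    using c by (simp add: mult.assoc[symmetric] ennreal_mult[symmetric] powr_add)
  finally show ?thesis by (simp add: c_def)
qed

context lmmm_series
begin

definition motion :: "(real \<Rightarrow> real) \<Rightarrow> (real \<Rightarrow> real) \<Rightarrow> real \<Rightarrow> 'a \<Rightarrow> real" where
  "motion \<alpha> H s \<omega> = scale_factor (\<alpha> s) * series (kern s (1 / \<alpha> s) (H s - 1 / \<alpha> s)) \<omega>"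

lemma motion_measurable [measurable]: "motion \<alpha> H s \<in> borel_measurable M"
  unfolding motion_def[abs_def] by measurable

theorem motion_increment_moment:
  assumes \<alpha>: "\<And>u. 0 < \<alpha> u" "\<And>u. \<alpha> u < 2" and H: "0 < H t" "H t < 1"
    and e: "0 < \<eta>" "\<eta> < \<alpha> t" and ne: "H t \<noteq> 1 / \<alpha> t"
    and lip: "lipschitz_at \<alpha> t" "lipschitz_at H t"
  shows "((\<lambda>\<epsilon>. expectation (\<lambda>\<omega>. \<bar>motion \<alpha> H (t + \<epsilon>) \<omega> - motion \<alpha> H t \<omega>\<bar> powr \<eta>) /
      (2 powr (\<eta> - 1) * Gamma (1 - \<eta> / \<alpha> t) / (\<eta> * sine_const \<eta>) *
        increment_norm (H t - 1 / \<alpha> t) (\<alpha> t) powr (\<eta> / \<alpha> t) * \<epsilon> powr (\<eta> * H t))) \<longlongrightarrow> 1) (at_right 0)"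
proof -
  let ?\<nu> = "density lborel (\<lambda>v. ennreal (m_hat_density v))"
  interpret \<nu>: prob_space ?\<nu> by (rule prob_space_\<nu>)
  define r where "r = \<alpha> t"
  define b where "b = 1 / \<alpha> t"
  define h where "h = H t"
  define \<kappa> where "\<kappa> = h - b"
  have r: "0 < r" "r < 2" "\<eta> < r" "b * r = 1" using \<alpha>[of t] e by (auto simp: r_def b_def)
  have b: "1 / 2 < b" "\<eta> * b < 1" "0 < b" using \<alpha>[of t] e by (auto simp: b_def field_simps)
  obtain p \<delta> where p: "1 / b < p" "p \<le> 2" and d: "0 < \<delta>" "\<kappa> + \<delta> < 1" and near: "p * (\<delta> - \<kappa>) < 1"
    and q: "0 \<le> p * (b + \<delta>) - 1" and far: "2 * (p * (b + \<delta>) - 1) + p * (\<kappa> - 1 + \<delta>) < - 1"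
    and small: "\<eta> * (b + \<delta>) < 1" and large: "1 < p * (b - \<delta>)"
    using admissible_exponents[of h b \<eta>] H b e unfolding \<kappa>_def h_def by metis
  have rp: "r \<le> p" using p(1) by (simp add: b_def r_def)
  then have ep: "\<eta> \<le> p" using r by simp
  \<comment> \<open>Room for \<open>t\<close>, for \<open>t + \<epsilon>\<close> with
    \<open>\<epsilon>\<close> up to 1, and for the position 1 of the reference increment.\<close>
  define A where "A = \<bar>t\<bar> + 1"
  have A: "1 \<le> A" "\<bar>t\<bar> \<le> A" "\<bar>1\<bar> \<le> A" by (auto simp: A_def)
  let ?c = "envelope_const \<kappa> \<delta> A"
  have c: "0 < ?c" using d A by (intro envelope_const_pos) auto
  obtain C where C0: "0 \<le> C" and C1:
    "\<forall>a s q. a \<in> borel_measurable (borel \<Otimes>\<^sub>M borel) \<longrightarrow> \<bar>s\<bar> \<le> A \<longrightarrow> 0 < q \<longrightarrow>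
      (\<forall>x v. 0 < x \<longrightarrow> \<bar>a (x, v)\<bar> \<le> q * (two_powers (- b) \<delta> (x / weight v) * envelope \<kappa> \<delta> A s v)) \<longrightarrow>
      series_converges a \<and> (\<integral>\<^sup>+\<omega>. ennreal (\<bar>series a \<omega>\<bar> powr \<eta>) \<partial>M) \<le> ennreal (C * q powr \<eta>)"
    and C2: "\<forall>s. \<bar>s\<bar> \<le> A \<longrightarrow> (\<integral>\<^sup>+v. ennreal ((weight v powr b * envelope \<kappa> \<delta> A s v) powr p) \<partial>?\<nu>) < \<infinity>"
    by (rule series_envelope_bound[OF e(1) ep p(2) d(1) near q far small large A(1)])
  note C = C0 C1[rule_format] C2[rule_format]

  \<comment> \<open>Since \<open>b * r = 1\<close>, the weight cancels the density of the marks and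
    the cells leave no trace in the norm.\<close>
  have stable_norm: "(\<integral>\<^sup>+v. ennreal (\<bar>weight v powr b * g v\<bar> powr r) \<partial>?\<nu>) = (\<integral>\<^sup>+v. ennreal (\<bar>g v\<bar> powr r) \<partial>lborel)"
    if [measurable]: "g \<in> borel_measurable borel" for g
  proof -
    have "\<bar>weight v powr b * g v\<bar> powr r / weight v = \<bar>g v\<bar> powr r" for v
      using weight_pos[of v] r by (simp add: abs_mult powr_mult powr_powr)
    then show ?thesis by (subst nn_integral_\<nu>) auto
  qed
  let ?F = "\<lambda>x. \<bar>\<bar>1 - x\<bar> powr \<kappa> - \<bar>x\<bar> powr \<kappa>\<bar> powr r"
  define I where "I = increment_norm \<kappa> r"
  \<comment> \<open>The integrand is the increment at position 1. Up to a constant its weighted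
    \<open>r\<close>-th power is at most 1 plus the \<open>p\<close>-th power of the weighted
    envelope, integrable against the law of the marks.\<close>
  have F_fin: "(\<integral>\<^sup>+x. ennreal (?F x) \<partial>lborel) < \<infinity>"
  proof -
    have "(\<integral>\<^sup>+x. ennreal (?F x) \<partial>lborel) = (\<integral>\<^sup>+v. ennreal (\<bar>weight v powr b * increment \<kappa> 1 v\<bar> powr r) \<partial>?\<nu>)"
      by (subst stable_norm) (auto simp: increment_def)
    also have "\<dots> \<le> (\<integral>\<^sup>+v. ennreal (?c powr r) * (1 + ennreal ((weight v powr b * envelope \<kappa> \<delta> A 1 v) powr p)) \<partial>?\<nu>)"
    proof (rule nn_integral_mono)
      fix v
      let ?w = "weight v powr b * envelope \<kappa> \<delta> A 1 v"
      have w: "0 \<le> ?w" by (simp add: envelope_nonneg)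
      have "\<bar>increment \<kappa> 1 v\<bar> \<le> ?c * envelope \<kappa> \<delta> A 1 v"
        using increment_le_envelope(1)[OF d A(1) A(3), of \<kappa> v] d by simp
      then have "weight v powr b * \<bar>increment \<kappa> 1 v\<bar> \<le> weight v powr b * (?c * envelope \<kappa> \<delta> A 1 v)"
        by (rule mult_left_mono) simp
      then have "\<bar>weight v powr b * increment \<kappa> 1 v\<bar> \<le> ?c * ?w" by (simp add: abs_mult mult_ac)
      then have "\<bar>weight v powr b * increment \<kappa> 1 v\<bar> powr r \<le> (?c * ?w) powr r"
        using r by (intro powr_mono2) auto
      also have "\<dots> = ?c powr r * ?w powr r" by (rule powr_mult)
      also have "\<dots> \<le> ?c powr r * (1 + ?w powr p)"
        using w r rp by (intro mult_left_mono powr_le_one_plus) auto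
      finally show "ennreal (\<bar>weight v powr b * increment \<kappa> 1 v\<bar> powr r) \<le> ennreal (?c powr r) * (1 + ennreal (?w powr p))"
        by (simp add: ennreal_mult[symmetric] ennreal_leI ennreal_plus[symmetric] ennreal_1[symmetric] del: ennreal_plus ennreal_1)
    qed
    also have "\<dots> = ennreal (?c powr r) * (1 + (\<integral>\<^sup>+v. ennreal ((weight v powr b * envelope \<kappa> \<delta> A 1 v) powr p) \<partial>?\<nu>))"
      by (simp add: nn_integral_cmult nn_integral_add \<nu>.emeasure_space_1[simplified])
    also have "\<dots> < \<infinity>"
      using C(3)[OF A(3)] by (simp add: ennreal_mult_less_top)
    finally show ?thesis .
  qed
  have F_int: "integrable lborel ?F" using F_fin by (intro integrableI_nonneg) auto
  have I_nn: "(\<integral>\<^sup>+x. ennreal (?F x) \<partial>lborel) = ennreal I"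
    unfolding I_def increment_norm_def using F_int by (intro nn_integral_eq_integral) auto
  \<comment> \<open>For \<open>\<kappa> = 0\<close> the two powers would cancel almost everywhere;
    here they differ at every point of the interval from 0 to \<open>1 / 2\<close>.\<close>
  have \<kappa>: "\<kappa> \<noteq> 0" using ne by (simp add: \<kappa>_def h_def b_def)
  have I_pos: "0 < I"
    unfolding I_def increment_norm_def
  proof (rule integral_lborel_pos[OF F_int, of "1 / 2"])
    fix y :: real assume y: "0 < y" "y < 1 / 2"
    have "(1 - y) powr \<kappa> \<noteq> y powr \<kappa>"
    proof
      assume eq: "(1 - y) powr \<kappa> = y powr \<kappa>"
      have "((1 - y) powr \<kappa>) powr (1 / \<kappa>) = (y powr \<kappa>) powr (1 / \<kappa>)" by (simp only: eq)
      then have "1 - y = y" using y \<kappa> by (simp add: powr_powr)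
      then show False using y by simp
    qed
    then show "0 < ?F y" using y by simp
  qed auto

  define \<beta> where "\<beta> s = 1 / \<alpha> s" for s
  define \<kappa>' where "\<kappa>' s = H s - 1 / \<alpha> s" for s
  define \<sigma> where "\<sigma> s = scale_factor (\<alpha> s)" for s
  have inv_lip: "lipschitz_at (\<lambda>x. k * (1 / x)) (\<alpha> t)" for k :: real
    by (rule lipschitz_at_DERIV[where D = "- k / (\<alpha> t)\<^sup>2"])
       (use \<alpha>(1)[of t] in \<open>auto intro!: derivative_eq_intros simp: power2_eq_square field_simps\<close>)
  have "lipschitz_at \<beta> t"
    using lipschitz_at_compose[OF lip(1) inv_lip[of 1]] by (simp add: \<beta>_def[abs_def])
  then obtain L1 d1 where L1: "0 \<le> L1" "0 < d1" "\<And>s. \<bar>s - t\<bar> \<le> d1 \<Longrightarrow> \<bar>\<beta> s - \<beta> t\<bar> \<le> L1 * \<bar>s - t\<bar>"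
    by (auto simp: lipschitz_at_def)
  have "lipschitz_at \<kappa>' t"
    using lipschitz_at_add[OF lip(2) lipschitz_at_compose[OF lip(1) inv_lip[of "-1"]]] by (simp add: \<kappa>'_def[abs_def])
  then obtain L2 d2 where L2: "0 \<le> L2" "0 < d2" "\<And>s. \<bar>s - t\<bar> \<le> d2 \<Longrightarrow> \<bar>\<kappa>' s - \<kappa>' t\<bar> \<le> L2 * \<bar>s - t\<bar>"
    by (auto simp: lipschitz_at_def)
  have "lipschitz_at \<sigma> t"
    unfolding \<sigma>_def[abs_def] by (rule lipschitz_at_compose[OF lip(1) scale_factor_lipschitz[OF \<alpha>]])
  then obtain L3 d3 where L3: "0 \<le> L3" "0 < d3" "\<And>s. \<bar>s - t\<bar> \<le> d3 \<Longrightarrow> \<bar>\<sigma> s - \<sigma> t\<bar> \<le> L3 * \<bar>s - t\<bar>"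
    by (auto simp: lipschitz_at_def)
  \<comment> \<open>The last two entries keep the drift of both exponents within
    \<open>\<delta> / 2\<close>, the range of the envelope bounds.\<close>
  define \<epsilon>0 where "\<epsilon>0 = Min {d1, d2, d3, 1, \<delta> / (2 * (L1 + 1)), \<delta> / (2 * (L2 + 1))}"
  have e0: "0 < \<epsilon>0" using L1 L2 L3 d by (simp add: \<epsilon>0_def)
  \<comment> \<open>The summand 1 ensures \<open>0 < Q\<close> even when both Lipschitz constants
    are 0, as the series bound asks for a positive scale.\<close>
  define Q where "Q = ?c * (L1 * (2 / \<delta>) + L2 + 1)"
  have Q: "0 < Q" unfolding Q_def using c L1 L2 d by (intro mult_pos_pos add_nonneg_pos add_nonneg_nonneg mult_nonneg_nonneg) auto
  have \<sigma>: "0 < \<sigma> t" "\<sigma> t powr r * stable_const r = 1"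
    unfolding \<sigma>_def r_def using scale_factor_powr[OF \<alpha>] by auto
  define Kc where "Kc = 2 powr (\<eta> - 1) * Gamma (1 - \<eta> / r) / (\<eta> * sine_const \<eta>) * I powr (\<eta> / r)"
  have Gp: "0 < Gamma (1 - \<eta> / r)" using r e by (intro Gamma_real_pos) simp
  have sp: "0 < sine_const \<eta>" using r e by (intro sine_const_pos) auto
  have Kc: "0 < Kc" unfolding Kc_def using Gp sp I_pos e by simp
  \<comment> \<open>4 is the constant of \<open>powr_abs_add_le\<close>; the two summands stem from
    the change of the scale factor and of the exponents.\<close>
  define Mc where "Mc = 4 * (L3 powr \<eta> * (C * ?c powr \<eta>) + \<sigma> t powr \<eta> * (C * Q powr \<eta>))"
  have Mc: "0 \<le> Mc" unfolding Mc_def using C(1) by simp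
  let ?N = "\<lambda>\<epsilon>. expectation (\<lambda>\<omega>. \<bar>motion \<alpha> H (t + \<epsilon>) \<omega> - motion \<alpha> H t \<omega>\<bar> powr \<eta>)"

  have bounds: "?N \<epsilon> \<le> (1 + d) powr \<eta> * (Kc * \<epsilon> powr (\<eta> * h)) + (1 + 1 / d) powr \<eta> * (Mc * \<epsilon> powr \<eta>)
      \<and> Kc * \<epsilon> powr (\<eta> * h) \<le> (1 + d) powr \<eta> * ?N \<epsilon> + (1 + 1 / d) powr \<eta> * (Mc * \<epsilon> powr \<eta>)"
    if \<epsilon>: "0 < \<epsilon>" "\<epsilon> < \<epsilon>0" and dpos: "0 < d" for \<epsilon> d
  proof -
    define s where "s = t + \<epsilon>"
    have eps: "\<epsilon> \<le> d1" "\<epsilon> \<le> d2" "\<epsilon> \<le> d3" "\<epsilon> \<le> 1" "\<epsilon> \<le> \<delta> / (2 * (L1 + 1))" "\<epsilon> \<le> \<delta> / (2 * (L2 + 1))"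
      using \<epsilon> by (auto simp: \<epsilon>0_def)
    have st: "\<bar>s - t\<bar> = \<epsilon>" using \<epsilon> by (simp add: s_def)
    have sA: "\<bar>s\<bar> \<le> A" using eps \<epsilon> by (simp add: s_def A_def)
    have \<beta>s: "\<bar>\<beta> s - b\<bar> \<le> L1 * \<epsilon>" using L1(3)[of s] st eps by (simp add: \<beta>_def b_def)
    have \<kappa>s: "\<bar>\<kappa>' s - \<kappa>\<bar> \<le> L2 * \<epsilon>" using L2(3)[of s] st eps by (simp add: \<kappa>'_def \<kappa>_def b_def h_def)
    have \<sigma>s: "\<bar>\<sigma> s - \<sigma> t\<bar> \<le> L3 * \<epsilon>" using L3(3)[of s] st eps by simp
    have half: "L * \<epsilon> \<le> \<delta> / 2" if "0 \<le> L" "\<epsilon> \<le> \<delta> / (2 * (L + 1))" for L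
    proof -
      have "L * \<epsilon> \<le> (L + 1) * \<epsilon>" using \<epsilon> by (simp add: distrib_right)
      also have "\<dots> \<le> (L + 1) * (\<delta> / (2 * (L + 1)))" using that by (intro mult_left_mono) auto
      also have "\<dots> = \<delta> / 2" using that by (simp add: field_simps)
      finally show ?thesis .
    qed
    have \<beta>2: "\<bar>\<beta> s - b\<bar> \<le> \<delta> / 2" using \<beta>s half[OF L1(1) eps(5)] by simp
    have \<kappa>2: "\<bar>\<kappa>' s - \<kappa>\<bar> \<le> \<delta> / 2" using \<kappa>s half[OF L2(1) eps(6)] by simp
    have z: "\<bar>b - b\<bar> \<le> \<delta> / 2" "\<bar>\<kappa> - \<kappa>\<bar> \<le> \<delta> / 2" using d by auto
    \<comment> \<open>\<open>?Kf\<close> has the new position and the old exponents and so separates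
      the two effects.\<close>
    let ?Kt = "kern t b \<kappa>" and ?Ks = "kern s (\<beta> s) (\<kappa>' s)" and ?Kf = "kern s b \<kappa>"
    define D where "D z = ?Ks z + (- 1) * ?Kf z" for z
    have Dm[measurable]: "D \<in> borel_measurable (borel \<Otimes>\<^sub>M borel)" unfolding D_def[abs_def] by measurable
    have convt: "series_converges ?Kt"
      by (rule C(2)[OF kern_measurable A(2) c, THEN conjunct1]) (rule kern_le(1)[OF _ d A(1,2) z(2,1)])
    have convf: "series_converges ?Kf"
      by (rule C(2)[OF kern_measurable sA c, THEN conjunct1]) (rule kern_le(1)[OF _ d A(1) sA z(2,1)])
    have Ks: "series_converges ?Ks" "(\<integral>\<^sup>+\<omega>. ennreal (\<bar>series ?Ks \<omega>\<bar> powr \<eta>) \<partial>M) \<le> ennreal (C * ?c powr \<eta>)"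
      using C(2)[OF kern_measurable sA c kern_le(1)[OF _ d A(1) sA \<kappa>2 \<beta>2]] by auto
    have D_le: "\<bar>D (x, v)\<bar> \<le> (Q * \<epsilon>) * (two_powers (- b) \<delta> (x / weight v) * envelope \<kappa> \<delta> A s v)" if x: "0 < x" for x v
    proof -
      have "\<bar>D (x, v)\<bar> \<le> (?c * (\<bar>\<beta> s - b\<bar> * (2 / \<delta>) + \<bar>\<kappa>' s - \<kappa>\<bar>)) * (two_powers (- b) \<delta> (x / weight v) * envelope \<kappa> \<delta> A s v)"
        using kern_le(2)[OF x d A(1) sA \<kappa>2 \<beta>2, of v] by (simp add: D_def)
      also have "\<dots> \<le> (Q * \<epsilon>) * (two_powers (- b) \<delta> (x / weight v) * envelope \<kappa> \<delta> A s v)"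
      proof (intro mult_right_mono mult_nonneg_nonneg two_powers_nonneg envelope_nonneg)
        have "\<bar>\<beta> s - b\<bar> * (2 / \<delta>) + \<bar>\<kappa>' s - \<kappa>\<bar> \<le> (L1 * \<epsilon>) * (2 / \<delta>) + L2 * \<epsilon>"
          using \<beta>s \<kappa>s d by (intro add_mono mult_right_mono) auto
        also have "\<dots> \<le> (L1 * (2 / \<delta>) + L2 + 1) * \<epsilon>" using \<epsilon> by (simp add: algebra_simps)
        finally have "?c * (\<bar>\<beta> s - b\<bar> * (2 / \<delta>) + \<bar>\<kappa>' s - \<kappa>\<bar>) \<le> ?c * ((L1 * (2 / \<delta>) + L2 + 1) * \<epsilon>)"
          using c by (intro mult_left_mono) auto
        then show "?c * (\<bar>\<beta> s - b\<bar> * (2 / \<delta>) + \<bar>\<kappa>' s - \<kappa>\<bar>) \<le> Q * \<epsilon>" by (simp add: Q_def mult.assoc)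
      qed
      finally show ?thesis .
    qed
    have Qe: "0 < Q * \<epsilon>" using Q \<epsilon> by simp
    have D: "series_converges D" "(\<integral>\<^sup>+\<omega>. ennreal (\<bar>series D \<omega>\<bar> powr \<eta>) \<partial>M) \<le> ennreal (C * (Q * \<epsilon>) powr \<eta>)"
      using C(2)[OF Dm sA Qe D_le] by auto
    define k where "k v = weight v powr b * (increment \<kappa> s v - increment \<kappa> t v)" for v
    have [measurable]: "k \<in> borel_measurable borel" unfolding k_def[abs_def] by measurable
    let ?P = "\<lambda>(x, v). x powr (- 1 / r) * k v"
    have P_eq: "?P = (\<lambda>z. ?Kf z + (- 1) * ?Kt z)"
      by (auto simp: kern_def k_def fun_eq_iff r_def b_def algebra_simps)
    note mt = series_scale[OF convt, of "- 1"]
    have P: "series_converges ?P" "AE \<omega> in M. series ?P \<omega> = series ?Kf \<omega> - series ?Kt \<omega>"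
    proof -
      show "series_converges ?P" unfolding P_eq by (rule series_converges_add(1)[OF convf mt(1)])
      show "AE \<omega> in M. series ?P \<omega> = series ?Kf \<omega> - series ?Kt \<omega>"
        using series_converges_add(2)[OF convf mt(1)] mt(2) unfolding P_eq by eventually_elim simp
    qed
    note mf = series_scale[OF convf, of "- 1"]
    have DS: "AE \<omega> in M. series D \<omega> = series ?Ks \<omega> - series ?Kf \<omega>"
      using series_converges_add(2)[OF Ks(1) mf(1)] mf(2) unfolding D_def[abs_def] by eventually_elim simp
    have [measurable]: "?P \<in> borel_measurable (borel \<Otimes>\<^sub>M borel)" by measurable
    let ?A = "\<lambda>\<omega>. \<sigma> t * series ?P \<omega>" and ?B = "\<lambda>\<omega>. (\<sigma> s - \<sigma> t) * series ?Ks \<omega> + \<sigma> t * series D \<omega>"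
    let ?Y = "\<lambda>\<omega>. motion \<alpha> H s \<omega> - motion \<alpha> H t \<omega>"
    have Am: "?A \<in> borel_measurable M" and Bm: "?B \<in> borel_measurable M" and Ym: "?Y \<in> borel_measurable M"
      by measurable
    have Y: "AE \<omega> in M. ?Y \<omega> = ?A \<omega> + ?B \<omega>"
      using P(2) DS
    proof eventually_elim
      case (elim \<omega>)
      have "motion \<alpha> H s \<omega> = \<sigma> s * series ?Ks \<omega>" by (simp add: motion_def \<sigma>_def \<beta>_def \<kappa>'_def)
      moreover have "motion \<alpha> H t \<omega> = \<sigma> t * series ?Kt \<omega>" by (simp add: motion_def \<sigma>_def \<kappa>_def h_def b_def)
      ultimately show ?case unfolding elim by (simp add: algebra_simps)
    qed
    have mom_A: "(\<integral>\<^sup>+\<omega>. ennreal (\<bar>?A \<omega>\<bar> powr \<eta>) \<partial>M) = ennreal (Kc * \<epsilon> powr (\<eta> * h))"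
    proof -
      define m where "m = \<epsilon> powr (r * h) * I"
      have m0: "0 \<le> m" using I_pos by (simp add: m_def)
      have "(\<integral>\<^sup>+v. ennreal (\<bar>k v\<bar> powr r) \<partial>?\<nu>) = (\<integral>\<^sup>+v. ennreal (\<bar>increment \<kappa> s v - increment \<kappa> t v\<bar> powr r) \<partial>lborel)"
        unfolding k_def by (rule stable_norm) measurable
      also have "\<dots> = ennreal (\<epsilon> powr (1 + \<kappa> * r)) * ennreal I"
        using nn_integral_increment_scaled[of t s \<kappa> r] \<epsilon> by (simp add: I_nn s_def)
      \<comment> \<open>With \<open>\<kappa> = h - 1 / r\<close> the scaling exponent is
        \<open>r * h\<close>, the source of the power \<open>\<eta> * h\<close> of
        \<open>\<epsilon>\<close>.\<close>
      also have "1 + \<kappa> * r = r * h" using r(4) by (simp add: \<kappa>_def algebra_simps)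
      also have "ennreal (\<epsilon> powr (r * h)) * ennreal I = ennreal m"
        using I_pos by (simp add: m_def ennreal_mult)
      finally have km: "(\<integral>\<^sup>+v. ennreal (\<bar>k v\<bar> powr r) \<partial>?\<nu>) = ennreal m" .
      have "(\<integral>\<^sup>+\<omega>. ennreal (\<bar>?A \<omega>\<bar> powr \<eta>) \<partial>M) = (\<integral>\<^sup>+\<omega>. ennreal (\<sigma> t powr \<eta>) * ennreal (\<bar>series ?P \<omega>\<bar> powr \<eta>) \<partial>M)"
        using \<sigma> by (intro nn_integral_cong) (simp add: abs_mult powr_mult ennreal_mult)
      also have "\<dots> = ennreal (\<sigma> t powr \<eta>) * (\<integral>\<^sup>+\<omega>. ennreal (\<bar>series ?P \<omega>\<bar> powr \<eta>) \<partial>M)"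
        by (rule nn_integral_cmult) measurable
      also have "\<dots> = ennreal (\<sigma> t powr \<eta>) * ennreal (2 powr (\<eta> - 1) * Gamma (1 - \<eta> / r) / (\<eta> * sine_const \<eta>) * (stable_const r * m) powr (\<eta> / r))"
        by (subst stable_series_abs_moment[OF _ e(1) r(3,2) m0 km P(1)]) auto
      also have "\<dots> = ennreal (\<sigma> t powr \<eta> * (2 powr (\<eta> - 1) * Gamma (1 - \<eta> / r) / (\<eta> * sine_const \<eta>) * (stable_const r * m) powr (\<eta> / r)))"
        using Gp sp e by (intro ennreal_mult[symmetric]) auto
      also have "\<sigma> t powr \<eta> * (2 powr (\<eta> - 1) * Gamma (1 - \<eta> / r) / (\<eta> * sine_const \<eta>) * (stable_const r * m) powr (\<eta> / r))
          = Kc * \<epsilon> powr (\<eta> * h)"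
      proof -
        have "\<sigma> t powr \<eta> = (\<sigma> t powr r) powr (\<eta> / r)" using r by (simp add: powr_powr)
        then have "\<sigma> t powr \<eta> * (stable_const r * m) powr (\<eta> / r) = (\<sigma> t powr r * (stable_const r * m)) powr (\<eta> / r)"
          by (simp only: powr_mult)
        \<comment> \<open>Here the choice of the scale factor removes
          \<open>stable_const\<close>.\<close>
        also have "\<sigma> t powr r * (stable_const r * m) = m" using \<sigma>(2) by (simp add: mult.assoc[symmetric])
        also have "m powr (\<eta> / r) = \<epsilon> powr (\<eta> * h) * I powr (\<eta> / r)"
          using r by (simp add: m_def powr_mult powr_powr mult.commute)
        finally show ?thesis by (simp add: Kc_def mult_ac)
      qed
      finally show ?thesis .
    qed
    have mom_B: "(\<integral>\<^sup>+\<omega>. ennreal (\<bar>?B \<omega>\<bar> powr \<eta>) \<partial>M) \<le> ennreal (Mc * \<epsilon> powr \<eta>)"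
    proof -
      have "(\<integral>\<^sup>+\<omega>. ennreal (\<bar>?B \<omega>\<bar> powr \<eta>) \<partial>M)
          \<le> (\<integral>\<^sup>+\<omega>. ennreal (4 * (L3 * \<epsilon>) powr \<eta>) * ennreal (\<bar>series ?Ks \<omega>\<bar> powr \<eta>)
            + ennreal (4 * \<sigma> t powr \<eta>) * ennreal (\<bar>series D \<omega>\<bar> powr \<eta>) \<partial>M)"
      proof (rule nn_integral_mono)
        fix \<omega>
        have "\<bar>?B \<omega>\<bar> powr \<eta> \<le> 4 * (\<bar>(\<sigma> s - \<sigma> t) * series ?Ks \<omega>\<bar> powr \<eta> + \<bar>\<sigma> t * series D \<omega>\<bar> powr \<eta>)"
          using e r by (intro powr_abs_add_le) auto
        also have "\<dots> \<le> 4 * ((L3 * \<epsilon>) powr \<eta> * \<bar>series ?Ks \<omega>\<bar> powr \<eta> + \<sigma> t powr \<eta> * \<bar>series D \<omega>\<bar> powr \<eta>)"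
        proof (intro mult_left_mono add_mono)
          have "\<bar>\<sigma> s - \<sigma> t\<bar> powr \<eta> \<le> (L3 * \<epsilon>) powr \<eta>" using \<sigma>s e by (intro powr_mono2) auto
          then show "\<bar>(\<sigma> s - \<sigma> t) * series ?Ks \<omega>\<bar> powr \<eta> \<le> (L3 * \<epsilon>) powr \<eta> * \<bar>series ?Ks \<omega>\<bar> powr \<eta>"
            by (simp only: abs_mult powr_mult[of "\<bar>\<sigma> s - \<sigma> t\<bar>"]) (rule mult_right_mono, simp_all)
          show "\<bar>\<sigma> t * series D \<omega>\<bar> powr \<eta> \<le> \<sigma> t powr \<eta> * \<bar>series D \<omega>\<bar> powr \<eta>"
            using \<sigma> by (simp add: abs_mult powr_mult)
        qed simp
        also have "\<dots> = (4 * (L3 * \<epsilon>) powr \<eta>) * \<bar>series ?Ks \<omega>\<bar> powr \<eta> + (4 * \<sigma> t powr \<eta>) * \<bar>series D \<omega>\<bar> powr \<eta>"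
          by (simp add: algebra_simps)
        finally have "ennreal (\<bar>?B \<omega>\<bar> powr \<eta>)
            \<le> ennreal ((4 * (L3 * \<epsilon>) powr \<eta>) * \<bar>series ?Ks \<omega>\<bar> powr \<eta> + (4 * \<sigma> t powr \<eta>) * \<bar>series D \<omega>\<bar> powr \<eta>)"
          by (rule ennreal_leI)
        also have "\<dots> = ennreal (4 * (L3 * \<epsilon>) powr \<eta>) * ennreal (\<bar>series ?Ks \<omega>\<bar> powr \<eta>)
            + ennreal (4 * \<sigma> t powr \<eta>) * ennreal (\<bar>series D \<omega>\<bar> powr \<eta>)"
          by (subst ennreal_plus, simp, simp, subst ennreal_mult, simp, simp, subst ennreal_mult, simp, simp, rule refl)
        finally show "ennreal (\<bar>?B \<omega>\<bar> powr \<eta>) \<le> \<dots>" .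
      qed
      also have "\<dots> = ennreal (4 * (L3 * \<epsilon>) powr \<eta>) * (\<integral>\<^sup>+\<omega>. ennreal (\<bar>series ?Ks \<omega>\<bar> powr \<eta>) \<partial>M)
          + ennreal (4 * \<sigma> t powr \<eta>) * (\<integral>\<^sup>+\<omega>. ennreal (\<bar>series D \<omega>\<bar> powr \<eta>) \<partial>M)"
        by (subst nn_integral_add, measurable, subst nn_integral_cmult, measurable, subst nn_integral_cmult, measurable)
      also have "\<dots> \<le> ennreal (4 * (L3 * \<epsilon>) powr \<eta>) * ennreal (C * ?c powr \<eta>)
          + ennreal (4 * \<sigma> t powr \<eta>) * ennreal (C * (Q * \<epsilon>) powr \<eta>)"
        using Ks(2) D(2) by (intro add_mono mult_left_mono) auto
      also have "\<dots> = ennreal ((4 * (L3 * \<epsilon>) powr \<eta>) * (C * ?c powr \<eta>) + (4 * \<sigma> t powr \<eta>) * (C * (Q * \<epsilon>) powr \<eta>))"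
        using C(1) by (subst ennreal_plus, simp, simp, subst ennreal_mult, simp, simp, subst ennreal_mult, simp, simp, intro refl)
      also have "(4 * (L3 * \<epsilon>) powr \<eta>) * (C * ?c powr \<eta>) + (4 * \<sigma> t powr \<eta>) * (C * (Q * \<epsilon>) powr \<eta>) = Mc * \<epsilon> powr \<eta>"
        by (simp add: Mc_def powr_mult algebra_simps)
      finally show ?thesis .
    qed
    define x where "x = ennreal ((1 + d) powr \<eta>)"
    define y where "y = ennreal ((1 + 1 / d) powr \<eta>)"
    have up: "(\<integral>\<^sup>+\<omega>. ennreal (\<bar>?Y \<omega>\<bar> powr \<eta>) \<partial>M) \<le> x * ennreal (Kc * \<epsilon> powr (\<eta> * h)) + y * ennreal (Mc * \<epsilon> powr \<eta>)"
      unfolding x_def y_def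
      by (rule order_trans[OF nn_integral_powr_perturb[OF Am Bm Ym Y e(1) dpos]])
         (intro add_mono mult_left_mono, simp_all only: mom_A mom_B order.refl zero_le)
    have up': "\<dots> = ennreal ((1 + d) powr \<eta> * (Kc * \<epsilon> powr (\<eta> * h)) + (1 + 1 / d) powr \<eta> * (Mc * \<epsilon> powr \<eta>))"
      unfolding x_def y_def using Kc Mc by (simp add: ennreal_mult)
    have Yi: "integrable M (\<lambda>\<omega>. \<bar>?Y \<omega>\<bar> powr \<eta>)"
    proof (rule integrableI_nonneg)
      show "(\<integral>\<^sup>+\<omega>. ennreal (\<bar>?Y \<omega>\<bar> powr \<eta>) \<partial>M) < \<infinity>" using up unfolding up' by (rule le_less_trans) simp
    qed auto
    have YN: "(\<integral>\<^sup>+\<omega>. ennreal (\<bar>?Y \<omega>\<bar> powr \<eta>) \<partial>M) = ennreal (?N \<epsilon>)"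
      using Yi by (subst nn_integral_eq_integral) (auto simp: s_def)
    have N0: "0 \<le> ?N \<epsilon>" by simp
    have mB: "(\<lambda>\<omega>. - ?B \<omega>) \<in> borel_measurable M" using Bm by measurable
    have AY: "AE \<omega> in M. ?A \<omega> = ?Y \<omega> + - ?B \<omega>" using Y by eventually_elim simp
    have "ennreal (Kc * \<epsilon> powr (\<eta> * h)) \<le> x * ennreal (?N \<epsilon>) + y * ennreal (Mc * \<epsilon> powr \<eta>)"
      unfolding x_def y_def mom_A[symmetric] YN[symmetric]
      by (rule order_trans[OF nn_integral_powr_perturb[OF Ym mB Am AY e(1) dpos]])
         (intro add_mono mult_left_mono order.refl, simp_all only: abs_minus_cancel mom_B zero_le)
    also have "\<dots> = ennreal ((1 + d) powr \<eta> * ?N \<epsilon> + (1 + 1 / d) powr \<eta> * (Mc * \<epsilon> powr \<eta>))"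
      unfolding x_def y_def using N0 Mc by (simp add: ennreal_mult)
    finally have "Kc * \<epsilon> powr (\<eta> * h) \<le> (1 + d) powr \<eta> * ?N \<epsilon> + (1 + 1 / d) powr \<eta> * (Mc * \<epsilon> powr \<eta>)"
      using N0 Mc by (subst (asm) ennreal_le_iff) (auto intro!: add_nonneg_nonneg mult_nonneg_nonneg)
    moreover have "?N \<epsilon> \<le> (1 + d) powr \<eta> * (Kc * \<epsilon> powr (\<eta> * h)) + (1 + 1 / d) powr \<eta> * (Mc * \<epsilon> powr \<eta>)"
      using up Kc Mc unfolding up' YN by (subst (asm) ennreal_le_iff) (auto intro!: add_nonneg_nonneg mult_nonneg_nonneg)
    ultimately show ?thesis by blast
  qed
  have "((\<lambda>\<epsilon>. ?N \<epsilon> / (Kc * \<epsilon> powr (\<eta> * h))) \<longlongrightarrow> 1) (at_right 0)"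
    using H bounds by (intro ratio_tendsto_one[OF Kc Mc _ e(1) e0]) (auto simp: h_def)
  then show ?thesis by (simp only: Kc_def I_def h_def r_def b_def \<kappa>_def)
qed

end

section \<open>From the Poisson data to the LePage setting\<close>

lemma C1_differentiable_imp_lipschitz_at:
  fixes f :: "real \<Rightarrow> real"
  assumes "f C1_differentiable_on UNIV"
  shows "lipschitz_at f t"
proof -
  from assms obtain D where "\<And>x. (f has_vector_derivative D x) (at x)"
    by (auto simp: C1_differentiable_on_def)
  then have "(f has_real_derivative D t) (at t)" by (simp add: has_real_derivative_iff_has_vector_derivative)
  then show ?thesis by (rule lipschitz_at_DERIV)
qed

text \<open>Independence from marks and signs is given for the sequence of arrival times. Taking
  differences is a measurable map of the sequence space, so it passes to the waiting times; together
  with independence within each sequence this yields the doubly indexed family.\<close>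

lemma (in prob_space) lmmm_series_of_poisson:
  assumes poisson: "poisson_arrival_times 1 \<Gamma>" and V: "iid_density m_hat_density V" and \<gamma>: "iid_signs \<gamma>"
    and indep: "indep_sequences [\<Gamma>, V, \<gamma>]"
  obtains T where "lmmm_series M T V \<gamma>" "\<And>i \<omega>. \<omega> \<in> space M \<Longrightarrow> \<Gamma> i \<omega> = (\<Sum>k\<le>i. T k \<omega>)"
proof -
  from poisson obtain T where T: "indep_vars (\<lambda>_. borel) T UNIV"
    "\<And>i. distributed M lborel (T i) (exponential_density 1)"
    "\<And>i \<omega>. \<omega> \<in> space M \<Longrightarrow> \<Gamma> i \<omega> = (\<Sum>k\<le>i. T k \<omega>)"
    unfolding poisson_arrival_times_def by blast
  \<comment> \<open>Only component 0 is transformed; the first waiting time is the first arrival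
    time itself.\<close>
  define Y where "Y n f = (if n = (0::nat) then (\<lambda>i. if i = 0 then f 0 else f i - f (i - 1)) else f)"
    for n and f :: "nat \<Rightarrow> real"
  have "indep_vars (\<lambda>_. Pi\<^sub>M UNIV (\<lambda>_. borel)) (\<lambda>n \<omega>. Y n (\<lambda>i. ([\<Gamma>, V, \<gamma>] ! n) i \<omega>)) {..<length [\<Gamma>, V, \<gamma>]}"
  proof (rule indep_vars_compose2[OF indep[unfolded indep_sequences_def]])
    fix n
    have proj: "(\<lambda>f::nat \<Rightarrow> real. f i) \<in> borel_measurable (Pi\<^sub>M UNIV (\<lambda>_. borel))" for i
      by (rule measurable_component_singleton) simp
    have "(\<lambda>f::nat \<Rightarrow> real. Y n f i) \<in> borel_measurable (Pi\<^sub>M UNIV (\<lambda>_. borel))" for i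
      unfolding Y_def using proj by (cases "n = 0"; cases "i = 0") (auto intro!: borel_measurable_diff)
    then show "Y n \<in> measurable (Pi\<^sub>M UNIV (\<lambda>_. borel)) (Pi\<^sub>M UNIV (\<lambda>_. borel))"
      by (intro measurable_PiM_single') (auto simp: space_PiM)
  qed
  note differences = this
  have len: "length [\<Gamma>, V, \<gamma>] = 3" by simp
  have "indep_vars (\<lambda>_. Pi\<^sub>M UNIV (\<lambda>_. borel)) (\<lambda>n \<omega> i. ([T, V, \<gamma>] ! n) i \<omega>) {..<3}"
  proof (rule indep_vars_cong_space[OF differences[unfolded len]])
    fix n \<omega> assume "n \<in> {..<3::nat}" and \<omega>: "\<omega> \<in> space M"
    then consider "n = 0" | "n = 1" | "n = 2" by force
    then show "Y n (\<lambda>i. ([\<Gamma>, V, \<gamma>] ! n) i \<omega>) = (\<lambda>i. ([T, V, \<gamma>] ! n) i \<omega>)"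
    proof cases
      case 1
      have "\<Gamma> i \<omega> - \<Gamma> (i - 1) \<omega> = T i \<omega>" if "i \<noteq> 0" for i
        using that by (cases i) (auto simp: T(3)[OF \<omega>])
      then show ?thesis using 1 by (auto simp: Y_def fun_eq_iff T(3)[OF \<omega>])
    qed (simp_all add: Y_def)
  qed
  moreover have "indep_vars (\<lambda>_. borel) ([T, V, \<gamma>] ! n) UNIV" if "n \<in> {..<3}" for n
  proof -
    from that consider "n = 0" | "n = 1" | "n = 2" by force
    then show ?thesis using T(1) V \<gamma> by cases (simp_all add: iid_density_def iid_signs_def)
  qed
  ultimately have ind: "indep_vars (\<lambda>_. borel) (\<lambda>(n, i). ([T, V, \<gamma>] ! n) i) ({..<3} \<times> UNIV)"
    by (rule indep_vars_blocks)
  have "lmmm_series M T V \<gamma>"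
    unfolding lmmm_series_def
  proof unfold_locales
    show "indep_vars (\<lambda>_. borel) (\<lambda>(n, i). ([T, V, \<gamma>] ! n) i) ({..<3} \<times> UNIV)" by (rule ind)
    show "distributed M lborel (T i) (\<lambda>x. ennreal (exponential_density 1 x))" for i by (rule T(2))
    show "distr M borel (V i) = density lborel (\<lambda>v. ennreal (m_hat_density v))" for i
    proof -
      have "distributed M lborel (V i) (\<lambda>x. ennreal (m_hat_density x))" using V by (simp add: iid_density_def)
      then have "distr M lborel (V i) = density lborel (\<lambda>v. ennreal (m_hat_density v))"
        by (rule distributed_distr_eq_density)
      then show ?thesis by (simp cong: distr_cong)
    qed
    show "prob {\<omega> \<in> space M. \<gamma> i \<omega> = \<sigma>} = 1 / 2" if "\<sigma> \<in> {1, -1}" for i \<sigma>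
      using \<gamma> that by (auto simp: iid_signs_def)
  qed
  then show thesis using T(3) by (rule that)
qed

theorem theorem3:
  fixes M :: "'a measure"
    and \<alpha> H :: "real \<Rightarrow> real" and c d t \<eta> :: real
    and \<Gamma> V \<gamma> :: "nat \<Rightarrow> 'a \<Rightarrow> real"
  assumes "prob_space M"
    and "{c..d} \<subseteq> {0<..<2}" and "range \<alpha> \<subseteq> {c..d}" and "range H \<subseteq> {0<..<1}"
    and "\<alpha> C1_differentiable_on UNIV" and "H C1_differentiable_on UNIV"
    and "prob_space.poisson_arrival_times M 1 \<Gamma>"
    and "prob_space.iid_density M m_hat_density V"
    and "prob_space.iid_signs M \<gamma>"
    and "prob_space.indep_sequences M [\<Gamma>, V, \<gamma>]"
    and "0 < \<eta>" and "\<eta> < c"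
    and "H t \<noteq> 1 / \<alpha> t"  (* otherwise the right-hand side vanishes and the ratio is undefined *)
  shows "(\<lambda>\<epsilon>. prob_space.expectation M
              (\<lambda>\<omega>. \<bar>lmmm \<alpha> H \<Gamma> V \<gamma> (t + \<epsilon>) \<omega> - lmmm \<alpha> H \<Gamma> V \<gamma> t \<omega>\<bar> powr \<eta>))
         \<sim>[at_right 0]
         (\<lambda>\<epsilon>. 2 powr (\<eta> - 1) * Gamma (1 - \<eta> / \<alpha> t) /
              (\<eta> * (LBINT u:{0<..}. u powr (- \<eta> - 1) * (sin u)\<^sup>2)) *
              (LBINT x. \<bar>\<bar>1 - x\<bar> powr (H t - 1 / \<alpha> t) - \<bar>x\<bar> powr (H t - 1 / \<alpha> t)\<bar> powr \<alpha> t)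
                powr (\<eta> / \<alpha> t) *
              \<epsilon> powr (\<eta> * H t))"
proof -
  interpret prob_space M by fact
  obtain T where "lmmm_series M T V \<gamma>" and \<Gamma>: "\<And>i \<omega>. \<omega> \<in> space M \<Longrightarrow> \<Gamma> i \<omega> = (\<Sum>k\<le>i. T k \<omega>)"
    using lmmm_series_of_poisson[OF assms(7-10)] by metis
  then interpret lmmm_series M T V \<gamma> by simp
  \<comment> \<open>The lower bound \<open>c\<close> turns \<open>\<eta> < c\<close> into
    \<open>\<eta> < \<alpha> t\<close>.\<close>
  have \<alpha>: "0 < \<alpha> u" "\<alpha> u < 2" "c \<le> \<alpha> u" for u
  proof -
    have "\<alpha> u \<in> {c..d}" by (rule subsetD[OF assms(3) rangeI])
    with assms(2) show "0 < \<alpha> u" "\<alpha> u < 2" "c \<le> \<alpha> u" by auto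
  qed
  have H: "0 < H t" "H t < 1" using subsetD[OF assms(4) rangeI[of H t]] by auto
  have "lmmm \<alpha> H \<Gamma> V \<gamma> s \<omega> = motion \<alpha> H s \<omega>" if "\<omega> \<in> space M" for s \<omega>
    unfolding lmmm_def motion_def by (rule lmmm_field_eq) (simp add: arrival_def \<Gamma>[OF that])
  then have "expectation (\<lambda>\<omega>. \<bar>lmmm \<alpha> H \<Gamma> V \<gamma> (t + \<epsilon>) \<omega> - lmmm \<alpha> H \<Gamma> V \<gamma> t \<omega>\<bar> powr \<eta>)
      = expectation (\<lambda>\<omega>. \<bar>motion \<alpha> H (t + \<epsilon>) \<omega> - motion \<alpha> H t \<omega>\<bar> powr \<eta>)" for \<epsilon>
    by (intro Bochner_Integration.integral_cong) auto
  moreover have "((\<lambda>\<epsilon>. expectation (\<lambda>\<omega>. \<bar>motion \<alpha> H (t + \<epsilon>) \<omega> - motion \<alpha> H t \<omega>\<bar> powr \<eta>) /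
      (2 powr (\<eta> - 1) * Gamma (1 - \<eta> / \<alpha> t) / (\<eta> * sine_const \<eta>) *
        increment_norm (H t - 1 / \<alpha> t) (\<alpha> t) powr (\<eta> / \<alpha> t) * \<epsilon> powr (\<eta> * H t))) \<longlongrightarrow> 1) (at_right 0)"
    using assms(11-13) \<alpha>(3)[of t] H
    by (intro motion_increment_moment \<alpha> C1_differentiable_imp_lipschitz_at assms(5,6)) auto
  ultimately show ?thesis
    unfolding sine_const_def increment_norm_def by (intro asymp_equivI') simp
qed

end
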